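(* Let $\varphi(t)$ be a smooth one-parameter family of $G_2$-structures on a smooth 7-manifold $M$ evolving by the general flow $$\frac{\partial}{\partial t}\varphi_{ijk} = h^l_i\varphi_{ljk} + h^l_j\varphi_{ilk} + h^l_k\varphi_{ijl} + X^l\psi_{lijk},$$ where $h=h(t)$ is a symmetric 2-tensor, $X=X(t)$ is a vector field, and $h^l_i = g^{lm}h_{im}$. Then the full torsion tensor $T_{pq}$ of $\varphi(t)$ evolves by $$\frac{\partial}{\partial t}T_{pq} = T_{pl}\,g^{lm}h_{mq} + T_{pl}\,g^{lm}X_{mq} + (\nabla_k h_{ip})\,g^{ka}g^{ib}\varphi_{abq} + \nabla_p X_q,$$ where $X_j = g_{jk}X^k$ and $X_{ij} = X^k\varphi_{kij}$.
   Context: Index notation in local coordinates $x^1,\dots,x^7$, with the summation convention; differential forms are written $\alpha=\frac{1}{k!}\alpha_{i_1\cdots i_k}dx^{i_1}\wedge\cdots\wedge dx^{i_k}$ with skew-symmetric coefficients. A $G_2$-structure on a smooth 7-manifold $M$ is a smooth 3-form $\varphi$ which at each point is equivalent, under a linear isomorphism $T_xM\cong\mathbb{R}^7$, to $e^{123}+e^{145}+e^{167}+e^{246}-e^{257}-e^{347}-e^{356}$. It determines a unique Riemannian metric $g$ and orientation (volume form $\mathsf{vol}$) by the convention $(u\lrcorner\varphi)\wedge(v\lrcorner\varphi)\wedge\varphi=-6\,g(u,v)\,\mathsf{vol}$. Let $*$ be the Hodge star, $\psi=*\varphi$ the dual 4-form, $\nabla$ the Levi-Civita connection of $g$. The full torsion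 tensor $T_{lm}$ is the (unique) 2-tensor with $\nabla_l\varphi_{abc}=T_{lm}g^{mn}\psi_{nabc}$. In the flow, $g,\psi,\nabla,T$ are those determined by $\varphi(t)$ at time $t$. *)

theory Defs
  imports "HOL-Analysis.Analysis"
begin

section \<open>Smooth functions\<close>

text \<open>Meaningful for open \<open>S\<close>.\<close>

primrec Ck_on :: "nat \<Rightarrow> ('v::euclidean_space \<Rightarrow> 'w::real_normed_vector) \<Rightarrow> 'v set \<Rightarrow> bool" where
  "Ck_on 0 f S \<longleftrightarrow> continuous_on S f"
| "Ck_on (Suc k) f S \<longleftrightarrow>
     f differentiable_on S \<and> (\<forall>b\<in>Basis. Ck_on k (\<lambda>x. frechet_derivative f (at x) b) S)"

text \<open>On an arbitrary set: local existence of smooth extensions. On an open set this is ordinary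
  smoothness; the general case is needed for products with a time interval that may contain
  its end points.\<close>

definition smooth_on :: "('v::euclidean_space \<Rightarrow> 'w::real_normed_vector) \<Rightarrow> 'v set \<Rightarrow> bool" where
  "smooth_on f S \<longleftrightarrow>
     (\<forall>x\<in>S. \<exists>W F. open W \<and> x \<in> W \<and> (\<forall>k. Ck_on k F W) \<and> (\<forall>y\<in>S \<inter> W. F y = f y))"

section \<open>Smooth 7-manifolds\<close>

type_synonym 'a chart = "'a set \<times> ('a \<Rightarrow> real^7)"

definition chart_dom :: "'a chart \<Rightarrow> 'a set" where
  "chart_dom c = fst c"

definition chart_map :: "'a chart \<Rightarrow> 'a \<Rightarrow> real^7" where
  "chart_map c = snd c"

definition chart_image :: "'a chart \<Rightarrow> (real^7) set" where
  "chart_image c = chart_map c ` chart_dom c"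

definition chart_inv :: "'a chart \<Rightarrow> real^7 \<Rightarrow> 'a" where
  "chart_inv c = inv_into (chart_dom c) (chart_map c)"

definition chart_on :: "'a topology \<Rightarrow> 'a chart \<Rightarrow> bool" where
  "chart_on M c \<longleftrightarrow> openin M (chart_dom c) \<and> open (chart_image c) \<and>
     homeomorphic_map (subtopology M (chart_dom c)) (top_of_set (chart_image c)) (chart_map c)"

text \<open>The atlas is not required to be maximal.\<close>

definition smooth_manifold7 :: "'a topology \<Rightarrow> 'a chart set \<Rightarrow> bool" where
  "smooth_manifold7 M A \<longleftrightarrow>
     Hausdorff_space M \<and> second_countable M \<and>
     (\<forall>c\<in>A. chart_on M c) \<and> (\<Union>c\<in>A. chart_dom c) = topspace M \<and>
     (\<forall>c\<in>A. \<forall>d\<in>A. smooth_on (chart_map d \<circ> chart_inv c)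
                       (chart_map c ` (chart_dom c \<inter> chart_dom d)))"

text \<open>\<open>\<partial>f/\<partial>x\<^sup>k\<close> in the local coordinates \<open>x\<close> given by \<open>c\<close>.\<close>

definition partial_deriv :: "'a chart \<Rightarrow> 7 \<Rightarrow> ('a \<Rightarrow> real) \<Rightarrow> 'a \<Rightarrow> real" where
  "partial_deriv c k f p =
     frechet_derivative (f \<circ> chart_inv c) (at (chart_map c p)) (axis k 1)"

text \<open>Entry \<open>(a, i)\<close> is \<open>\<partial>x\<^sup>a/\<partial>y\<^sup>i\<close> for the coordinates \<open>x\<close> of \<open>c\<close> and \<open>y\<close> of \<open>d\<close>.\<close>

definition coord_change :: "'a chart \<Rightarrow> 'a chart \<Rightarrow> 'a \<Rightarrow> real^7^7" where
  "coord_change c d p = jacobian (chart_map c \<circ> chart_inv d) (at (chart_map d p))"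

section \<open>Forms and covariant tensors at a point\<close>

text \<open>A covariant tensor of rank \<open>k\<close> is given by its components: \<open>\<alpha> [i\<^sub>1, \<dots>, i\<^sub>k]\<close> stands for
  \<open>\<alpha>\<close> with subscripts \<open>i\<^sub>1 \<dots> i\<^sub>k\<close>. Only lists of length \<open>k\<close> matter. The indices are the elements of
  the type \<open>7\<close>, in which \<open>7 = 0\<close>. Tensors with two lower indices that enter matrix algebra
  are matrices, and vectors are elements of \<open>real^7\<close>.\<close>

type_synonym tensor = "7 list \<Rightarrow> real"

definition tensor1 :: "real^7 \<Rightarrow> tensor" where
  "tensor1 w I = w $ (I ! 0)"

definition tensor2 :: "real^7^7 \<Rightarrow> tensor" where
  "tensor2 S I = S $ (I ! 0) $ (I ! 1)"

definition pullback :: "real^7^7 \<Rightarrow> tensor \<Rightarrow> tensor" where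
  "pullback L \<alpha> I =
     (\<Sum>K | length K = length I. (\<Prod>r<length I. L $ (K ! r) $ (I ! r)) * \<alpha> K)"

definition wedge :: "nat \<Rightarrow> nat \<Rightarrow> tensor \<Rightarrow> tensor \<Rightarrow> tensor" where
  "wedge k l \<alpha> \<beta> I =
     (\<Sum>\<sigma> | \<sigma> permutes {..<k + l}. of_int (sign \<sigma>) *
        \<alpha> (map (\<lambda>r. I ! \<sigma> r) [0..<k]) * \<beta> (map (\<lambda>r. I ! \<sigma> r) [k..<k + l])) / (fact k * fact l)"

definition int_prod :: "real^7 \<Rightarrow> tensor \<Rightarrow> tensor" where
  "int_prod u \<alpha> I = (\<Sum>i\<in>UNIV. u $ i * \<alpha> (i # I))"

text \<open>The 7-form \<open>v dx\<^sup>1 \<and> \<dots> \<and> dx\<^sup>7\<close>.\<close>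

definition top_form :: "real \<Rightarrow> tensor" where
  "top_form v I = v * det (vector (map (\<lambda>i. axis i 1) I) :: real^7^7)"

text \<open>Hodge star of a \<open>k\<close>-form for the metric \<open>G\<close> and the volume form \<open>v dx\<^sup>1 \<and> \<dots> \<and> dx\<^sup>7\<close>,
  normalised by \<open>\<alpha> \<and> *\<beta> = \<langle>\<alpha>, \<beta>\<rangle> vol\<close>.\<close>

definition hodge :: "real^7^7 \<Rightarrow> real \<Rightarrow> nat \<Rightarrow> tensor \<Rightarrow> tensor" where
  "hodge G v k \<alpha> J =
     (\<Sum>I | length I = k. \<Sum>K | length K = k.
        (\<Prod>r<k. matrix_inv G $ (I ! r) $ (K ! r)) * \<alpha> K * top_form v (I @ J)) / fact k"

section \<open>The linear algebra of a G2-structure\<close>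

definition covec :: "7 \<Rightarrow> tensor" where
  "covec a I = (if I = [a] then 1 else 0)"

definition covec3 :: "7 \<Rightarrow> 7 \<Rightarrow> 7 \<Rightarrow> tensor" where
  "covec3 a b c = wedge 2 1 (wedge 1 1 (covec a) (covec b)) (covec c)"

definition phi0 :: tensor where
  "phi0 I = covec3 1 2 3 I + covec3 1 4 5 I + covec3 1 6 7 I + covec3 2 4 6 I
          - covec3 2 5 7 I - covec3 3 4 7 I - covec3 3 5 6 I"

definition G2_form :: "tensor \<Rightarrow> bool" where
  "G2_form f \<longleftrightarrow> (\<exists>L. invertible L \<and> (\<forall>I. length I = 3 \<longrightarrow> f I = pullback L phi0 I))"

text \<open>\<open>G\<close> is an inner product, \<open>v dx\<^sup>1 \<and> \<dots> \<and> dx\<^sup>7\<close> is the volume form of \<open>G\<close> for one of the two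
  orientations, and \<open>(u \<lrcorner> f) \<and> (w \<lrcorner> f) \<and> f = -6 G(u, w) vol\<close>.\<close>

definition is_G2_metric_vol :: "tensor \<Rightarrow> real^7^7 \<Rightarrow> real \<Rightarrow> bool" where
  "is_G2_metric_vol f G v \<longleftrightarrow>
     transpose G = G \<and> (\<forall>u. u \<noteq> 0 \<longrightarrow> u \<bullet> (G *v u) > 0) \<and> \<bar>v\<bar> = sqrt (det G) \<and>
     (\<forall>u w I. length I = 7 \<longrightarrow>
        wedge 4 3 (wedge 2 2 (int_prod u f) (int_prod w f)) f I
          = - 6 * (u \<bullet> (G *v w)) * top_form v I)"

definition G2_metric :: "tensor \<Rightarrow> real^7^7" where
  "G2_metric f = fst (THE (G, v). is_G2_metric_vol f G v)"

definition G2_vol :: "tensor \<Rightarrow> real" where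
  "G2_vol f = snd (THE (G, v). is_G2_metric_vol f G v)"

definition G2_inv_metric :: "tensor \<Rightarrow> real^7^7" where
  "G2_inv_metric f = matrix_inv (G2_metric f)"

definition G2_psi :: "tensor \<Rightarrow> tensor" where
  "G2_psi f = hodge (G2_metric f) (G2_vol f) 3 f"

section \<open>Tensor fields\<close>

text \<open>A tensor field is given by its components in every chart of the atlas; the components with
  respect to two charts are related by the tensor transformation law.\<close>

definition G2_structure ::
  "'a topology \<Rightarrow> 'a chart set \<Rightarrow> ('a chart \<Rightarrow> 'a \<Rightarrow> tensor) \<Rightarrow> bool" where
  "G2_structure M A \<phi> \<longleftrightarrow>
     (\<forall>c\<in>A. \<forall>I. length I = 3 \<longrightarrow> smooth_on (\<lambda>y. \<phi> c (chart_inv c y) I) (chart_image c)) \<and>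
     (\<forall>c\<in>A. \<forall>d\<in>A. \<forall>p\<in>chart_dom c \<inter> chart_dom d. \<forall>I. length I = 3 \<longrightarrow>
        \<phi> d p I = pullback (coord_change c d p) (\<phi> c p) I) \<and>
     (\<forall>c\<in>A. \<forall>p\<in>chart_dom c. G2_form (\<phi> c p))"

definition smooth_G2_family ::
  "'a topology \<Rightarrow> 'a chart set \<Rightarrow> real set \<Rightarrow> (real \<Rightarrow> 'a chart \<Rightarrow> 'a \<Rightarrow> tensor) \<Rightarrow> bool" where
  "smooth_G2_family M A J \<phi> \<longleftrightarrow>
     (\<forall>t\<in>J. G2_structure M A (\<phi> t)) \<and>
     (\<forall>c\<in>A. \<forall>I. length I = 3 \<longrightarrow>
        smooth_on (\<lambda>(t, y). \<phi> t c (chart_inv c y) I) (J \<times> chart_image c))"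

definition symmetric_2tensor ::
  "'a topology \<Rightarrow> 'a chart set \<Rightarrow> ('a chart \<Rightarrow> 'a \<Rightarrow> real^7^7) \<Rightarrow> bool" where
  "symmetric_2tensor M A h \<longleftrightarrow>
     (\<forall>c\<in>A. smooth_on (\<lambda>y. h c (chart_inv c y)) (chart_image c)) \<and>
     (\<forall>c\<in>A. \<forall>d\<in>A. \<forall>p\<in>chart_dom c \<inter> chart_dom d.
        h d p = transpose (coord_change c d p) ** h c p ** coord_change c d p) \<and>
     (\<forall>c\<in>A. \<forall>p\<in>chart_dom c. transpose (h c p) = h c p)"

definition vector_field ::
  "'a topology \<Rightarrow> 'a chart set \<Rightarrow> ('a chart \<Rightarrow> 'a \<Rightarrow> real^7) \<Rightarrow> bool" where
  "vector_field M A X \<longleftrightarrow>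
     (\<forall>c\<in>A. smooth_on (\<lambda>y. X c (chart_inv c y)) (chart_image c)) \<and>
     (\<forall>c\<in>A. \<forall>d\<in>A. \<forall>p\<in>chart_dom c \<inter> chart_dom d.
        X c p = coord_change c d p *v X d p)"

section \<open>Levi-Civita connection\<close>

text \<open>For a connection with Christoffel symbols \<open>\<Gamma> m k i\<close> (\<open>m\<close> the upper index) at \<open>p\<close>, the component
  \<open>\<nabla>\<^sub>k S\<^sub>I\<close> at \<open>p\<close>.\<close>

definition cov_deriv ::
  "'a chart \<Rightarrow> (7 \<Rightarrow> 7 \<Rightarrow> 7 \<Rightarrow> real) \<Rightarrow> 7 \<Rightarrow> ('a \<Rightarrow> tensor) \<Rightarrow> 'a \<Rightarrow> tensor" where
  "cov_deriv c \<Gamma> k S p I =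
     partial_deriv c k (\<lambda>q. S q I) p - (\<Sum>r<length I. \<Sum>m\<in>UNIV. \<Gamma> m k (I ! r) * S p (I[r := m]))"

text \<open>The Christoffel symbols at \<open>p\<close> of the torsion-free connection with \<open>\<nabla>G = 0\<close>.\<close>

definition levi_civita :: "'a chart \<Rightarrow> ('a \<Rightarrow> real^7^7) \<Rightarrow> 'a \<Rightarrow> 7 \<Rightarrow> 7 \<Rightarrow> 7 \<Rightarrow> real" where
  "levi_civita c G p =
     (THE \<Gamma>. (\<forall>m i j. \<Gamma> m i j = \<Gamma> m j i) \<and>
             (\<forall>k i j. cov_deriv c \<Gamma> k (\<lambda>q. tensor2 (G q)) p [i, j] = 0))"

text \<open>\<open>\<nabla>\<^sub>k S\<^sub>I\<close> at \<open>p\<close> for the Levi-Civita connection of the metric determined by \<open>\<phi>\<close>.\<close>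

definition G2_nabla ::
  "('a chart \<Rightarrow> 'a \<Rightarrow> tensor) \<Rightarrow> 'a chart \<Rightarrow> 7 \<Rightarrow> ('a \<Rightarrow> tensor) \<Rightarrow> 'a \<Rightarrow> tensor" where
  "G2_nabla \<phi> c k S p = cov_deriv c (levi_civita c (\<lambda>q. G2_metric (\<phi> c q)) p) k S p"

section \<open>Torsion\<close>

definition full_torsion ::
  "('a chart \<Rightarrow> 'a \<Rightarrow> tensor) \<Rightarrow> 'a chart \<Rightarrow> 'a \<Rightarrow> real^7^7" where
  "full_torsion \<phi> c p =
     (THE T. \<forall>l i j k. G2_nabla \<phi> c l (\<phi> c) p [i, j, k] =
        (\<Sum>m\<in>UNIV. \<Sum>n\<in>UNIV.
           T $ l $ m * G2_inv_metric (\<phi> c p) $ m $ n * G2_psi (\<phi> c p) [n, i, j, k]))"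

section \<open>Index conventions of the flow\<close>

text \<open>\<open>h\<^sup>l\<^sub>i = g\<^sup>l\<^sup>m h\<^sub>i\<^sub>m\<close>\<close>

definition raise :: "tensor \<Rightarrow> real^7^7 \<Rightarrow> 7 \<Rightarrow> 7 \<Rightarrow> real" where
  "raise f h l i = (\<Sum>m\<in>UNIV. G2_inv_metric f $ l $ m * h $ i $ m)"

text \<open>\<open>X\<^sub>j = g\<^sub>j\<^sub>k X\<^sup>k\<close>\<close>

definition lower :: "tensor \<Rightarrow> real^7 \<Rightarrow> real^7" where
  "lower f X = G2_metric f *v X"

definition flow_rhs :: "tensor \<Rightarrow> real^7^7 \<Rightarrow> real^7 \<Rightarrow> 7 \<Rightarrow> 7 \<Rightarrow> 7 \<Rightarrow> real" where
  "flow_rhs f h X i j k =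
     (\<Sum>l\<in>UNIV. raise f h l i * f [l, j, k] + raise f h l j * f [i, l, k]
               + raise f h l k * f [i, j, l] + X $ l * G2_psi f [l, i, j, k])"

end

theory Submission
  imports Defs
begin

text \<open>The metric and \<open>\<psi>\<close> are natural functions of \<open>\<phi>\<close>. Hence if the velocity of \<open>\<phi>\<close> is the infinitesimal
  action of an endomorphism field \<open>A\<close>, the same \<open>A\<close> gives the velocities of \<open>g\<close> and \<open>\<psi>\<close>. This applies both to
  the flow, where \<open>A\<close> is assembled from \<open>h\<close> and \<open>X\<close>, and to spatial derivatives, where it yields a
  vector \<open>W\<^sub>k\<close> with \<open>\<nabla>\<^sub>k\<phi> = W\<^sub>k \<lrcorner> \<psi>\<close>, whose covector is the row \<open>T\<^sub>k\<close> of the torsion. Differentiating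
  \<open>\<nabla>\<^sub>kg = 0\<close> and \<open>\<nabla>\<^sub>k\<phi> = W\<^sub>k \<lrcorner> \<psi>\<close> in time shows that the endomorphism \<open>\<nabla>\<^sub>kA - \<Gamma>'\<^sub>k\<close>, with \<open>\<Gamma>'\<close> the
  time derivative of the Christoffel symbols, is skew and acts on \<open>\<phi>\<close> as \<open>(W'\<^sub>k + A W\<^sub>k) \<lrcorner> \<psi>\<close>. A skew
  endomorphism acts on \<open>\<phi>\<close> as \<open>V \<lrcorner> \<psi>\<close> with \<open>V\<close> its contraction with \<open>\<phi>\<close>, which determines \<open>W'\<close>.\<close>

text \<open>\<open>G2_metric\<close>, \<open>levi_civita\<close> and \<open>full_torsion\<close> are
  definite descriptions, which say nothing about regularity in time or space. All regularity
  therefore comes from closed formulas. The convention for the metric fixes \<open>v g\<close> as a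
  cubic polynomial in \<phi>; its determinant is \<open>v^9\<close>, so on G2-forms the metric, its
  inverse and \<psi> arise from the components of \<phi> by field operations and one odd root. The
  Christoffel formula and \<open>frame_torsion\<close> do the same for \<Gamma> and T. These
  formulas are never differentiated explicitly: a derivative depends only on the first jet of a
  curve, so it is read off the curve of pullbacks by \<open>1 + sA\<close>. That every derivative of
  \<phi> is an action \<open>act A\<close> reflects 49 - 14 = 35: the stabiliser G2 has dimension
  14, so GL(7) has an open orbit on 3-forms. Time and space derivatives are exchanged only for
  functions of \<phi>, which is jointly smooth; \<open>h\<close> and \<open>X\<close> are
  differentiated in space alone. Since \<open>J\<close> may contain its end points, the exchange
  takes place on local smooth extensions to open sets.\<close>

lemma exhaust_7: fixes x :: 7 shows "x = 1 \<or> x = 2 \<or> x = 3 \<or> x = 4 \<or> x = 5 \<or> x = 6 \<or> x = 7"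
proof (induct x)
  case (of_int z)
  then have "z = 0 \<or> z = 1 \<or> z = 2 \<or> z = 3 \<or> z = 4 \<or> z = 5 \<or> z = 6" by fastforce
  then show ?case by auto
qed

lemma forall_7: "(\<forall>i::7. P i) \<longleftrightarrow> P 1 \<and> P 2 \<and> P 3 \<and> P 4 \<and> P 5 \<and> P 6 \<and> P 7"
  by (metis exhaust_7)

lemma UNIV_7: "(UNIV::7 set) = {1,2,3,4,5,6,7}"
  using exhaust_7 by auto

lemma sum_7: "sum f (UNIV::7 set) = f 1 + f 2 + f 3 + f 4 + f 5 + f 6 + f 7"
  unfolding UNIV_7 by (simp add: ac_simps)

text \<open>The order of type \<open>7\<close> is that of the representatives 0 to 6, so comparisons
  of concrete indices are decided by computing these.\<close>

lemmas less_7 = less_bit1_def bit1.Rep_numeral bit1.Rep_1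

section \<open>Wedge products of low degree and the standard 3-form\<close>

text \<open>Every permutation of \<open>{..<Suc n}\<close> is in exactly one way a swap of
  \<open>n\<close> with some \<open>b\<close> (the identity if \<open>b = n\<close>) after a
  permutation of \<open>{..<n}\<close>. Used repeatedly, this expands a small antisymmetrisation
  into its explicit terms.\<close>

lemma sum_sign_permutes_Suc:
  "(\<Sum>\<sigma> | \<sigma> permutes {..<Suc n}. real_of_int (sign \<sigma>) * f \<sigma>) =
   (\<Sum>b<Suc n. \<Sum>\<sigma> | \<sigma> permutes {..<n}.
      real_of_int (sign \<sigma>) * ((if b = n then 1 else - 1) * f (Transposition.transpose n b \<circ> \<sigma>)))"
proof -
  have sgn: "sign (Transposition.transpose n b \<circ> \<sigma>) = (if b = n then 1 else - 1) * sign \<sigma>"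
    if "\<sigma> permutes {..<n}" for b \<sigma>
    using that permutation_permutes[of \<sigma>] finite_lessThan[of n]
    by (auto simp: sign_compose permutation_swap_id sign_swap_id)
  have "(\<Sum>\<sigma> | \<sigma> permutes {..<Suc n}. real_of_int (sign \<sigma>) * f \<sigma>) =
      (\<Sum>b<Suc n. \<Sum>\<sigma> | \<sigma> permutes {..<n}. real_of_int (sign (Transposition.transpose n b \<circ> \<sigma>)) * f (Transposition.transpose n b \<circ> \<sigma>))"
    using sum_over_permutations_insert[of "{..<n}" n "\<lambda>\<sigma>. real_of_int (sign \<sigma>) * f \<sigma>"]
    by (simp add: lessThan_Suc)
  also have "\<dots> = (\<Sum>b<Suc n. \<Sum>\<sigma> | \<sigma> permutes {..<n}.
      real_of_int (sign \<sigma>) * ((if b = n then 1 else - 1) * f (Transposition.transpose n b \<circ> \<sigma>)))"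
    by (intro sum.cong refl) (simp add: sgn)
  finally show ?thesis .
qed

lemma wedge_1_1: "wedge 1 1 \<alpha> \<beta> [i,j] = \<alpha> [i] * \<beta> [j] - \<alpha> [j] * \<beta> [i]"
  by (simp add: wedge_def sum_sign_permutes_Suc Transposition.transpose_def numeral_2_eq_2 mult.assoc)

lemma wedge_2_1: "wedge 2 1 \<alpha> \<beta> [i,j,k] =
   (\<alpha> [i,j] * \<beta> [k] - \<alpha> [j,i] * \<beta> [k] - \<alpha> [i,k] * \<beta> [j] + \<alpha> [k,i] * \<beta> [j] + \<alpha> [j,k] * \<beta> [i] - \<alpha> [k,j] * \<beta> [i]) / 2"
  by (simp add: wedge_def sum_sign_permutes_Suc Transposition.transpose_def numeral_2_eq_2 mult.assoc upt_rec)

lemma covec3: "covec3 a b c [i,j,k] =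
   of_bool (i = a) * (of_bool (j = b \<and> k = c) - of_bool (j = c \<and> k = b))
   + of_bool (i = b) * (of_bool (j = c \<and> k = a) - of_bool (j = a \<and> k = c))
   + of_bool (i = c) * (of_bool (j = a \<and> k = b) - of_bool (j = b \<and> k = a))"
proof -
  have *: "covec x [y] = of_bool (y = x)" for x y
    by (simp add: covec_def)
  show ?thesis
    unfolding covec3_def wedge_2_1 wedge_1_1 * of_bool_conj by (simp add: field_simps)
qed

text \<open>Two distinct indices lie in exactly one of the seven triples (the lines of the Fano
  plane), which determines the third index and the sign. Leaving \<open>k\<close> free lets sums
  over the last slot collapse.\<close>

lemma phi0_table:
  shows
    "phi0 [1,1,k] = 0" "phi0 [1,2,k] =  of_bool (k = 3)" "phi0 [1,3,k] = - of_bool (k = 2)" "phi0 [1,4,k] =  of_bool (k = 5)"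
    "phi0 [1,5,k] = - of_bool (k = 4)" "phi0 [1,6,k] =  of_bool (k = 7)" "phi0 [1,7,k] = - of_bool (k = 6)"
    "phi0 [2,1,k] = - of_bool (k = 3)" "phi0 [2,2,k] = 0" "phi0 [2,3,k] =  of_bool (k = 1)" "phi0 [2,4,k] =  of_bool (k = 6)"
    "phi0 [2,5,k] = - of_bool (k = 7)" "phi0 [2,6,k] = - of_bool (k = 4)" "phi0 [2,7,k] =  of_bool (k = 5)"
    "phi0 [3,1,k] =  of_bool (k = 2)" "phi0 [3,2,k] = - of_bool (k = 1)" "phi0 [3,3,k] = 0" "phi0 [3,4,k] = - of_bool (k = 7)"
    "phi0 [3,5,k] = - of_bool (k = 6)" "phi0 [3,6,k] =  of_bool (k = 5)" "phi0 [3,7,k] =  of_bool (k = 4)"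
    "phi0 [4,1,k] = - of_bool (k = 5)" "phi0 [4,2,k] = - of_bool (k = 6)" "phi0 [4,3,k] =  of_bool (k = 7)" "phi0 [4,4,k] = 0"
    "phi0 [4,5,k] =  of_bool (k = 1)" "phi0 [4,6,k] =  of_bool (k = 2)" "phi0 [4,7,k] = - of_bool (k = 3)"
    "phi0 [5,1,k] =  of_bool (k = 4)" "phi0 [5,2,k] =  of_bool (k = 7)" "phi0 [5,3,k] =  of_bool (k = 6)" "phi0 [5,4,k] = - of_bool (k = 1)"
    "phi0 [5,5,k] = 0" "phi0 [5,6,k] = - of_bool (k = 3)" "phi0 [5,7,k] = - of_bool (k = 2)"
    "phi0 [6,1,k] = - of_bool (k = 7)" "phi0 [6,2,k] =  of_bool (k = 4)" "phi0 [6,3,k] = - of_bool (k = 5)" "phi0 [6,4,k] = - of_bool (k = 2)"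
    "phi0 [6,5,k] =  of_bool (k = 3)" "phi0 [6,6,k] = 0" "phi0 [6,7,k] =  of_bool (k = 1)"
    "phi0 [7,1,k] =  of_bool (k = 6)" "phi0 [7,2,k] = - of_bool (k = 5)" "phi0 [7,3,k] = - of_bool (k = 4)" "phi0 [7,4,k] =  of_bool (k = 3)"
    "phi0 [7,5,k] =  of_bool (k = 2)" "phi0 [7,6,k] = - of_bool (k = 1)" "phi0 [7,7,k] = 0"
  by (simp_all add: phi0_def covec3)

lemma covec3_swap:
  "covec3 a b c [j,i,k] = - covec3 a b c [i,j,k]" "covec3 a b c [i,k,j] = - covec3 a b c [i,j,k]"
  unfolding covec3 of_bool_conj by (simp_all add: algebra_simps)

lemma phi0_swap: "phi0 [j,i,k] = - phi0 [i,j,k]" "phi0 [i,k,j] = - phi0 [i,j,k]"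
  by (simp_all only: phi0_def covec3_swap[of _ _ _ j i] covec3_swap(2)[of _ _ _ i k])

lemma sum_of_bool_mult [simp]:
  fixes f :: "'i::finite \<Rightarrow> real"
  shows "(\<Sum>k\<in>UNIV. of_bool (k = a) * f k) = f a" "(\<Sum>k\<in>UNIV. f k * of_bool (k = a)) = f a"
  by (simp_all add: of_bool_def if_distrib[of "\<lambda>x. x * _"] if_distrib[of "\<lambda>x. _ * x"] cong: if_cong)

text \<open>The components of \<open>*\<phi>\<^sub>0\<close>, read off the identity for the contraction of \<open>\<phi>\<^sub>0\<close> with itself in one index.
  The sign convention for the metric makes \<open>- e\<^sup>1\<^sup>2\<^sup>3\<^sup>4\<^sup>5\<^sup>6\<^sup>7\<close> the volume form of \<open>\<phi>\<^sub>0\<close>.\<close>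

definition psi0 :: "7 \<Rightarrow> 7 \<Rightarrow> 7 \<Rightarrow> 7 \<Rightarrow> real" where
  "psi0 i j a b = of_bool (i = a \<and> j = b) - of_bool (i = b \<and> j = a)
     - (\<Sum>k\<in>UNIV. phi0 [i,j,k] * phi0 [a,b,k])"

lemma psi0_swap12: "psi0 j i a b = - psi0 i j a b"
  by (simp add: psi0_def phi0_swap(1)[of j i] sum_negf conj_commute)

lemma psi0_swap34: "psi0 i j b a = - psi0 i j a b"
  by (simp add: psi0_def phi0_swap(1)[of b a] sum_negf conj_commute)

text \<open>This swap mixes the two factors of the contraction, so unlike the other two it does not
  come from the skewness of \<open>phi0\<close>. It is special to the standard form and is checked
  on all index values.\<close>

lemma psi0_swap23: "psi0 i a j b = - psi0 i j a b"
proof -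
  have "\<forall>i j a b. psi0 i a j b = - psi0 i j a b"
    by (simp add: forall_7 psi0_def phi0_table sum_negf)
  then show ?thesis by blast
qed

text \<open>A skew function vanishes on repeated indices and is otherwise determined up to sign by
  sorting them. In degrees three and four this leaves 35 cases to verify instead of 343 and
  2401.\<close>

lemma alternating3_eqI:
  fixes D E :: "'i::linorder \<Rightarrow> 'i \<Rightarrow> 'i \<Rightarrow> real"
  assumes D: "\<And>a b c. D b a c = - D a b c" "\<And>a b c. D a c b = - D a b c"
    and E: "\<And>a b c. E b a c = - E a b c" "\<And>a b c. E a c b = - E a b c"
    and eq: "\<And>a b c. a < b \<Longrightarrow> b < c \<Longrightarrow> D a b c = E a b c"
  shows "D a b c = E a b c"
proof -
  define F where "F a b c = D a b c - E a b c" for a b c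
  have sw: "F b a c = - F a b c" "F a c b = - F a b c" for a b c
    unfolding F_def by (simp_all add: D(1)[of b a] D(2)[of a c] E(1)[of b a] E(2)[of a c])
  have z: "F a b c = 0" if "a < b" "b < c" for a b c
    using eq that by (simp add: F_def)
  have e: "F a a c = 0" "F a c c = 0" for a c
    using sw(1)[of a a c] sw(2)[of a c c] by auto
  have 1: "F a b c = 0" if "a < b" for a b c
    using z[of a b c] z[of a c b] z[of c a b] that sw(1)[of a c b] sw(2)[of a b c] e
    by (metis add.inverse_neutral linorder_less_linear)
  then have "F a b c = 0"
    using 1[of a b c] 1[of b a c] e sw(1)[of a b c]
    by (metis add.inverse_neutral linorder_less_linear)
  then show ?thesis by (simp add: F_def)
qed

lemma alternating4_eqI:
  fixes D E :: "'i::linorder \<Rightarrow> 'i \<Rightarrow> 'i \<Rightarrow> 'i \<Rightarrow> real"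
  assumes D: "\<And>a b c d. D b a c d = - D a b c d" "\<And>a b c d. D a c b d = - D a b c d" "\<And>a b c d. D a b d c = - D a b c d"
    and E: "\<And>a b c d. E b a c d = - E a b c d" "\<And>a b c d. E a c b d = - E a b c d" "\<And>a b c d. E a b d c = - E a b c d"
    and eq: "\<And>a b c d. a < b \<Longrightarrow> b < c \<Longrightarrow> c < d \<Longrightarrow> D a b c d = E a b c d"
  shows "D a b c d = E a b c d"
proof -
  define F where "F a b c d = D a b c d - E a b c d" for a b c d
  have sw: "F b a c d = - F a b c d" "F a c b d = - F a b c d" "F a b d c = - F a b c d" for a b c d
    unfolding F_def by (simp_all add: D(1)[of b a] D(2)[of a c] D(3)[of a b d] E(1)[of b a] E(2)[of a c] E(3)[of a b d])
  have z: "F a b c d = 0" if "a < b" "b < c" "c < d" for a b c d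
    using eq that by (simp add: F_def)
  have e: "F a a c d = 0" "F a c c d = 0" "F a c d d = 0" for a c d
    using sw(1)[of a a c] sw(2)[of a c c] sw(3)[of a c d d] by auto
  have 1: "F a b c d = 0" if "a < b" "b < c" for a b c d
  proof -
    consider "c < d" | "c = d" | "b < d" "d < c" | "b = d" | "a < d" "d < b" | "a = d" | "d < a"
      by (metis linorder_less_linear)
    then show ?thesis
      using that z[of a b c d] z[of a b d c] z[of a d b c] z[of d a b c] e sw(1)[of a d b c] sw(2)[of a b d c] sw(3)[of a b c d]
      by cases auto
  qed
  have 2: "F a b c d = 0" if "a < b" for a b c d
    using 1[of a b c d] 1[of a c b d] 1[of c a b d] that sw(1)[of a c b d] sw(2)[of a b c d] e
    by (metis add.inverse_neutral linorder_less_linear)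
  then have "F a b c d = 0"
    using 2[of a b c d] 2[of b a c d] e sw(1)[of a b c d]
    by (metis add.inverse_neutral linorder_less_linear)
  then show ?thesis by (simp add: F_def)
qed

section \<open>The Levi-Civita symbol and wedge products\<close>

definition eps :: "7 list \<Rightarrow> real" where
  "eps = top_form 1"

text \<open>List positions start at 0, whereas rows of a matrix are labelled by type
  \<open>7\<close>. This bijection matches the permutations of \<open>{..<7}\<close> in
  \<open>wedge\<close> with those of \<open>UNIV\<close> in \<open>det\<close>.\<close>

definition idx :: "nat \<Rightarrow> 7" where
  "idx r = of_nat (Suc r)"

lemma top_form_eps: "top_form v I = v * eps I"
  by (simp add: eps_def top_form_def)

lemma lessThan_7: "{..<7::nat} = {0,1,2,3,4,5,6}"
  by (auto simp: numeral_eq_Suc less_Suc_eq)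

lemma upt_7: "[0..<7] = [0,1,2,3,4,5,6]"
  by (simp add: upt_rec)

lemma idx_simps: "idx 0 = 1" "idx 1 = 2" "idx (Suc 0) = 2" "idx 2 = 3" "idx 3 = 4" "idx 4 = 5" "idx 5 = 6" "idx 6 = 7"
  by (simp_all add: idx_def)

lemma bij_idx: "bij_betw idx {..<7} UNIV"
  unfolding bij_betw_def inj_on_def lessThan_7 UNIV_7 by (simp add: idx_simps)

lemma length_7_cases:
  assumes "length l = 7"
  obtains a b c d e f g where "l = [a,b,c,d,e,f,g]"
proof -
  have "length l = Suc (Suc (Suc (Suc (Suc (Suc (Suc 0))))))" using assms by simp
  then show ?thesis using that by (auto simp: length_Suc_conv)
qed

lemma vector_idx:
  assumes "length l = 7" "r < 7"
  shows "(vector l :: 'b::zero^7) $ idx r = l ! r"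
proof -
  obtain a b c d e f g where "l = [a,b,c,d,e,f,g]"
    using assms(1) by (rule length_7_cases)
  moreover have "r \<in> {0,1,2,3,4,5,6}" using assms(2) lessThan_7 by (metis lessThan_iff)
  ultimately show ?thesis
    by (auto simp: vector_def idx_simps)
qed

text \<open>Conjugation by \<open>idx\<close> is a bijection between the two groups of permutations
  and preserves signs.\<close>

lemma det_sum_permutes_lessThan:
  fixes M :: "real^7^7"
  shows "det M = (\<Sum>\<sigma> | \<sigma> permutes {..<7}. of_int (sign \<sigma>) * (\<Prod>r<7. M $ idx r $ idx (\<sigma> r)))"
proof -
  let ?m = "map_permutation {..<7} idx"
  have inj: "inj_on idx {..<7}" and im: "idx ` {..<7} = UNIV"
    using bij_idx by (auto simp: bij_betw_def)
  have inv: "bij_betw (inv_into {..<7} idx) UNIV {..<7}"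
    using bij_idx by (rule bij_betw_inv_into)
  have bij: "bij_betw ?m {\<sigma>. \<sigma> permutes {..<7}} {p. p permutes UNIV}"
  proof (rule bij_betw_byWitness[where f' = "map_permutation UNIV (inv_into {..<7} idx)"])
    show "\<forall>\<sigma>\<in>{\<sigma>. \<sigma> permutes {..<7}}. map_permutation UNIV (inv_into {..<7} idx) (?m \<sigma>) = \<sigma>"
      using bij_idx inj by (auto intro!: map_permutation_compose_inv simp: inv_into_f_f)
    show "\<forall>p\<in>{p. p permutes UNIV}. ?m (map_permutation UNIV (inv_into {..<7} idx) p) = p"
      using inv im by (auto intro!: map_permutation_compose_inv simp: f_inv_into_f)
    show "?m ` {\<sigma>. \<sigma> permutes {..<7}} \<subseteq> {p. p permutes UNIV}"
      using map_permutation_permutes[OF bij_idx] by auto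
    show "map_permutation UNIV (inv_into {..<7} idx) ` {p. p permutes UNIV} \<subseteq> {\<sigma>. \<sigma> permutes {..<7}}"
      using map_permutation_permutes[OF inv] by auto
  qed
  have "det M = (\<Sum>\<sigma> | \<sigma> permutes {..<7}. of_int (sign (?m \<sigma>)) * (\<Prod>i\<in>UNIV. M $ i $ ?m \<sigma> i))"
    unfolding det_def using sum.reindex_bij_betw[OF bij, of "\<lambda>p. of_int (sign p) * (\<Prod>i\<in>UNIV. M $ i $ p i)"] by simp
  also have "\<dots> = (\<Sum>\<sigma> | \<sigma> permutes {..<7}. of_int (sign \<sigma>) * (\<Prod>r<7. M $ idx r $ idx (\<sigma> r)))"
  proof (intro sum.cong refl)
    fix \<sigma> :: "nat \<Rightarrow> nat" assume "\<sigma> \<in> {\<sigma>. \<sigma> permutes {..<7}}"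
    then have \<sigma>: "\<sigma> permutes {..<7}" by simp
    have "(\<Prod>i\<in>UNIV. M $ i $ ?m \<sigma> i) = (\<Prod>r<7. M $ idx r $ ?m \<sigma> (idx r))"
      by (rule prod.reindex_bij_betw[OF bij_idx, symmetric])
    also have "\<dots> = (\<Prod>r<7. M $ idx r $ idx (\<sigma> r))"
      using inj by (auto intro!: prod.cong simp: map_permutation_apply)
    finally show "of_int (sign (?m \<sigma>)) * (\<Prod>i\<in>UNIV. M $ i $ ?m \<sigma> i)
        = of_int (sign \<sigma>) * (\<Prod>r<7. M $ idx r $ idx (\<sigma> r))"
      using sign_map_permutation[OF inj \<sigma>] by simp
  qed
  finally show ?thesis .
qed

definition rows_axis :: "7 list \<Rightarrow> real^7^7" where
  "rows_axis I = vector (map (\<lambda>i. axis i 1) I)"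

lemma eps_det: "eps I = det (rows_axis I)"
  by (simp add: eps_def top_form_def rows_axis_def)

lemma rows_axis_idx:
  "length I = 7 \<Longrightarrow> r < 7 \<Longrightarrow> rows_axis I $ idx r $ j = of_bool (j = I ! r)"
  by (simp add: rows_axis_def vector_idx axis_def)

text \<open>Both factors are determinants with basis vectors as rows, so the product is the
  determinant of their inner products, which are Kronecker deltas: the generalised Kronecker
  delta.\<close>

lemma eps_mult_eps:
  assumes I: "length I = 7" and K: "length K = 7"
  shows "eps I * eps K = (\<Sum>\<sigma> | \<sigma> permutes {..<7}. of_int (sign \<sigma>) * of_bool (K = map (\<lambda>r. I ! \<sigma> r) [0..<7]))"
proof -
  have "eps I * eps K = det (rows_axis K ** transpose (rows_axis I))"
    by (simp add: eps_det det_mul det_transpose)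
  also have "\<dots> = (\<Sum>\<sigma> | \<sigma> permutes {..<7}. of_int (sign \<sigma>) * of_bool (K = map (\<lambda>r. I ! \<sigma> r) [0..<7]))"
    unfolding det_sum_permutes_lessThan
  proof (intro sum.cong refl arg_cong2[where f = "(*)"])
    fix \<sigma> :: "nat \<Rightarrow> nat" assume "\<sigma> \<in> {\<sigma>. \<sigma> permutes {..<7}}"
    then have \<sigma>: "\<sigma> r < 7" if "r < 7" for r
      using that permutes_in_image[of \<sigma> "{..<7}" r] by simp
    have "(\<Prod>r<7. (rows_axis K ** transpose (rows_axis I)) $ idx r $ idx (\<sigma> r)) = (\<Prod>r<7. of_bool (K ! r = I ! \<sigma> r))"
      by (intro prod.cong refl)
        (simp add: matrix_matrix_mult_def transpose_def rows_axis_idx I K \<sigma>)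
    also have "\<dots> = of_bool (K = map (\<lambda>r. I ! \<sigma> r) [0..<7])"
      using K by (auto simp: of_bool_def list_eq_iff_nth_eq)
    finally show "(\<Prod>r<7. (rows_axis K ** transpose (rows_axis I)) $ idx r $ idx (\<sigma> r)) = of_bool (K = map (\<lambda>r. I ! \<sigma> r) [0..<7])" .
  qed
  finally show ?thesis .
qed

lemma finite_length_eq: "finite {K :: 'i::finite list. length K = n}"
  using finite_lists_length_eq[of "UNIV :: 'i set" n] by simp

text \<open>Turns an antisymmetrisation of top degree into a contraction with \<open>eps\<close>,
  whose behaviour under pullback is just a factor \<open>det L\<close>.\<close>

lemma sum_sign_permutes_eps:
  assumes I: "length I = 7"
  shows "(\<Sum>\<sigma> | \<sigma> permutes {..<7}. of_int (sign \<sigma>) * F (map (\<lambda>r. I ! \<sigma> r) [0..<7]))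
       = eps I * (\<Sum>K | length K = 7. eps K * F K)"
proof -
  have "eps I * (\<Sum>K | length K = 7. eps K * F K) = (\<Sum>K | length K = 7. (eps I * eps K) * F K)"
    by (simp add: sum_distrib_left mult.assoc)
  also have "\<dots> = (\<Sum>K | length K = 7. \<Sum>\<sigma> | \<sigma> permutes {..<7}.
      of_int (sign \<sigma>) * (of_bool (K = map (\<lambda>r. I ! \<sigma> r) [0..<7]) * F K))"
    by (intro sum.cong refl) (simp add: eps_mult_eps I sum_distrib_right mult.assoc)
  also have "\<dots> = (\<Sum>\<sigma> | \<sigma> permutes {..<7}. of_int (sign \<sigma>) *
      (\<Sum>K | length K = 7. of_bool (K = map (\<lambda>r. I ! \<sigma> r) [0..<7]) * F K))"
    by (subst sum.swap) (simp add: sum_distrib_left)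
  also have "\<dots> = (\<Sum>\<sigma> | \<sigma> permutes {..<7}. of_int (sign \<sigma>) * F (map (\<lambda>r. I ! \<sigma> r) [0..<7]))"
    by (intro sum.cong refl)
      (simp add: finite_length_eq of_bool_def if_distrib[of "\<lambda>x. x * _"] sum.If_cases cong: if_cong)
  finally show ?thesis ..
qed

lemma eps_idx: "eps (map idx [0..<7]) = 1"
proof -
  have "rows_axis (map idx [0..<7]) $ i = mat 1 $ i" for i
  proof -
    obtain r where "r < 7" "i = idx r"
      using bij_idx by (metis UNIV_I bij_betw_def imageE lessThan_iff)
    then show ?thesis
      by (simp add: vec_eq_iff rows_axis_idx mat_def of_bool_def eq_commute)
  qed
  then have "rows_axis (map idx [0..<7]) = mat 1"
    by (simp add: vec_eq_iff)
  then show ?thesis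
    by (simp add: eps_det)
qed

lemma sum_eps_pullback:
  assumes "length J = 7"
  shows "(\<Sum>K | length K = 7. eps K * (\<Prod>r<7. L $ (K ! r) $ (J ! r))) = det L * eps J"
proof -
  have "det L * eps J = det (rows_axis J ** transpose L)"
    by (simp add: eps_det det_mul det_transpose)
  also have "\<dots> = (\<Sum>\<sigma> | \<sigma> permutes {..<7}. of_int (sign \<sigma>) * (\<Prod>r<7. L $ idx (\<sigma> r) $ (J ! r)))"
    unfolding det_sum_permutes_lessThan
    by (intro sum.cong prod.cong refl arg_cong2[where f = "(*)"])
      (simp add: matrix_matrix_mult_def transpose_def rows_axis_idx assms)
  \<comment> \<open>The permutation sum is written with the base list 1, ..., 7, on which
    \<open>eps\<close> equals 1, so that \<open>sum_sign_permutes_eps\<close> applies.\<close>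
  also have "\<dots> = (\<Sum>\<sigma> | \<sigma> permutes {..<7}. of_int (sign \<sigma>) *
      (\<lambda>K. \<Prod>r<7. L $ (K ! r) $ (J ! r)) (map (\<lambda>r. map idx [0..<7] ! \<sigma> r) [0..<7]))"
  proof (intro sum.cong refl arg_cong2[where f = "(*)"])
    fix \<sigma> :: "nat \<Rightarrow> nat" assume "\<sigma> \<in> {\<sigma>. \<sigma> permutes {..<7}}"
    then have \<sigma>: "\<sigma> r < 7" if "r < 7" for r
      using that permutes_in_image[of \<sigma> "{..<7}" r] by simp
    show "(\<Prod>r<7. L $ idx (\<sigma> r) $ (J ! r)) = (\<lambda>K. \<Prod>r<7. L $ (K ! r) $ (J ! r)) (map (\<lambda>r. map idx [0..<7] ! \<sigma> r) [0..<7])"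
      using \<sigma> by (auto intro!: prod.cong)
  qed
  also have "\<dots> = (\<Sum>K | length K = 7. eps K * (\<Prod>r<7. L $ (K ! r) $ (J ! r)))"
    by (subst sum_sign_permutes_eps) (simp_all add: eps_idx)
  finally show ?thesis ..
qed

lemma eps_permute:
  assumes I: "length I = 7" and \<sigma>: "\<sigma> permutes {..<7}"
  shows "eps (map (\<lambda>r. I ! \<sigma> r) [0..<7]) = of_int (sign \<sigma>) * eps I"
proof -
  let ?p = "map_permutation {..<7} idx \<sigma>"
  have inj: "inj_on idx {..<7}" using bij_idx by (simp add: bij_betw_def)
  have p: "?p permutes UNIV" using map_permutation_permutes[OF bij_idx \<sigma>] .
  have "rows_axis (map (\<lambda>r. I ! \<sigma> r) [0..<7]) $ i = rows_axis I $ ?p i" for i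
  proof -
    obtain r where r: "r < 7" "i = idx r"
      using bij_idx by (metis UNIV_I bij_betw_def imageE lessThan_iff)
    then have "\<sigma> r < 7"
      using permutes_in_image[OF \<sigma>, of r] by simp
    then show ?thesis
      using r inj I by (simp add: vec_eq_iff rows_axis_idx map_permutation_apply)
  qed
  then have "rows_axis (map (\<lambda>r. I ! \<sigma> r) [0..<7]) = (\<chi> i. rows_axis I $ ?p i)"
    by (simp add: vec_eq_iff)
  then show ?thesis
    using det_permute_rows[OF p, of "rows_axis I"] sign_map_permutation[OF inj \<sigma>]
    by (simp add: eps_det)
qed

lemma eps_not_distinct:
  assumes "length I = 7" "\<not> distinct I"
  shows "eps I = 0"
proof -
  obtain r s where rs: "r < 7" "s < 7" "r \<noteq> s" "I ! r = I ! s"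
    using assms by (auto simp: distinct_conv_nth)
  then have "idx r \<noteq> idx s"
    using bij_idx by (auto simp: bij_betw_def inj_on_def)
  moreover have "row (idx r) (rows_axis I) = row (idx s) (rows_axis I)"
    using rs assms by (simp add: row_def vec_eq_iff rows_axis_idx)
  ultimately show ?thesis
    unfolding eps_det by (rule det_identical_rows)
qed

lemma eps_swap:
  "eps [b,a,c,d,e,f,g] = - eps [a,b,c,d,e,f,g]"
  "eps [a,c,b,d,e,f,g] = - eps [a,b,c,d,e,f,g]"
  "eps [a,b,d,c,e,f,g] = - eps [a,b,c,d,e,f,g]"
  "eps [a,b,c,e,d,f,g] = - eps [a,b,c,d,e,f,g]"
  "eps [a,b,c,d,f,e,g] = - eps [a,b,c,d,e,f,g]"
  "eps [a,b,c,d,e,g,f] = - eps [a,b,c,d,e,f,g]"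
proof -
  let ?\<tau> = "\<lambda>n. Transposition.transpose n (Suc n)"
  have *: "eps (map (\<lambda>r. [a,b,c,d,e,f,g] ! ?\<tau> n r) [0..<7]) = - eps [a,b,c,d,e,f,g]" if "n < 6" for n
  proof -
    have p: "?\<tau> n permutes {..<7}" by (rule permutes_swap_id) (use that in auto)
    have "sign (?\<tau> n) = -1" by (simp add: sign_swap_id)
    then show ?thesis by (intro trans[OF eps_permute[OF _ p]]) simp_all
  qed
  show "eps [b,a,c,d,e,f,g] = - eps [a,b,c,d,e,f,g]"
    using *[of 0] by (simp only: upt_7 list.map) (simp add: Transposition.transpose_def)
  show "eps [a,c,b,d,e,f,g] = - eps [a,b,c,d,e,f,g]"
    using *[of 1] by (simp only: upt_7 list.map) (simp add: Transposition.transpose_def)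
  show "eps [a,b,d,c,e,f,g] = - eps [a,b,c,d,e,f,g]"
    using *[of 2] by (simp only: upt_7 list.map) (simp add: Transposition.transpose_def)
  show "eps [a,b,c,e,d,f,g] = - eps [a,b,c,d,e,f,g]"
    using *[of 3] by (simp only: upt_7 list.map) (simp add: Transposition.transpose_def)
  show "eps [a,b,c,d,f,e,g] = - eps [a,b,c,d,e,f,g]"
    using *[of 4] by (simp only: upt_7 list.map) (simp add: Transposition.transpose_def)
  show "eps [a,b,c,d,e,g,f] = - eps [a,b,c,d,e,f,g]"
    using *[of 5] by (simp only: upt_7 list.map) (simp add: Transposition.transpose_def)
qed

section \<open>Index lists, tensor products and pullbacks\<close>

lemma sum_length_Suc:
  "(\<Sum>K :: 'i::finite list | length K = Suc n. F K) = (\<Sum>i\<in>UNIV. \<Sum>K | length K = n. F (i # K))"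
proof -
  have "(\<Sum>i\<in>UNIV. \<Sum>K | length K = n. F (i # K)) = (\<Sum>(i, K)\<in>UNIV \<times> {K. length K = n}. F (i # K))"
    by (rule sum.cartesian_product)
  also have "\<dots> = (\<Sum>K :: 'i list | length K = Suc n. F K)"
    by (rule sum.reindex_bij_witness[where i = "\<lambda>K. (hd K, tl K)" and j = "\<lambda>(i, K). i # K"])
      (auto simp: length_Suc_conv)
  finally show ?thesis ..
qed

lemma sum_length_add:
  "(\<Sum>K :: 'i::finite list | length K = m + n. H (take m K) (drop m K))
     = (\<Sum>K | length K = m. \<Sum>N | length N = n. H K N)"
proof -
  have "(\<Sum>K | length K = m. \<Sum>N | length N = n. H K N)
      = (\<Sum>(K, N)\<in>{K :: 'i list. length K = m} \<times> {N. length N = n}. H K N)"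
    by (rule sum.cartesian_product)
  also have "\<dots> = (\<Sum>K :: 'i list | length K = m + n. H (take m K) (drop m K))"
    by (rule sum.reindex_bij_witness[where i = "\<lambda>K. (take m K, drop m K)" and j = "\<lambda>(K, N). K @ N"])
      auto
  finally show ?thesis ..
qed

lemma prod_sum_length:
  fixes a :: "nat \<Rightarrow> 'i::finite \<Rightarrow> real"
  shows "(\<Prod>r<n. \<Sum>i\<in>UNIV. a r i) = (\<Sum>K | length K = n. \<Prod>r<n. a r (K ! r))"
proof (induction n arbitrary: a)
  case (Suc n)
  have "(\<Prod>r<Suc n. \<Sum>i\<in>UNIV. a r i) = (\<Sum>i\<in>UNIV. a 0 i) * (\<Prod>r<n. \<Sum>i\<in>UNIV. a (Suc r) i)"
    by (simp add: prod.lessThan_Suc_shift del: prod.lessThan_Suc)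
  also have "\<dots> = (\<Sum>K | length K = Suc n. \<Prod>r<Suc n. a r (K ! r))"
    by (simp add: Suc.IH[of "\<lambda>r. a (Suc r)"] sum_length_Suc prod.lessThan_Suc_shift sum_product
        del: prod.lessThan_Suc)
  finally show ?case .
qed simp

text \<open>No antisymmetrisation is built in: in top degree the contraction with \<open>eps\<close>
  supplies it.\<close>

definition tensor_prod :: "nat \<Rightarrow> tensor \<Rightarrow> tensor \<Rightarrow> tensor" where
  "tensor_prod m \<alpha> \<beta> I = \<alpha> (take m I) * \<beta> (drop m I)"

lemma pullback_tensor_prod:
  assumes "length I = m + n"
  shows "pullback L (tensor_prod m \<alpha> \<beta>) I = pullback L \<alpha> (take m I) * pullback L \<beta> (drop m I)"
proof -
  have split: "(\<Prod>r<m + n. L $ (K ! r) $ (I ! r)) =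
      (\<Prod>r<m. L $ (take m K ! r) $ (take m I ! r)) * (\<Prod>r<n. L $ (drop m K ! r) $ (drop m I ! r))"
    if "length K = m + n" for K
  proof -
    have "(\<Prod>r<m + n. L $ (K ! r) $ (I ! r)) = (\<Prod>r<m. L $ (K ! r) $ (I ! r)) * (\<Prod>r=m..<m+n. L $ (K ! r) $ (I ! r))"
      using prod.atLeastLessThan_concat[of 0 m "m + n" "\<lambda>r. L $ (K ! r) $ (I ! r)"]
      by (simp add: atLeast0LessThan)
    also have "(\<Prod>r=m..<m+n. L $ (K ! r) $ (I ! r)) = (\<Prod>r<n. L $ (K ! (m + r)) $ (I ! (m + r)))"
      using prod.atLeastLessThan_shift_bounds[of "\<lambda>r. L $ (K ! r) $ (I ! r)" 0 m n]
      by (simp add: atLeast0LessThan add.commute)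
    finally show ?thesis using that assms by simp
  qed
  have "pullback L (tensor_prod m \<alpha> \<beta>) I = (\<Sum>K | length K = m + n.
      (\<lambda>M N. ((\<Prod>r<m. L $ (M ! r) $ (take m I ! r)) * \<alpha> M) * ((\<Prod>r<n. L $ (N ! r) $ (drop m I ! r)) * \<beta> N)) (take m K) (drop m K))"
    unfolding pullback_def tensor_prod_def assms
    by (intro sum.cong refl) (simp add: split)
  also have "\<dots> = pullback L \<alpha> (take m I) * pullback L \<beta> (drop m I)"
    by (subst sum_length_add) (simp add: pullback_def assms sum_product)
  finally show ?thesis .
qed

lemma pullback_cong:
  "(\<And>K. length K = length I \<Longrightarrow> \<alpha> K = \<beta> K) \<Longrightarrow> pullback L \<alpha> I = pullback L \<beta> I"
  by (simp add: pullback_def)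

lemma int_prod_pullback:
  "int_prod u (pullback L \<alpha>) I = pullback L (int_prod (L *v u) \<alpha>) I"
proof -
  have "int_prod u (pullback L \<alpha>) I = (\<Sum>i\<in>UNIV. \<Sum>k\<in>UNIV. \<Sum>K | length K = length I.
      (\<Prod>r<length I. L $ (K ! r) $ (I ! r)) * (L $ k $ i * u $ i * \<alpha> (k # K)))"
    by (simp add: int_prod_def pullback_def sum_length_Suc prod.lessThan_Suc_shift sum_distrib_left mult_ac
        del: prod.lessThan_Suc)
  also have "\<dots> = (\<Sum>K | length K = length I. \<Sum>k\<in>UNIV. \<Sum>i\<in>UNIV.
      (\<Prod>r<length I. L $ (K ! r) $ (I ! r)) * (L $ k $ i * u $ i * \<alpha> (k # K)))"
    by (subst sum.swap, subst sum.swap[of _ _ UNIV], subst sum.swap) (rule refl)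
  also have "\<dots> = pullback L (int_prod (L *v u) \<alpha>) I"
    by (simp add: pullback_def int_prod_def matrix_vector_mult_def sum_distrib_left sum_distrib_right mult_ac)
  finally show ?thesis .
qed

lemma sum_eps_mult_pullback:
  "(\<Sum>K | length K = 7. eps K * pullback L \<alpha> K) = det L * (\<Sum>K | length K = 7. eps K * \<alpha> K)"
proof -
  have "(\<Sum>K | length K = 7. eps K * pullback L \<alpha> K)
      = (\<Sum>K | length K = 7. \<Sum>M | length M = 7. (eps K * (\<Prod>r<7. L $ (M ! r) $ (K ! r))) * \<alpha> M)"
    by (intro sum.cong refl) (simp add: pullback_def sum_distrib_left mult.assoc)
  also have "\<dots> = (\<Sum>M | length M = 7. (\<Sum>K | length K = 7. eps K * (\<Prod>r<7. transpose L $ (K ! r) $ (M ! r))) * \<alpha> M)"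
    by (subst sum.swap) (simp add: transpose_def sum_distrib_right)
  also have "\<dots> = det L * (\<Sum>K | length K = 7. eps K * \<alpha> K)"
    by (simp add: sum_eps_pullback sum_distrib_left mult.assoc)
  finally show ?thesis .
qed

text \<open>Divided by 24 = 2! 2! 3!, this is the coefficient of the 7-form \<alpha> \<and> \<beta>
  \<and> \<gamma> for two 2-forms and a 3-form.\<close>

definition eps_form :: "tensor \<Rightarrow> tensor \<Rightarrow> tensor \<Rightarrow> real" where
  "eps_form \<alpha> \<beta> \<gamma> = (\<Sum>K | length K = 7. eps K * tensor_prod 2 \<alpha> (tensor_prod 2 \<beta> \<gamma>) K)"

lemma eps_form_pullback:
  "eps_form (pullback L \<alpha>) (pullback L \<beta>) (pullback L \<gamma>) = det L * eps_form \<alpha> \<beta> \<gamma>"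
proof -
  have "tensor_prod 2 (pullback L \<alpha>) (tensor_prod 2 (pullback L \<beta>) (pullback L \<gamma>)) K
      = pullback L (tensor_prod 2 \<alpha> (tensor_prod 2 \<beta> \<gamma>)) K" if "length K = 7" for K
    using pullback_tensor_prod[of K 2 5 L \<alpha> "tensor_prod 2 \<beta> \<gamma>"]
      pullback_tensor_prod[of "drop 2 K" 2 3 L \<beta> \<gamma>] that
    by (simp add: tensor_prod_def)
  then show ?thesis
    by (simp add: eps_form_def sum_eps_mult_pullback)
qed

lemma eps_form_cong:
  assumes "\<And>I. length I = 2 \<Longrightarrow> \<alpha> I = \<alpha>' I" "\<And>I. length I = 2 \<Longrightarrow> \<beta> I = \<beta>' I"
    "\<And>I. length I = 3 \<Longrightarrow> \<gamma> I = \<gamma>' I"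
  shows "eps_form \<alpha> \<beta> \<gamma> = eps_form \<alpha>' \<beta>' \<gamma>'"
  unfolding eps_form_def by (intro sum.cong) (simp_all add: tensor_prod_def assms)

lemma wedge_4_3_eps:
  assumes "length I = 7"
  shows "wedge 4 3 \<omega> \<gamma> I = eps I * (\<Sum>K | length K = 7. eps K * tensor_prod 4 \<omega> \<gamma> K) / 144"
proof -
  have "wedge 4 3 \<omega> \<gamma> I = (\<Sum>\<sigma> | \<sigma> permutes {..<7}. of_int (sign \<sigma>) *
      tensor_prod 4 \<omega> \<gamma> (map (\<lambda>r. I ! \<sigma> r) [0..<7])) / 144"
    by (simp add: wedge_def tensor_prod_def take_map drop_map fact_numeral mult.assoc)
  then show ?thesis
    by (simp add: sum_sign_permutes_eps assms)
qed

text \<open>Antisymmetrising the first four slots does not change the contraction with \<open>eps\<close>, except for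
  the factor \<open>4!\<close>.\<close>

lemma sum_eps_wedge_2_2:
  "(\<Sum>K | length K = 7. eps K * tensor_prod 4 (wedge 2 2 \<alpha> \<beta>) \<gamma> K) = 6 * eps_form \<alpha> \<beta> \<gamma>"
proof -
  define F where "F = tensor_prod 2 \<alpha> (tensor_prod 2 \<beta> \<gamma>)"
  have key: "eps K * tensor_prod 4 (wedge 2 2 \<alpha> \<beta>) \<gamma> K =
       (\<Sum>\<tau> | \<tau> permutes {..<4}. eps (map (\<lambda>r. K ! \<tau> r) [0..<7]) * F (map (\<lambda>r. K ! \<tau> r) [0..<7])) / 4"
    if K: "length K = 7" for K
  proof -
    have *: "of_int (sign \<tau>) * \<alpha> (map (\<lambda>r. take 4 K ! \<tau> r) [0..<2]) * \<beta> (map (\<lambda>r. take 4 K ! \<tau> r) [2..<4]) * (eps K * \<gamma> (drop 4 K))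
       = eps (map (\<lambda>r. K ! \<tau> r) [0..<7]) * F (map (\<lambda>r. K ! \<tau> r) [0..<7])"
      if "\<tau> permutes {..<4}" for \<tau>
    proof -
      have \<tau>7: "\<tau> permutes {..<7}"
        using that by (rule permutes_subset) auto
      have lt: "\<tau> r < 4" if "r < 4" for r
        using permutes_in_image[OF \<open>\<tau> permutes {..<4}\<close>, of r] that by simp
      have ge: "\<tau> r = r" if "\<not> r < 4" for r
        using permutes_not_in[OF \<open>\<tau> permutes {..<4}\<close>, of r] that by simp
      have "drop 4 (map (\<lambda>r. K ! \<tau> r) [0..<7]) = drop 4 K"
        using K ge by (auto simp: list_eq_iff_nth_eq)
      moreover have "take 2 (map (\<lambda>r. K ! \<tau> r) [0..<7]) = map (\<lambda>r. take 4 K ! \<tau> r) [0..<2]"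
        using K lt by (auto simp: list_eq_iff_nth_eq)
      moreover have "take 2 (drop 2 (map (\<lambda>r. K ! \<tau> r) [0..<7])) = map (\<lambda>r. take 4 K ! \<tau> r) [2..<4]"
        using K lt by (auto simp: list_eq_iff_nth_eq less_2_cases_iff numeral_2_eq_2 numeral_3_eq_3)
      ultimately show ?thesis
        using K \<tau>7 by (simp add: F_def tensor_prod_def eps_permute)
    qed
    have "(\<Sum>\<tau> | \<tau> permutes {..<4}. eps (map (\<lambda>r. K ! \<tau> r) [0..<7]) * F (map (\<lambda>r. K ! \<tau> r) [0..<7]))
       = (\<Sum>\<tau> | \<tau> permutes {..<4}. of_int (sign \<tau>) * \<alpha> (map (\<lambda>r. take 4 K ! \<tau> r) [0..<2]) *
           \<beta> (map (\<lambda>r. take 4 K ! \<tau> r) [2..<4]) * (eps K * \<gamma> (drop 4 K)))"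
      by (rule sum.cong[OF refl], rule *[symmetric], simp)
    then show ?thesis
      by (simp add: tensor_prod_def wedge_def fact_numeral flip: sum_distrib_right)
  qed
  have "(\<Sum>K | length K = 7. eps K * tensor_prod 4 (wedge 2 2 \<alpha> \<beta>) \<gamma> K)
     = (\<Sum>K | length K = 7. \<Sum>\<tau> | \<tau> permutes {..<4}. eps (map (\<lambda>r. K ! \<tau> r) [0..<7]) * F (map (\<lambda>r. K ! \<tau> r) [0..<7])) / 4"
    by (subst sum_divide_distrib, rule sum.cong[OF refl], rule key) simp
  also have "(\<Sum>K | length K = 7. \<Sum>\<tau> | \<tau> permutes {..<4}. eps (map (\<lambda>r. K ! \<tau> r) [0..<7]) * F (map (\<lambda>r. K ! \<tau> r) [0..<7]))
     = (\<Sum>\<tau> | \<tau> permutes {..<4::nat}. \<Sum>K | length K = 7. eps K * F K)"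
  proof (subst sum.swap, rule sum.cong[OF refl])
    fix \<tau> :: "nat \<Rightarrow> nat" assume "\<tau> \<in> {\<tau>. \<tau> permutes {..<4}}"
    then have \<tau>: "\<tau> permutes {..<7}"
      using permutes_subset[of \<tau> "{..<4}" "{..<7}"] by auto
    have lt: "\<tau> r < 7" "inv \<tau> r < 7" if "r < 7" for r
      using permutes_in_image[OF \<tau>, of r] permutes_in_image[OF permutes_inv[OF \<tau>], of r] that by simp_all
    show "(\<Sum>K | length K = 7. eps (map (\<lambda>r. K ! \<tau> r) [0..<7]) * F (map (\<lambda>r. K ! \<tau> r) [0..<7])) = (\<Sum>K | length K = 7. eps K * F K)"
      by (rule sum.reindex_bij_witness[where j = "\<lambda>K. map (\<lambda>r. K ! \<tau> r) [0..<7]" and i = "\<lambda>K. map (\<lambda>r. K ! inv \<tau> r) [0..<7]"])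
        (auto simp: list_eq_iff_nth_eq lt permutes_inverses[OF \<tau>])
  qed
  \<comment> \<open>Each of the 4! permutations contributes the same sum; with the 2! 2! in the
    denominator of \<open>wedge\<close> the factor 6 remains.\<close>
  also have "\<dots> = 24 * eps_form \<alpha> \<beta> \<gamma>"
    by (simp add: card_permutations[where n = 4] fact_numeral eps_form_def F_def)
  finally show ?thesis by simp
qed

lemma wedge_wedge_eps_form:
  "length I = 7 \<Longrightarrow> wedge 4 3 (wedge 2 2 \<alpha> \<beta>) \<gamma> I = eps I * eps_form \<alpha> \<beta> \<gamma> / 24"
  by (simp add: wedge_4_3_eps sum_eps_wedge_2_2)


section \<open>Contraction identities for the standard form and its dual\<close>

lemma eps_zero: "\<not> distinct [a,b,c,d,e,f,g] \<Longrightarrow> eps [a,b,c,d,e,f,g] = 0"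
  by (rule eps_not_distinct) auto

lemma eps_1234567: "eps [1,2,3,4,5,6,7] = 1"
  using eps_idx by (simp only: upt_7 list.map idx_simps)

text \<open>In the order of type \<open>7\<close> the index \<open>7 = 0\<close> comes first.\<close>

lemma eps_7123456: "eps [7,1,2,3,4,5,6] = 1"
  using eps_1234567 eps_swap(1)[of 7 1 2 3 4 5 6] eps_swap(2)[of 1 7 2 3 4 5 6] eps_swap(3)[of 1 2 7 3 4 5 6]
    eps_swap(4)[of 1 2 3 7 4 5 6] eps_swap(5)[of 1 2 3 4 7 5 6] eps_swap(6)[of 1 2 3 4 5 7 6]
  by simp

text \<open>As plain rewrite rules the swaps would loop. Conditioned on an inversion they sort the
  indices, ending at \<open>eps_7123456\<close>.\<close>

lemma eps_sort:
  "b < a \<Longrightarrow> eps [a,b,c,d,e,f,g] = - eps [b,a,c,d,e,f,g]"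
  "c < b \<Longrightarrow> eps [a,b,c,d,e,f,g] = - eps [a,c,b,d,e,f,g]"
  "d < c \<Longrightarrow> eps [a,b,c,d,e,f,g] = - eps [a,b,d,c,e,f,g]"
  "e < d \<Longrightarrow> eps [a,b,c,d,e,f,g] = - eps [a,b,c,e,d,f,g]"
  "f < e \<Longrightarrow> eps [a,b,c,d,e,f,g] = - eps [a,b,c,d,f,e,g]"
  "g < f \<Longrightarrow> eps [a,b,c,d,e,f,g] = - eps [a,b,c,d,e,g,f]"
  by (rule eps_swap)+

lemma forall_less3_7:
  fixes P :: "7 \<Rightarrow> 7 \<Rightarrow> 7 \<Rightarrow> bool"
  shows "(\<forall>a b c. a < b \<longrightarrow> b < c \<longrightarrow> P a b c) \<longleftrightarrow>
     P 1 2 3 \<and> P 1 2 4 \<and> P 1 2 5 \<and> P 1 2 6 \<and> P 1 3 4 \<and> P 1 3 5 \<and> P 1 3 6 \<and>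
     P 1 4 5 \<and> P 1 4 6 \<and> P 1 5 6 \<and> P 2 3 4 \<and> P 2 3 5 \<and> P 2 3 6 \<and> P 2 4 5 \<and>
     P 2 4 6 \<and> P 2 5 6 \<and> P 3 4 5 \<and> P 3 4 6 \<and> P 3 5 6 \<and> P 4 5 6 \<and> P 7 1 2 \<and>
     P 7 1 3 \<and> P 7 1 4 \<and> P 7 1 5 \<and> P 7 1 6 \<and> P 7 2 3 \<and> P 7 2 4 \<and> P 7 2 5 \<and>
     P 7 2 6 \<and> P 7 3 4 \<and> P 7 3 5 \<and> P 7 3 6 \<and> P 7 4 5 \<and> P 7 4 6 \<and> P 7 5 6"
  unfolding forall_7 by (simp add: less_7)

lemma forall_less4_7:
  fixes P :: "7 \<Rightarrow> 7 \<Rightarrow> 7 \<Rightarrow> 7 \<Rightarrow> bool"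
  shows "(\<forall>a b c d. a < b \<longrightarrow> b < c \<longrightarrow> c < d \<longrightarrow> P a b c d) \<longleftrightarrow>
     P 1 2 3 4 \<and> P 1 2 3 5 \<and> P 1 2 3 6 \<and> P 1 2 4 5 \<and> P 1 2 4 6 \<and> P 1 2 5 6 \<and> P 1 3 4 5 \<and>
     P 1 3 4 6 \<and> P 1 3 5 6 \<and> P 1 4 5 6 \<and> P 2 3 4 5 \<and> P 2 3 4 6 \<and> P 2 3 5 6 \<and> P 2 4 5 6 \<and>
     P 3 4 5 6 \<and> P 7 1 2 3 \<and> P 7 1 2 4 \<and> P 7 1 2 5 \<and> P 7 1 2 6 \<and> P 7 1 3 4 \<and> P 7 1 3 5 \<and>
     P 7 1 3 6 \<and> P 7 1 4 5 \<and> P 7 1 4 6 \<and> P 7 1 5 6 \<and> P 7 2 3 4 \<and> P 7 2 3 5 \<and> P 7 2 3 6 \<and>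
     P 7 2 4 5 \<and> P 7 2 4 6 \<and> P 7 2 5 6 \<and> P 7 3 4 5 \<and> P 7 3 4 6 \<and> P 7 3 5 6 \<and> P 7 4 5 6"
  unfolding forall_7 by (simp add: less_7)

text \<open>Each triple occurs in 3! orders, and in each of them the signs of \<open>eps\<close> and
  \<open>phi0\<close> compensate.\<close>

lemma sum_eps_phi0_lines:
  "(\<Sum>e\<in>UNIV. \<Sum>f\<in>UNIV. \<Sum>g\<in>UNIV. eps [a,b,c,d,e,f,g] * phi0 [e,f,g]) =
     6 * (eps [a,b,c,d,1,2,3] + eps [a,b,c,d,1,4,5] + eps [a,b,c,d,1,6,7] + eps [a,b,c,d,2,4,6]
        - eps [a,b,c,d,2,5,7] - eps [a,b,c,d,3,4,7] - eps [a,b,c,d,3,5,6])"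
proof -
  show ?thesis
    by (simp add: sum_7 phi0_table eps_sort(5,6) less_7)
qed

text \<open>Up to 3! and the orientation sign this is the Hodge dual of \<open>phi0\<close>. Both
  sides are skew, so increasing indices suffice.\<close>

lemma sum_eps_phi0:
  "(\<Sum>e\<in>UNIV. \<Sum>f\<in>UNIV. \<Sum>g\<in>UNIV. eps [a,b,c,d,e,f,g] * phi0 [e,f,g]) = - 6 * psi0 a b c d"
proof -
  define D where "D a b c d = eps [a,b,c,d,1,2,3] + eps [a,b,c,d,1,4,5] + eps [a,b,c,d,1,6,7] + eps [a,b,c,d,2,4,6]
        - eps [a,b,c,d,2,5,7] - eps [a,b,c,d,3,4,7] - eps [a,b,c,d,3,5,6]" for a b c d
  have le: "\<forall>a b c d. a < b \<longrightarrow> b < c \<longrightarrow> c < d \<longrightarrow> D a b c d = - psi0 a b c d"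
    unfolding forall_less4_7 by (simp add: less_7 D_def psi0_def phi0_table sum_negf eps_zero eps_sort eps_7123456)
  have "D a b c d = - psi0 a b c d" for a b c d
  proof (rule alternating4_eqI[of D "\<lambda>a b c d. - psi0 a b c d"], goal_cases)
    show "D b a c d = - D a b c d" "D a c b d = - D a b c d" "D a b d c = - D a b c d" for a b c d
      unfolding D_def eps_swap(1)[of b a] eps_swap(2)[of a c b] eps_swap(3)[of a b d c] by simp_all
    show "- psi0 b a c d = - (- psi0 a b c d)" "- psi0 a c b d = - (- psi0 a b c d)" "- psi0 a b d c = - (- psi0 a b c d)" for a b c d
      using psi0_swap12[of b a c d] psi0_swap23[of a b c d] psi0_swap34[of a b d c] by simp_all
  qed (use le in blast)
  then show ?thesis
    unfolding sum_eps_phi0_lines D_def by simp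
qed

lemma phi0_cyc: "phi0 [i,j,k] = phi0 [j,k,i]"
  using phi0_swap[of j i k] phi0_swap[of j k i] by simp

lemma sum_of_bool_conj [simp]:
  fixes f :: "'i::finite \<Rightarrow> 'i \<Rightarrow> real"
  shows "(\<Sum>i\<in>UNIV. \<Sum>j\<in>UNIV. of_bool (i = a \<and> j = b) * f i j) = f a b"
    "(\<Sum>i\<in>UNIV. \<Sum>j\<in>UNIV. of_bool (i = b \<and> j = a) * f i j) = f b a"
  by (simp_all add: of_bool_conj mult.assoc sum_distrib_left[symmetric])

text \<open>Every index lies in three triples, each read in two orders, which gives 6; two indices
  determine the third, so distinct \<open>a\<close>, \<open>b\<close> give 0.\<close>

lemma phi0_phi0_2: "(\<Sum>i\<in>UNIV. \<Sum>j\<in>UNIV. phi0 [i,j,a] * phi0 [i,j,b]) = 6 * of_bool (a = b)"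
proof -
  have "\<forall>a b. (\<Sum>i\<in>UNIV. \<Sum>j\<in>UNIV. phi0 [i,j,a] * phi0 [i,j,b]) = 6 * of_bool (a = b)"
    unfolding forall_7 by (simp add: sum_7 phi0_table)
  then show ?thesis by blast
qed

text \<open>In the expansion of \<open>psi0\<close> the two deltas contribute \<open>2 phi0\<close>
  and the contraction of \<open>phi0\<close> with itself \<open>- 6 phi0\<close>.\<close>

lemma psi0_phi0: "(\<Sum>i\<in>UNIV. \<Sum>j\<in>UNIV. psi0 a b i j * phi0 [i,j,c]) = - 4 * phi0 [a,b,c]"
proof -
  have "(\<Sum>i\<in>UNIV. \<Sum>j\<in>UNIV. (\<Sum>k\<in>UNIV. phi0 [a,b,k] * phi0 [i,j,k]) * phi0 [i,j,c])
      = (\<Sum>k\<in>UNIV. phi0 [a,b,k] * (\<Sum>i\<in>UNIV. \<Sum>j\<in>UNIV. phi0 [i,j,k] * phi0 [i,j,c]))"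
    unfolding sum_distrib_left sum_distrib_right
    by (subst sum.swap[of _ UNIV UNIV], subst sum.swap[of _ _ UNIV], intro sum.cong refl) (simp add: mult_ac)
  also have "\<dots> = 6 * phi0 [a,b,c]"
    by (simp add: phi0_phi0_2 mult.left_commute sum_distrib_left[symmetric])
  finally have *: "(\<Sum>i\<in>UNIV. \<Sum>j\<in>UNIV. (\<Sum>k\<in>UNIV. phi0 [a,b,k] * phi0 [i,j,k]) * phi0 [i,j,c]) = 6 * phi0 [a,b,c]" .
  have "(\<Sum>i\<in>UNIV. \<Sum>j\<in>UNIV. psi0 a b i j * phi0 [i,j,c])
      = (\<Sum>i\<in>UNIV. \<Sum>j\<in>UNIV. of_bool (i = a \<and> j = b) * phi0 [i,j,c] - of_bool (i = b \<and> j = a) * phi0 [i,j,c]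
      - (\<Sum>k\<in>UNIV. phi0 [a,b,k] * phi0 [i,j,k]) * phi0 [i,j,c])"
    unfolding psi0_def by (intro sum.cong refl) (simp only: left_diff_distrib conj_commute eq_commute)
  also have "\<dots> = phi0 [a,b,c] - phi0 [b,a,c] - 6 * phi0 [a,b,c]"
    by (simp only: sum_subtractf sum_of_bool_conj *)
  finally show ?thesis
    using phi0_swap(1)[of a b c] by simp
qed

lemma sum_rotate3:
  "(\<Sum>a\<in>A. \<Sum>b\<in>B. \<Sum>c\<in>C. F a b c) = (\<Sum>c\<in>C. \<Sum>a\<in>A. \<Sum>b\<in>B. F a b c)"
  by (subst sum.swap[of _ C B], subst sum.swap[of _ C A], rule refl)

lemma sum_rotate4:
  "(\<Sum>a\<in>A. \<Sum>b\<in>B. \<Sum>c\<in>C. \<Sum>d\<in>D. F a b c d) = (\<Sum>d\<in>D. \<Sum>a\<in>A. \<Sum>b\<in>B. \<Sum>c\<in>C. F a b c d)"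
  by (subst sum_rotate3, rule sum.swap)

lemma sum_3: "(\<Sum>K | length K = 3. F K) = (\<Sum>i\<in>UNIV. \<Sum>j\<in>UNIV. \<Sum>k\<in>UNIV. F [i, j, k])" for F :: "'i::finite list \<Rightarrow> real"
  by (simp add: sum_length_Suc numeral_3_eq_3)

text \<open>The constant is (-6) (-4) 6, from \<open>sum_eps_phi0\<close>, \<open>psi0_phi0\<close>
  and \<open>phi0_phi0_2\<close> in turn. Being positive against the -6 of the convention, it makes
  the volume of \<open>phi0\<close> negative.\<close>

lemma eps_form_phi0: "eps_form (int_prod u phi0) (int_prod w phi0) phi0 = 144 * (u \<bullet> w)"
proof -
  have "eps_form (int_prod u phi0) (int_prod w phi0) phi0
     = (\<Sum>a\<in>UNIV. \<Sum>b\<in>UNIV. \<Sum>c\<in>UNIV. \<Sum>d\<in>UNIV. int_prod u phi0 [a,b] * int_prod w phi0 [c,d] *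
         (\<Sum>e\<in>UNIV. \<Sum>f\<in>UNIV. \<Sum>g\<in>UNIV. eps [a,b,c,d,e,f,g] * phi0 [e,f,g]))"
    unfolding eps_form_def
    by (simp add: sum_length_Suc numeral_eq_Suc tensor_prod_def sum_distrib_left mult_ac)
  also have "\<dots> = - 6 * (\<Sum>a\<in>UNIV. \<Sum>b\<in>UNIV. int_prod u phi0 [a,b] *
         (\<Sum>j\<in>UNIV. w $ j * (\<Sum>c\<in>UNIV. \<Sum>d\<in>UNIV. psi0 a b c d * phi0 [j,c,d])))"
    unfolding sum_eps_phi0 sum_distrib_left
  proof (rule sum.cong[OF refl], rule sum.cong[OF refl])
    fix a b
    have "(\<Sum>c\<in>UNIV. \<Sum>d\<in>UNIV. int_prod w phi0 [c, d] * psi0 a b c d)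
        = (\<Sum>j\<in>UNIV. \<Sum>c\<in>UNIV. \<Sum>d\<in>UNIV. w $ j * (psi0 a b c d * phi0 [j, c, d]))"
      unfolding int_prod_def sum_distrib_right
      by (subst sum.swap[of _ _ UNIV], subst sum.swap[of _ UNIV UNIV], intro sum.cong refl) (simp add: mult_ac)
    then have "- 6 * int_prod u phi0 [a, b] * (\<Sum>c\<in>UNIV. \<Sum>d\<in>UNIV. int_prod w phi0 [c, d] * psi0 a b c d)
      = - 6 * int_prod u phi0 [a, b] * (\<Sum>j\<in>UNIV. \<Sum>c\<in>UNIV. \<Sum>d\<in>UNIV. w $ j * (psi0 a b c d * phi0 [j, c, d]))"
      by (rule arg_cong)
    then show "(\<Sum>c\<in>UNIV. \<Sum>d\<in>UNIV. int_prod u phi0 [a, b] * int_prod w phi0 [c, d] * (- 6 * psi0 a b c d)) =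
      (\<Sum>j\<in>UNIV. \<Sum>c\<in>UNIV. \<Sum>d\<in>UNIV. - 6 * (int_prod u phi0 [a, b] * (w $ j * (psi0 a b c d * phi0 [j, c, d]))))"
      unfolding sum_distrib_left by (simp only: mult_ac)
  qed
  also have "\<dots> = 24 * (\<Sum>a\<in>UNIV. \<Sum>b\<in>UNIV. int_prod u phi0 [a,b] * int_prod w phi0 [a,b])"
  proof -
    have "phi0 [j,c,d] = phi0 [c,d,j]" for j c d
      using phi0_swap[of c j d] phi0_swap[of c d j] by simp
    then have "(\<Sum>c\<in>UNIV. \<Sum>d\<in>UNIV. psi0 a b c d * phi0 [j,c,d]) = - 4 * phi0 [j,a,b]" for a b j
      by (simp add: psi0_phi0)
    then have "(\<Sum>j\<in>UNIV. w $ j * (\<Sum>c\<in>UNIV. \<Sum>d\<in>UNIV. psi0 a b c d * phi0 [j,c,d])) = - 4 * int_prod w phi0 [a,b]" for a b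
      by (simp add: int_prod_def sum_distrib_left sum_negf mult_ac)
    then show ?thesis
      by (simp only:) (simp add: sum_distrib_left sum_negf mult_ac)
  qed
  also have "(\<Sum>a\<in>UNIV. \<Sum>b\<in>UNIV. int_prod u phi0 [a,b] * int_prod w phi0 [a,b]) = 6 * (u \<bullet> w)"
  proof -
    have ip: "int_prod u phi0 [a,b] = (\<Sum>i\<in>UNIV. u $ i * phi0 [a,b,i])" for u a b
      unfolding int_prod_def by (intro sum.cong refl) (simp add: phi0_cyc[of _ a b])
    have "(\<Sum>a\<in>UNIV. \<Sum>b\<in>UNIV. int_prod u phi0 [a,b] * int_prod w phi0 [a,b])
        = (\<Sum>i\<in>UNIV. \<Sum>j\<in>UNIV. u $ i * w $ j * (\<Sum>a\<in>UNIV. \<Sum>b\<in>UNIV. phi0 [a,b,i] * phi0 [a,b,j]))"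
      unfolding ip sum_product unfolding sum_distrib_left
      by (subst sum_rotate4, subst sum_rotate4, intro sum.cong refl) (simp add: mult_ac)
    then show ?thesis
      by (simp add: phi0_phi0_2 inner_vec_def sum_distrib_left mult_ac of_bool_def
          if_distrib[of "\<lambda>x. _ * x"] cong: if_cong)
  qed
  finally show ?thesis by simp
qed

section \<open>The metric and the dual form of a G2-form\<close>

text \<open>The product \<open>v g\<close> that the convention determines before scale and
  orientation are separated; 144 = 6 * 24 combines the 6 of the convention with the 24 of
  \<open>eps_form\<close>.\<close>

definition b_form :: "tensor \<Rightarrow> real^7^7" where
  "b_form f = (\<chi> i j. - eps_form (int_prod (axis i 1) f) (int_prod (axis j 1) f) f / 144)"

lemma int_prod_axis: "int_prod (axis i 1) f I = f (i # I)"
  by (simp add: int_prod_def axis_def if_distrib[of "\<lambda>x. x * _"] cong: if_cong)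

lemma eps_form_sum1:
  "eps_form (int_prod u f) \<beta> \<gamma> = (\<Sum>i\<in>UNIV. u $ i * eps_form (int_prod (axis i 1) f) \<beta> \<gamma>)"
  unfolding eps_form_def tensor_prod_def int_prod_axis sum_distrib_left
  by (subst sum.swap) (simp add: int_prod_def sum_distrib_left sum_distrib_right mult_ac)

lemma eps_form_sum2:
  "eps_form \<alpha> (int_prod u f) \<gamma> = (\<Sum>i\<in>UNIV. u $ i * eps_form \<alpha> (int_prod (axis i 1) f) \<gamma>)"
  unfolding eps_form_def tensor_prod_def int_prod_axis sum_distrib_left
  by (subst sum.swap) (simp add: int_prod_def sum_distrib_left sum_distrib_right mult_ac)

lemma eps_form_b_form:
  "eps_form (int_prod u f) (int_prod w f) f = - 144 * (u \<bullet> (b_form f *v w))"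
  unfolding eps_form_sum1[of u] eps_form_sum2[of _ w]
  by (simp add: b_form_def inner_vec_def matrix_vector_mult_def sum_distrib_left sum_negf sum_divide_distrib mult_ac)
    (rule sum.swap)

lemma matrix_eqI_inner:
  fixes A B :: "real^'n^'m"
  assumes "\<And>u w. u \<bullet> (A *v w) = u \<bullet> (B *v w)"
  shows "A = B"
  using assms by (metis matrix_eq vector_eq_rdot inner_commute)

lemma is_G2_metric_vol_iff:
  "is_G2_metric_vol f G v \<longleftrightarrow>
     transpose G = G \<and> (\<forall>u. u \<noteq> 0 \<longrightarrow> u \<bullet> (G *v u) > 0) \<and> \<bar>v\<bar> = sqrt (det G) \<and> b_form f = v *\<^sub>R G"
proof -
  have "(\<forall>u w I. length I = 7 \<longrightarrow>
        wedge 4 3 (wedge 2 2 (int_prod u f) (int_prod w f)) f I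
          = - 6 * (u \<bullet> (G *v w)) * top_form v I) \<longleftrightarrow>
    (\<forall>u w I. length I = 7 \<longrightarrow> eps I * (u \<bullet> (b_form f *v w)) = eps I * (u \<bullet> ((v *\<^sub>R G) *v w)))"
    by (simp add: wedge_wedge_eps_form eps_form_b_form top_form_eps scaleR_matrix_vector_assoc[symmetric]) (auto simp: field_simps)
  also have "\<dots> \<longleftrightarrow> b_form f = v *\<^sub>R G"
  proof
    assume *: "\<forall>u w I. length I = 7 \<longrightarrow> eps I * (u \<bullet> (b_form f *v w)) = eps I * (u \<bullet> ((v *\<^sub>R G) *v w))"
    show "b_form f = v *\<^sub>R G"
      using *[rule_format, of "[1,2,3,4,5,6,7]"] by (intro matrix_eqI_inner) (simp add: eps_1234567)
  qed simp
  finally show ?thesis unfolding is_G2_metric_vol_def by blast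
qed

lemma det_scaleR: "det (c *\<^sub>R A) = c ^ CARD('n) * det A" for A :: "real^'n^'n"
proof -
  have "c *\<^sub>R A = (\<chi> i. c *s A $ i)"
    by (simp add: vec_eq_iff)
  then show ?thesis
    using det_rows_mul[of "\<lambda>_. c" "\<lambda>i. A $ i"] by (simp only: prod_constant) simp
qed

text \<open>Since \<open>v^2 = det G\<close>, the determinant of \<open>v G\<close> is
  \<open>v^7 v^2\<close>. An odd root recovers \<open>v\<close> together with its sign, so metric
  and orientation are both unique.\<close>

lemma is_G2_metric_vol_explicit:
  assumes "is_G2_metric_vol f G v"
  shows "v = root 9 (det (b_form f))" "G = b_form f /\<^sub>R v" "v \<noteq> 0" "v ^ 2 = det G"
proof -
  have G: "\<forall>u. u \<noteq> 0 \<longrightarrow> u \<bullet> (G *v u) > 0" and v: "\<bar>v\<bar> = sqrt (det G)" and b: "b_form f = v *\<^sub>R G"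
    using assms by (auto simp: is_G2_metric_vol_iff)
  have "\<forall>x. G *v x = 0 \<longrightarrow> x = 0"
    using G by (metis inner_zero_right less_irrefl)
  then have "det G \<noteq> 0"
    by (metis invertible_det_nz invertible_left_inverse matrix_left_invertible_ker)
  moreover have "det G \<ge> 0"
    using v by (metis abs_ge_zero real_sqrt_ge_0_iff)
  ultimately show v2: "v ^ 2 = det G" and v0: "v \<noteq> 0"
    using v by (metis power2_abs real_sqrt_pow2, auto)
  have "det (b_form f) = v ^ 9"
    unfolding b det_scaleR by (simp add: v2[symmetric] power_add[symmetric])
  then show "v = root 9 (det (b_form f))"
    by (simp add: odd_real_root_power_cancel)
  show "G = b_form f /\<^sub>R v"
    using v0 by (simp add: b)
qed

lemma G2_metric_vol_eq:
  assumes "is_G2_metric_vol f G v"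
  shows "G2_metric f = G" "G2_vol f = v"
proof -
  have "(THE (G, v). is_G2_metric_vol f G v) = (G, v)"
  proof (rule the_equality)
    show "case (G, v) of (G, v) \<Rightarrow> is_G2_metric_vol f G v" using assms by simp
    show "p = (G, v)" if "case p of (G, v) \<Rightarrow> is_G2_metric_vol f G v" for p
    proof (cases p)
      case (Pair G' v')
      then have "is_G2_metric_vol f G' v'" using that by simp
      from is_G2_metric_vol_explicit(1,2)[OF this] is_G2_metric_vol_explicit(1,2)[OF assms]
      show ?thesis using Pair by metis
    qed
  qed
  then show "G2_metric f = G" "G2_vol f = v"
    by (simp_all add: G2_metric_def G2_vol_def)
qed

text \<open>For \<open>phi0\<close> the metric is the identity and the volume -1. Under pullback
  vectors are moved by \<open>L\<close> and \<open>eps_form\<close> acquires the factor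
  \<open>det L\<close>.\<close>

lemma is_G2_metric_vol_pullback:
  assumes L: "invertible L" and f: "\<And>I. length I = 3 \<Longrightarrow> f I = pullback L phi0 I"
  shows "is_G2_metric_vol f (transpose L ** L) (- det L)"
proof -
  have "u \<bullet> (b_form f *v w) = u \<bullet> ((- det L *\<^sub>R (transpose L ** L)) *v w)" for u w
  proof -
    have "int_prod u f I = pullback L (int_prod (L *v u) phi0) I" if "length I = 2" for u I
    proof -
      have "int_prod u f I = int_prod u (pullback L phi0) I"
        using that by (simp add: int_prod_def f)
      then show ?thesis by (simp add: int_prod_pullback)
    qed
    then have "eps_form (int_prod u f) (int_prod w f) f
        = eps_form (pullback L (int_prod (L *v u) phi0)) (pullback L (int_prod (L *v w) phi0)) (pullback L phi0)"
      by (intro eps_form_cong) (simp_all add: f)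
    also have "\<dots> = 144 * det L * ((L *v u) \<bullet> (L *v w))"
      by (simp add: eps_form_pullback eps_form_phi0)
    also have "(L *v u) \<bullet> (L *v w) = u \<bullet> ((transpose L ** L) *v w)"
      by (metis dot_lmul_matrix matrix_vector_mul_assoc transpose_matrix_vector transpose_transpose)
    finally show ?thesis
      by (simp add: eps_form_b_form scaleR_matrix_vector_assoc[symmetric] del: scaleR_minus_left)
  qed
  then have "b_form f = (- det L) *\<^sub>R (transpose L ** L)"
    by (rule matrix_eqI_inner)
  moreover have "u \<bullet> ((transpose L ** L) *v u) > 0" if "u \<noteq> 0" for u
  proof -
    have "u \<bullet> ((transpose L ** L) *v u) = (L *v u) \<bullet> (L *v u)"
      by (metis dot_lmul_matrix matrix_vector_mul_assoc transpose_matrix_vector transpose_transpose)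
    moreover have "L *v u \<noteq> 0"
      using L that by (metis invertible_def matrix_left_invertible_ker)
    ultimately show ?thesis by simp
  qed
  ultimately show ?thesis
    by (auto simp: is_G2_metric_vol_iff matrix_transpose_mul det_mul det_transpose)
qed

lemma matrix_inv_eqI:
  assumes "A ** B = mat 1" "B ** A = mat 1"
  shows "matrix_inv A = (B :: real^'n^'n)"
proof -
  have "A ** matrix_inv A = mat 1 \<and> matrix_inv A ** A = mat 1"
    unfolding matrix_inv_def by (rule someI_ex) (use assms in blast)
  then show ?thesis
    using assms by (metis matrix_mul_assoc matrix_mul_lid matrix_mul_rid)
qed

lemma prod_append:
  fixes g :: "'i \<Rightarrow> 'j \<Rightarrow> real"
  assumes "length M = m" "length I = m" "length N = n" "length J = n"
  shows "(\<Prod>r<m + n. g ((M @ N) ! r) ((I @ J) ! r)) = (\<Prod>r<m. g (M ! r) (I ! r)) * (\<Prod>r<n. g (N ! r) (J ! r))"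
  using assms
proof (induction M arbitrary: m I)
  case (Cons a M)
  then obtain i I' m' where *: "I = i # I'" "m = Suc m'" by (cases I; cases m) auto
  then show ?case
    using Cons.IH[of m' I'] Cons.prems by (simp add: prod.lessThan_Suc_shift mult.assoc del: prod.lessThan_Suc)
qed simp

lemma sum_prod_mult:
  fixes g h :: "nat \<Rightarrow> 'i::finite \<Rightarrow> real"
  shows "(\<Sum>K | length K = n. (\<Prod>r<n. g r (K ! r)) * (\<Prod>r<n. h r (K ! r))) = (\<Prod>r<n. \<Sum>k\<in>UNIV. g r k * h r k)"
  by (simp add: prod_sum_length prod.distrib)

definition psi_tensor :: tensor where
  "psi_tensor I = psi0 (I ! 0) (I ! 1) (I ! 2) (I ! 3)"

lemma eps_rotate3: "eps [e,f,g,a,b,c,d] = eps [a,b,c,d,e,f,g]"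
proof -
  have "eps [e,f,g,a,b,c,d] = eps [e,f,a,b,c,d,g]"
    using eps_swap(3)[of e f a g b c d] eps_swap(4)[of e f a b g c d] eps_swap(5)[of e f a b c g d]
      eps_swap(6)[of e f a b c d g] by simp
  also have "\<dots> = eps [e,a,b,c,d,f,g]"
    using eps_swap(2)[of e a f b c d g] eps_swap(3)[of e a b f c d g] eps_swap(4)[of e a b c f d g]
      eps_swap(5)[of e a b c d f g] by simp
  also have "\<dots> = eps [a,b,c,d,e,f,g]"
    using eps_swap(1)[of a e b c d f g] eps_swap(2)[of a b e c d f g] eps_swap(3)[of a b c e d f g]
      eps_swap(4)[of a b c d e f g] by simp
  finally show ?thesis .
qed

lemma sum_phi0_eps:
  assumes "length N = 4"
  shows "(\<Sum>M | length M = 3. phi0 M * eps (M @ N)) = - 6 * psi_tensor N"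
proof -
  obtain a b c d where "N = [a,b,c,d]"
    using assms by (auto simp: numeral_eq_Suc length_Suc_conv)
  then show ?thesis
    using sum_eps_phi0[of a b c d]
    by (simp add: sum_3 psi_tensor_def eps_rotate3[of _ _ _ a b c d] mult.commute)
qed

text \<open>The volume \<open>det L * eps\<close> is rewritten as \<open>eps\<close> contracted with
  seven copies of \<open>L\<close>. The inverse metric turns the copies of \<open>L\<close> from
  \<open>f\<close> into copies of \<open>E\<close>, which cancel the three copies of
  \<open>L\<close> on \<open>I\<close>. What remains is \<open>phi0\<close> contracted with
  \<open>eps\<close>, which is -6 \<open>psi0\<close>, with four copies of \<open>L\<close> on
  \<open>J\<close>; the sign of the volume and the 3! of \<open>hodge\<close> remove the factor
  -6.\<close>

lemma hodge_phi0_pullback: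
  assumes LE: "L ** E = mat 1" and J: "length J = 4"
    and f: "\<And>I. length I = 3 \<Longrightarrow> f I = pullback L phi0 I"
    and Gi: "matrix_inv G = E ** transpose E"
  shows "hodge G (- det L) 3 f J = pullback L psi_tensor J"
proof -
  have GL: "(\<Sum>k\<in>UNIV. matrix_inv G $ i $ k * L $ m $ k) = E $ i $ m" for i m
  proof -
    have "(\<Sum>k\<in>UNIV. matrix_inv G $ i $ k * L $ m $ k) = (E ** transpose E ** transpose L) $ i $ m"
      by (simp add: Gi matrix_matrix_mult_def transpose_def)
    also have "E ** transpose E ** transpose L = E ** transpose (L ** E)"
      by (simp add: matrix_transpose_mul matrix_mul_assoc)
    finally show ?thesis by (simp add: LE transpose_mat)
  qed
  have GLp: "(\<Sum>K | length K = 3. (\<Prod>r<3. matrix_inv G $ (I ! r) $ (K ! r)) * (\<Prod>r<3. L $ (M ! r) $ (K ! r)))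
      = (\<Prod>r<3. E $ (I ! r) $ (M ! r))" for I M
    using sum_prod_mult[of "\<lambda>r k. matrix_inv G $ (I ! r) $ k" 3 "\<lambda>r k. L $ (M ! r) $ k"] by (simp only: GL)
  have LE': "(\<Sum>k\<in>UNIV. E $ k $ m * L $ m' $ k) = of_bool (m' = m)" for m m'
    using LE by (simp add: vec_eq_iff matrix_matrix_mult_def mat_def of_bool_def mult.commute)
  define c where "c I = - det L * eps (I @ J)" for I
  have c: "c I = - (\<Sum>M' | length M' = 3. \<Sum>N | length N = 4.
      (\<Prod>r<3. L $ (M' ! r) $ (I ! r)) * (eps (M' @ N) * (\<Prod>r<4. L $ (N ! r) $ (J ! r))))" if I: "length I = 3" for I
  proof -
    have "det L * eps (I @ J) = (\<Sum>K | length K = 3 + 4. eps K * (\<Prod>r<3 + 4. L $ (K ! r) $ ((I @ J) ! r)))"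
      using I J sum_eps_pullback[of "I @ J" L] by simp
    also have "\<dots> = (\<Sum>K | length K = 3 + 4. (\<lambda>M N. eps (M @ N) * (\<Prod>r<3 + 4. L $ ((M @ N) ! r) $ ((I @ J) ! r))) (take 3 K) (drop 3 K))"
      by simp
    also have "\<dots> = (\<Sum>M' | length M' = 3. \<Sum>N | length N = 4. eps (M' @ N) * (\<Prod>r<3 + 4. L $ ((M' @ N) ! r) $ ((I @ J) ! r)))"
      by (rule sum_length_add)
    also have "\<dots> = (\<Sum>M' | length M' = 3. \<Sum>N | length N = 4.
        (\<Prod>r<3. L $ (M' ! r) $ (I ! r)) * (eps (M' @ N) * (\<Prod>r<4. L $ (N ! r) $ (J ! r))))"
    proof (intro sum.cong refl)
      fix M' N :: "7 list" assume "M' \<in> {M'. length M' = 3}" "N \<in> {N. length N = 4}"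
      then show "eps (M' @ N) * (\<Prod>r<3 + 4. L $ ((M' @ N) ! r) $ ((I @ J) ! r)) =
          (\<Prod>r<3. L $ (M' ! r) $ (I ! r)) * (eps (M' @ N) * (\<Prod>r<4. L $ (N ! r) $ (J ! r)))"
        using prod_append[of M' 3 I N 4 J "\<lambda>i j. L $ i $ j"] I J by (simp only: mem_Collect_eq) (simp only: mult_ac)
    qed
    finally show ?thesis by (simp add: c_def)
  qed
  have "6 * hodge G (- det L) 3 f J =
      (\<Sum>I | length I = 3. \<Sum>K | length K = 3. (\<Prod>r<3. matrix_inv G $ (I ! r) $ (K ! r)) * f K * c I)"
    by (simp add: hodge_def top_form_eps c_def fact_numeral)
  also have "\<dots> = (\<Sum>I | length I = 3. \<Sum>K | length K = 3. \<Sum>M | length M = 3.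
        ((\<Prod>r<3. matrix_inv G $ (I ! r) $ (K ! r)) * (\<Prod>r<3. L $ (M ! r) $ (K ! r))) * (phi0 M * c I))"
    by (intro sum.cong refl) (simp add: f pullback_def sum_distrib_left sum_distrib_right mult_ac)
  also have "\<dots> = (\<Sum>I | length I = 3. \<Sum>M | length M = 3. (\<Prod>r<3. E $ (I ! r) $ (M ! r)) * (phi0 M * c I))"
    by (rule sum.cong[OF refl], subst sum.swap)
      (simp only: sum_distrib_right[symmetric] GLp)
  also have "\<dots> = - (\<Sum>I | length I = 3. \<Sum>M | length M = 3. \<Sum>M' | length M' = 3. \<Sum>N | length N = 4.
        ((\<Prod>r<3. E $ (I ! r) $ (M ! r)) * (\<Prod>r<3. L $ (M' ! r) $ (I ! r))) *
          (phi0 M * (eps (M' @ N) * (\<Prod>r<4. L $ (N ! r) $ (J ! r)))))"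
    unfolding sum_negf[symmetric]
    by (intro sum.cong refl) (simp add: c sum_distrib_left sum_negf mult_ac)
  also have "\<dots> = - (\<Sum>M | length M = 3. \<Sum>M' | length M' = 3. \<Sum>N | length N = 4.
        of_bool (M' = M) * (phi0 M * (eps (M' @ N) * (\<Prod>r<4. L $ (N ! r) $ (J ! r)))))"
  proof -
    have "(\<Sum>I | length I = 3. (\<Prod>r<3. E $ (I ! r) $ (M ! r)) * (\<Prod>r<3. L $ (M' ! r) $ (I ! r))) = of_bool (M' = M)"
      if "length M = 3" "length M' = 3" for M M'
    proof -
      have "(\<Sum>I | length I = 3. (\<Prod>r<3. E $ (I ! r) $ (M ! r)) * (\<Prod>r<3. L $ (M' ! r) $ (I ! r)))
          = (\<Prod>r<3. of_bool (M' ! r = M ! r))"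
        using sum_prod_mult[of "\<lambda>r k. E $ k $ (M ! r)" 3 "\<lambda>r k. L $ (M' ! r) $ k"] by (simp only: LE')
      also have "\<dots> = of_bool (M' = M)"
        using that by (auto simp: of_bool_def list_eq_iff_nth_eq)
      finally show ?thesis .
    qed
    then have *: "(\<Sum>I | length I = 3. (\<Prod>r<3. E $ (I ! r) $ (M ! r)) * (\<Prod>r<3. L $ (M' ! r) $ (I ! r)) * x) = of_bool (M' = M) * x"
      if "length M = 3" "length M' = 3" for M M' x
      using that by (simp add: sum_distrib_right[symmetric])
    show ?thesis
      by (subst sum_rotate4, subst sum_rotate4, subst sum_rotate4)
        (intro arg_cong[where f = uminus] sum.cong[OF refl], simp add: *)
  qed
  also have "\<dots> = - (\<Sum>N | length N = 4. (\<Prod>r<4. L $ (N ! r) $ (J ! r)) * (\<Sum>M | length M = 3. phi0 M * eps (M @ N)))"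
  proof -
    have "(\<Sum>M' | length M' = 3. \<Sum>N | length N = 4. of_bool (M' = M) * (phi0 M * (eps (M' @ N) * (\<Prod>r<4. L $ (N ! r) $ (J ! r)))))
        = (\<Sum>N | length N = 4. phi0 M * (eps (M @ N) * (\<Prod>r<4. L $ (N ! r) $ (J ! r))))" if "length M = 3" for M
    proof (subst sum.swap, rule sum.cong[OF refl])
      fix N :: "7 list"
      have "(\<Sum>M' | length M' = 3. of_bool (M' = M) * (phi0 M * (eps (M' @ N) * (\<Prod>r<4. L $ (N ! r) $ (J ! r)))))
          = (\<Sum>M'\<in>{M}. of_bool (M' = M) * (phi0 M * (eps (M' @ N) * (\<Prod>r<4. L $ (N ! r) $ (J ! r)))))"
        using that by (intro sum.mono_neutral_right) (auto simp: finite_length_eq)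
      then show "(\<Sum>M' | length M' = 3. of_bool (M' = M) * (phi0 M * (eps (M' @ N) * (\<Prod>r<4. L $ (N ! r) $ (J ! r)))))
          = phi0 M * (eps (M @ N) * (\<Prod>r<4. L $ (N ! r) $ (J ! r)))"
        by simp
    qed
    then have "(\<Sum>M | length M = 3. \<Sum>M' | length M' = 3. \<Sum>N | length N = 4.
          of_bool (M' = M) * (phi0 M * (eps (M' @ N) * (\<Prod>r<4. L $ (N ! r) $ (J ! r)))))
        = (\<Sum>M | length M = 3. \<Sum>N | length N = 4. phi0 M * (eps (M @ N) * (\<Prod>r<4. L $ (N ! r) $ (J ! r))))"
      by (rule sum.cong[OF refl]) simp
    also have "\<dots> = (\<Sum>N | length N = 4. (\<Prod>r<4. L $ (N ! r) $ (J ! r)) * (\<Sum>M | length M = 3. phi0 M * eps (M @ N)))"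
      by (subst sum.swap) (simp add: sum_distrib_left mult_ac)
    finally show ?thesis by simp
  qed
  also have "\<dots> = 6 * pullback L psi_tensor J"
    by (simp add: sum_phi0_eps pullback_def J sum_distrib_left sum_negf mult_ac)
  finally show ?thesis by simp
qed

text \<open>\<open>L\<close> is an orthonormal coframe in which \<open>f\<close> is the standard
  form and \<open>E\<close> is the dual frame. Through it, pointwise identities for G2-forms reduce
  to those for \<open>phi0\<close>.\<close>

lemma G2_frame:
  assumes "G2_form f"
  obtains L E where "L ** E = mat 1" "E ** L = mat 1" "\<And>I. length I = 3 \<Longrightarrow> f I = pullback L phi0 I"
    "G2_metric f = transpose L ** L" "G2_vol f = - det L" "G2_inv_metric f = E ** transpose E"
    "\<And>J. length J = 4 \<Longrightarrow> G2_psi f J = pullback L psi_tensor J"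
proof -
  obtain L where L: "invertible L" and f: "\<And>I. length I = 3 \<Longrightarrow> f I = pullback L phi0 I"
    using assms by (auto simp: G2_form_def)
  then obtain E where LE: "L ** E = mat 1" and EL: "E ** L = mat 1"
    by (auto simp: invertible_def)
  have G: "G2_metric f = transpose L ** L" and v: "G2_vol f = - det L"
    using G2_metric_vol_eq[OF is_G2_metric_vol_pullback[OF L f]] by auto
  have t: "transpose L ** transpose E = mat 1" "transpose E ** transpose L = mat 1"
    by (simp_all add: matrix_transpose_mul[symmetric] LE EL transpose_mat)
  have "matrix_inv (transpose L ** L) = E ** transpose E"
  proof (rule matrix_inv_eqI)
    show "transpose L ** L ** (E ** transpose E) = mat 1"
      by (metis LE t(1) matrix_mul_assoc matrix_mul_lid)
    show "E ** transpose E ** (transpose L ** L) = mat 1"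
      by (metis EL t(2) matrix_mul_assoc matrix_mul_lid)
  qed
  then have Gi: "G2_inv_metric f = E ** transpose E" "matrix_inv (G2_metric f) = E ** transpose E"
    by (simp_all add: G2_inv_metric_def G)
  have "G2_psi f J = pullback L psi_tensor J" if "length J = 4" for J
    unfolding G2_psi_def v by (rule hodge_phi0_pullback[OF LE that f Gi(2)])
  with LE EL f G v Gi(1) show ?thesis by (rule that)
qed

section \<open>Infinitesimal action of endomorphisms on 3-forms\<close>

text \<open>The derivative at \<open>s = 0\<close> of the pullback by \<open>1 + sA\<close>.\<close>

definition act :: "real^7^7 \<Rightarrow> tensor \<Rightarrow> tensor" where
  "act A S I = (\<Sum>r<length I. \<Sum>m\<in>UNIV. A $ m $ (I ! r) * S (I[r := m]))"

lemma act_2: "act A S [i,j] = (\<Sum>m\<in>UNIV. A $ m $ i * S [m,j]) + (\<Sum>m\<in>UNIV. A $ m $ j * S [i,m])"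
  by (simp add: act_def lessThan_Suc numeral_2_eq_2 add.commute)

lemma act_3: "act A S [i,j,k] = (\<Sum>m\<in>UNIV. A $ m $ i * S [m,j,k]) + (\<Sum>m\<in>UNIV. A $ m $ j * S [i,m,k])
    + (\<Sum>m\<in>UNIV. A $ m $ k * S [i,j,m])"
  by (simp add: act_def lessThan_Suc numeral_eq_Suc algebra_simps)

lemma act_3_swap:
  assumes "\<And>i j k. S [j,i,k] = - S [i,j,k]" "\<And>i j k. S [i,k,j] = - S [i,j,k]"
  shows "act A S [j,i,k] = - act A S [i,j,k]" "act A S [i,k,j] = - act A S [i,j,k]"
proof -
  have a: "S [m,i,k] = - S [i,m,k]" "S [j,m,k] = - S [m,j,k]" "S [j,i,m] = - S [i,j,m]" for m
    by (rule assms)+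
  show "act A S [j,i,k] = - act A S [i,j,k]"
    by (simp add: act_3 a sum_negf)
  have b: "S [m,k,j] = - S [m,j,k]" "S [i,m,j] = - S [i,j,m]" "S [i,k,m] = - S [i,m,k]" for m
    by (rule assms)+
  show "act A S [i,k,j] = - act A S [i,j,k]"
    by (simp add: act_3 b sum_negf)
qed

text \<open>Brings the summation index into the last slot, where \<open>phi0_table\<close> evaluates
  the sum.\<close>

lemma act_phi0_sorted: "act A phi0 [i,j,k] = (\<Sum>m\<in>UNIV. A $ m $ i * phi0 [j,k,m]) + (\<Sum>m\<in>UNIV. A $ m $ j * phi0 [k,i,m])
    + (\<Sum>m\<in>UNIV. A $ m $ k * phi0 [i,j,m])"
proof -
  have "phi0 [m,j,k] = phi0 [j,k,m]" "phi0 [i,m,k] = phi0 [k,i,m]" for m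
    using phi0_cyc[of m j k] phi0_cyc[of k i m] by simp_all
  then show ?thesis by (simp only: act_3)
qed

text \<open>Skew matrices split into the Lie algebra of G2, which both sides annihilate, and the
  matrices \<open>X^l phi0_lab\<close>. Their contraction with \<open>phi0\<close> is 6X, and half
  of it matches their action 3X \<lrcorner> \<psi>. The verification is on increasing
  indices.\<close>

lemma act_skew_phi0:
  fixes S :: "real^7^7"
  assumes S: "\<And>i j. S $ j $ i = - S $ i $ j"
  shows "act S phi0 [i,j,k] = (\<Sum>n\<in>UNIV. ((\<Sum>a\<in>UNIV. \<Sum>b\<in>UNIV. S $ a $ b * phi0 [a,b,n]) / 2) * psi0 n i j k)"
proof -
  define V where "V n = (\<Sum>a\<in>UNIV. \<Sum>b\<in>UNIV. S $ a $ b * phi0 [a,b,n]) / 2" for n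
  have S0: "S $ i $ i = 0" for i using S[of i i] by simp
  have S': "b < a \<Longrightarrow> S $ a $ b = - S $ b $ a" for a b by (rule S)
  have V: "V 1 = S $ 2 $ 3 + S $ 4 $ 5 - S $ 7 $ 6" "V 2 = - S $ 1 $ 3 + S $ 7 $ 5 + S $ 4 $ 6"
      "V 3 = S $ 1 $ 2 + S $ 7 $ 4 - S $ 5 $ 6" "V 4 = - S $ 1 $ 5 - S $ 7 $ 3 - S $ 2 $ 6"
      "V 5 = S $ 1 $ 4 - S $ 7 $ 2 + S $ 3 $ 6" "V 6 = S $ 7 $ 1 + S $ 2 $ 4 - S $ 3 $ 5"
      "V 7 = S $ 1 $ 6 - S $ 3 $ 4 - S $ 2 $ 5"
    by (simp_all add: V_def sum_7 phi0_table S' S0 less_7)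
  have "\<forall>i j k. i < j \<longrightarrow> j < k \<longrightarrow> act S phi0 [i,j,k] = (\<Sum>n\<in>UNIV. V n * psi0 n i j k)"
    unfolding forall_less3_7 act_phi0_sorted
    by (simp add: sum_7[of "\<lambda>n. V n * _ n"] psi0_def phi0_table sum_negf S' S0 less_7 V)
  then have le: "act S phi0 [i,j,k] = (\<Sum>n\<in>UNIV. V n * psi0 n i j k)" if "i < j" "j < k" for i j k
    using that by blast
  have "act S phi0 [i,j,k] = (\<Sum>n\<in>UNIV. V n * psi0 n i j k)" for i j k
  proof (rule alternating3_eqI[of "\<lambda>i j k. act S phi0 [i,j,k]" "\<lambda>i j k. \<Sum>n\<in>UNIV. V n * psi0 n i j k", OF act_3_swap[of phi0, OF phi0_swap] _ _ le])
    show "(\<Sum>n\<in>UNIV. V n * psi0 n j i k) = - (\<Sum>n\<in>UNIV. V n * psi0 n i j k)" for i j k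
      by (simp add: psi0_swap23[of _ j i k] sum_negf)
    show "(\<Sum>n\<in>UNIV. V n * psi0 n i k j) = - (\<Sum>n\<in>UNIV. V n * psi0 n i j k)" for i j k
      by (simp add: psi0_swap34[of _ i k j] sum_negf)
  qed
  then show ?thesis by (simp add: V_def)
qed

text \<open>The matrices killing \<open>phi0\<close> form the 14-dimensional Lie algebra of G2, so
  the 49-dimensional space of matrices maps onto the 35-dimensional space of 3-forms. The proof
  gives an explicit right inverse.\<close>

lemma surj_act_phi0:
  fixes \<alpha> :: tensor
  assumes \<alpha>: "\<And>i j k. \<alpha> [j,i,k] = - \<alpha> [i,j,k]" "\<And>i j k. \<alpha> [i,k,j] = - \<alpha> [i,j,k]"
  obtains B where "\<And>i j k. \<alpha> [i,j,k] = act B phi0 [i,j,k]"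
proof -
  define P where "P i j = (\<Sum>m\<in>UNIV. \<Sum>n\<in>UNIV. \<alpha> [i,m,n] * phi0 [j,m,n])" for i j
  define t where "t = (\<Sum>m\<in>UNIV. P m m)"
  \<comment> \<open>If \<alpha> is the action of a symmetric matrix B, then P = 4 B + 2 (tr B) 1 and
    t = 18 tr B. If B is skew and orthogonal to the Lie algebra of G2, then P = -12 B. The
    combination inverts both: on symmetric P the first two terms add up to P/4, on skew P to
    -P/12.\<close>
  define B :: "real^7^7" where "B = (\<chi> i j. P i j / 12 + P j i / 6 - of_bool (i = j) * t / 36)"
  have s1: "j < i \<Longrightarrow> \<alpha> [i,j,k] = - \<alpha> [j,i,k]" and s2: "k < j \<Longrightarrow> \<alpha> [i,j,k] = - \<alpha> [i,k,j]" for i j k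
    by (rule \<alpha>)+
  have z: "\<alpha> [i,i,k] = 0" "\<alpha> [i,k,k] = 0" for i k
    using \<alpha>(1)[of i i k] \<alpha>(2)[of i k k] by simp_all
  have P: "P i j = (\<Sum>n\<in>UNIV. \<alpha> [i,1,n] * phi0 [j,1,n]) + (\<Sum>n\<in>UNIV. \<alpha> [i,2,n] * phi0 [j,2,n])
      + (\<Sum>n\<in>UNIV. \<alpha> [i,3,n] * phi0 [j,3,n]) + (\<Sum>n\<in>UNIV. \<alpha> [i,4,n] * phi0 [j,4,n])
      + (\<Sum>n\<in>UNIV. \<alpha> [i,5,n] * phi0 [j,5,n]) + (\<Sum>n\<in>UNIV. \<alpha> [i,6,n] * phi0 [j,6,n])
      + (\<Sum>n\<in>UNIV. \<alpha> [i,7,n] * phi0 [j,7,n])" for i j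
    unfolding P_def by (rule sum_7)
  have t: "t = 6 * (\<alpha> [1,2,3] + \<alpha> [1,4,5] + \<alpha> [7,1,6] + \<alpha> [2,4,6] - \<alpha> [7,2,5] - \<alpha> [7,3,4] - \<alpha> [3,5,6])"
    by (simp add: t_def sum_7 P phi0_table sum_negf s1 s2 z less_7)
  have "\<forall>i j k. i < j \<longrightarrow> j < k \<longrightarrow> \<alpha> [i,j,k] = act B phi0 [i,j,k]"
    unfolding forall_less3_7 act_phi0_sorted
    by (simp add: B_def t P phi0_table sum_negf s1 s2 z less_7) (simp add: field_simps)
  then have le: "\<alpha> [i,j,k] = act B phi0 [i,j,k]" if "i < j" "j < k" for i j k
    using that by blast
  have "\<alpha> [i,j,k] = act B phi0 [i,j,k]" for i j k
    by (rule alternating3_eqI[of "\<lambda>i j k. \<alpha> [i,j,k]" "\<lambda>i j k. act B phi0 [i,j,k]", OF \<alpha> act_3_swap[of phi0, OF phi0_swap] le])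
  then show ?thesis by (rule that)
qed

section \<open>Contractions in an orthonormal frame\<close>

definition con2 :: "real^7^7 \<Rightarrow> (7 \<Rightarrow> 7 \<Rightarrow> real) \<Rightarrow> (7 \<Rightarrow> 7 \<Rightarrow> real) \<Rightarrow> real" where
  "con2 H \<beta> \<gamma> = (\<Sum>i\<in>UNIV. \<Sum>j\<in>UNIV. \<Sum>a\<in>UNIV. \<Sum>b\<in>UNIV. \<beta> i j * H $ i $ a * H $ j $ b * \<gamma> a b)"

text \<open>Components of a 2-tensor in the frame of the columns of \<open>E\<close>. When the
  inverse metric is \<open>E ** transpose E\<close>, they turn \<open>con2\<close> into a plain sum
  of products.\<close>

definition sand :: "real^7^7 \<Rightarrow> (7 \<Rightarrow> 7 \<Rightarrow> real) \<Rightarrow> 7 \<Rightarrow> 7 \<Rightarrow> real" where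
  "sand E \<beta> m n = (\<Sum>i\<in>UNIV. \<Sum>j\<in>UNIV. E $ i $ m * E $ j $ n * \<beta> i j)"

lemma con2_sand: "con2 (E ** transpose E) \<beta> \<gamma> = (\<Sum>m\<in>UNIV. \<Sum>n\<in>UNIV. sand E \<beta> m n * sand E \<gamma> m n)"
proof -
  have "con2 (E ** transpose E) \<beta> \<gamma> = (\<Sum>i\<in>UNIV. \<Sum>j\<in>UNIV. \<Sum>a\<in>UNIV. \<Sum>b\<in>UNIV. \<Sum>m\<in>UNIV. \<Sum>n\<in>UNIV.
      (E $ i $ m * E $ j $ n * \<beta> i j) * (E $ a $ m * E $ b $ n * \<gamma> a b))"
    unfolding con2_def
    by (intro sum.cong refl) (simp add: matrix_matrix_mult_def transpose_def sum_product sum_distrib_left sum_distrib_right mult_ac)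
  also have "\<dots> = (\<Sum>m\<in>UNIV. \<Sum>n\<in>UNIV. \<Sum>i\<in>UNIV. \<Sum>j\<in>UNIV. \<Sum>a\<in>UNIV. \<Sum>b\<in>UNIV.
      (E $ i $ m * E $ j $ n * \<beta> i j) * (E $ a $ m * E $ b $ n * \<gamma> a b))"
  proof -
    have r6: "(\<Sum>i\<in>UNIV. \<Sum>j\<in>UNIV. \<Sum>a\<in>UNIV. \<Sum>b\<in>UNIV. \<Sum>m\<in>UNIV. \<Sum>n\<in>UNIV. F i j a b m n)
       = (\<Sum>m\<in>UNIV. \<Sum>n\<in>UNIV. \<Sum>i\<in>UNIV. \<Sum>j\<in>UNIV. \<Sum>a\<in>UNIV. \<Sum>b\<in>UNIV. F i j a b m n)"
      for F :: "7 \<Rightarrow> 7 \<Rightarrow> 7 \<Rightarrow> 7 \<Rightarrow> 7 \<Rightarrow> 7 \<Rightarrow> real"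
    proof -
      have "(\<Sum>a\<in>UNIV. \<Sum>b\<in>UNIV. \<Sum>m\<in>UNIV. \<Sum>n\<in>UNIV. F i j a b m n) = (\<Sum>m\<in>UNIV. \<Sum>n\<in>UNIV. \<Sum>a\<in>UNIV. \<Sum>b\<in>UNIV. F i j a b m n)" for i j
        by (subst sum_rotate4, subst sum_rotate4) (rule refl)
      then have "(\<Sum>i\<in>UNIV. \<Sum>j\<in>UNIV. \<Sum>a\<in>UNIV. \<Sum>b\<in>UNIV. \<Sum>m\<in>UNIV. \<Sum>n\<in>UNIV. F i j a b m n)
        = (\<Sum>i\<in>UNIV. \<Sum>j\<in>UNIV. \<Sum>m\<in>UNIV. \<Sum>n\<in>UNIV. \<Sum>a\<in>UNIV. \<Sum>b\<in>UNIV. F i j a b m n)"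
        by simp
      also have "\<dots> = (\<Sum>m\<in>UNIV. \<Sum>n\<in>UNIV. \<Sum>i\<in>UNIV. \<Sum>j\<in>UNIV. \<Sum>a\<in>UNIV. \<Sum>b\<in>UNIV. F i j a b m n)"
        by (subst sum_rotate4[of "\<lambda>i j m n. \<Sum>a\<in>UNIV. \<Sum>b\<in>UNIV. F i j a b m n"], subst sum_rotate4[of "\<lambda>n i j m. \<Sum>a\<in>UNIV. \<Sum>b\<in>UNIV. F i j a b m n"]) (rule refl)
      finally show ?thesis .
    qed
    show ?thesis by (rule r6)
  qed
  also have "\<dots> = (\<Sum>m\<in>UNIV. \<Sum>n\<in>UNIV. sand E \<beta> m n * sand E \<gamma> m n)"
    unfolding sand_def sum_distrib_right unfolding sum_distrib_left by (rule refl)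
  finally show ?thesis .
qed

lemma sand_inverse:
  assumes "L ** E = mat 1"
  shows "sand E (sand L \<beta>) m n = \<beta> m n"
proof -
  have LE: "(\<Sum>i\<in>UNIV. L $ a $ i * E $ i $ m) = of_bool (a = m)" for a m
    using assms by (simp add: vec_eq_iff matrix_matrix_mult_def mat_def of_bool_def)
  have "sand E (sand L \<beta>) m n = (\<Sum>i\<in>UNIV. \<Sum>j\<in>UNIV. \<Sum>a\<in>UNIV. \<Sum>b\<in>UNIV. (L $ a $ i * E $ i $ m) * (L $ b $ j * E $ j $ n) * \<beta> a b)"
    by (simp add: sand_def sum_distrib_left mult_ac)
  also have "\<dots> = (\<Sum>a\<in>UNIV. \<Sum>b\<in>UNIV. \<Sum>i\<in>UNIV. \<Sum>j\<in>UNIV. (L $ a $ i * E $ i $ m) * (L $ b $ j * E $ j $ n) * \<beta> a b)"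
    by (subst sum_rotate4, subst sum_rotate4) (rule refl)
  also have "\<dots> = (\<Sum>a\<in>UNIV. \<Sum>b\<in>UNIV. (\<Sum>i\<in>UNIV. L $ a $ i * E $ i $ m) * (\<Sum>j\<in>UNIV. L $ b $ j * E $ j $ n) * \<beta> a b)"
    unfolding sum_product unfolding sum_distrib_right by (rule refl)
  also have "\<dots> = \<beta> m n"
    by (simp only: LE mult.assoc sum_of_bool_mult sum_distrib_left[symmetric])
  finally show ?thesis .
qed

lemma pullback_3:
  "pullback L \<alpha> [i,j,k] = (\<Sum>a\<in>UNIV. \<Sum>b\<in>UNIV. \<Sum>c\<in>UNIV. L $ a $ i * L $ b $ j * L $ c $ k * \<alpha> [a,b,c])"
  by (simp add: pullback_def sum_length_Suc numeral_eq_Suc lessThan_Suc mult_ac)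

lemma pullback_4:
  "pullback L \<alpha> [i,j,k,l] = (\<Sum>a\<in>UNIV. \<Sum>b\<in>UNIV. \<Sum>c\<in>UNIV. \<Sum>d\<in>UNIV. L $ a $ i * L $ b $ j * L $ c $ k * L $ d $ l * \<alpha> [a,b,c,d])"
  by (simp add: pullback_def sum_length_Suc numeral_eq_Suc lessThan_Suc mult_ac)

lemma pullback_3_sand12:
  "pullback L \<alpha> [i,j,k] = sand L (\<lambda>a b. \<Sum>c\<in>UNIV. L $ c $ k * \<alpha> [a,b,c]) i j"
  by (simp add: pullback_3 sand_def sum_distrib_left mult_ac)

lemma pullback_3_sand23:
  "pullback L \<alpha> [i,j,k] = sand L (\<lambda>b c. \<Sum>a\<in>UNIV. L $ a $ i * \<alpha> [a,b,c]) j k"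
  unfolding pullback_3 sand_def sum_distrib_left
  by (subst (2) sum_rotate3) (simp add: mult_ac)

lemma pullback_4_sand34:
  "pullback L \<alpha> [i,j,k,l] = sand L (\<lambda>c d. \<Sum>a\<in>UNIV. \<Sum>b\<in>UNIV. L $ a $ i * L $ b $ j * \<alpha> [a,b,c,d]) k l"
  unfolding pullback_4 sand_def sum_distrib_left
  by (subst sum_rotate4, subst sum_rotate4) (simp add: mult_ac)

lemma phi0_phi0_23: "(\<Sum>m\<in>UNIV. \<Sum>n\<in>UNIV. phi0 [c,m,n] * phi0 [m,n,d]) = 6 * of_bool (c = d)"
  using phi0_phi0_2[of c d] by (simp add: phi0_cyc[of c])

lemma prod_lessThan_remove:
  "r < n \<Longrightarrow> (\<Prod>s<n. g s) = g r * (\<Prod>s\<in>{..<n} - {r}. g s)" for g :: "nat \<Rightarrow> real"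
  by (simp add: prod.remove)

text \<open>Slot by slot, \<open>S\<close> may be moved past \<open>L\<close> at the price of
  becoming \<open>S'\<close>; the other slots are not affected.\<close>

lemma act_pullback:
  assumes LS: "L ** S = S' ** L"
  shows "act S (pullback L \<alpha>) I = pullback L (act S' \<alpha>) I"
proof -
  define n where "n = length I"
  define p where "p r K = (\<Prod>s\<in>{..<n} - {r}. L $ (K ! s) $ (I ! s))" for r and K :: "7 list"
  have p_upd: "p r (K[r := m]) = p r K" for r K m
    unfolding p_def by (intro prod.cong refl) auto
  have key: "(\<Sum>m\<in>UNIV. S $ m $ (I ! r) * pullback L \<alpha> (I[r := m]))
      = (\<Sum>K | length K = n. (\<Prod>s<n. L $ (K ! s) $ (I ! s)) * (\<Sum>m\<in>UNIV. S' $ m $ (K ! r) * \<alpha> (K[r := m])))"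
    if r: "r < n" for r
  proof -
    have "(\<Prod>s<n. L $ (K ! s) $ (I[r := m] ! s)) = L $ (K ! r) $ m * p r K" for m and K :: "7 list"
    proof -
      have "(\<Prod>s\<in>{..<n} - {r}. L $ (K ! s) $ (I[r := m] ! s)) = p r K"
        unfolding p_def by (intro prod.cong refl) auto
      then show ?thesis
        using r by (simp add: prod_lessThan_remove n_def)
    qed
    then have "(\<Sum>m\<in>UNIV. S $ m $ (I ! r) * pullback L \<alpha> (I[r := m]))
        = (\<Sum>K | length K = n. p r K * (\<Sum>m\<in>UNIV. L $ (K ! r) $ m * S $ m $ (I ! r)) * \<alpha> K)"
      unfolding pullback_def length_list_update n_def[symmetric] sum_distrib_left sum_distrib_right
      by (subst sum.swap) (simp add: mult_ac)
    also have "\<dots> = (\<Sum>K | length K = n. p r K * (\<Sum>m\<in>UNIV. S' $ (K ! r) $ m * L $ m $ (I ! r)) * \<alpha> K)"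
      using LS by (simp add: vec_eq_iff matrix_matrix_mult_def)
    also have "\<dots> = (\<Sum>(K, m)\<in>{K. length K = n} \<times> UNIV. p r K * (S' $ (K ! r) $ m * L $ m $ (I ! r)) * \<alpha> K)"
      by (simp add: sum.cartesian_product[symmetric] sum_distrib_left sum_distrib_right)
    \<comment> \<open>Exchanging \<open>m\<close> with the \<open>r\<close>-th entry of
      \<open>K\<close> is an involution of the pairs, and the product \<open>p r\<close> over the
      other slots does not see it.\<close>
    also have "\<dots> = (\<Sum>(K, m)\<in>{K. length K = n} \<times> UNIV. p r K * (S' $ m $ (K ! r) * L $ (K ! r) $ (I ! r)) * \<alpha> (K[r := m]))"
      by (rule sum.reindex_bij_witness[where i = "\<lambda>(K, m). (K[r := m], K ! r)" and j = "\<lambda>(K, m). (K[r := m], K ! r)"])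
        (use r in \<open>auto simp: p_upd\<close>)
    also have "\<dots> = (\<Sum>K | length K = n. (\<Prod>s<n. L $ (K ! s) $ (I ! s)) * (\<Sum>m\<in>UNIV. S' $ m $ (K ! r) * \<alpha> (K[r := m])))"
      using prod_lessThan_remove[OF r] 
      by (simp add: sum.cartesian_product[symmetric] sum_distrib_left sum_distrib_right p_def mult_ac)
    finally show ?thesis .
  qed
  have "act S (pullback L \<alpha>) I = (\<Sum>r<n. \<Sum>K | length K = n. (\<Prod>s<n. L $ (K ! s) $ (I ! s)) * (\<Sum>m\<in>UNIV. S' $ m $ (K ! r) * \<alpha> (K[r := m])))"
    unfolding act_def n_def[symmetric] by (intro sum.cong refl) (simp add: key)
  also have "\<dots> = pullback L (act S' \<alpha>) I"
    unfolding pullback_def act_def n_def[symmetric]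
    by (subst sum.swap) (simp add: sum_distrib_left)
  finally show ?thesis .
qed

lemma int_prod_pullback_frame:
  assumes LE: "L ** E = mat 1" and \<psi>: "\<And>J. length J = Suc (length I) \<Longrightarrow> \<psi> J = pullback L \<psi>' J"
  shows "int_prod (E *v V) \<psi> I = pullback L (int_prod V \<psi>') I"
proof -
  have "int_prod (E *v V) \<psi> I = int_prod (E *v V) (pullback L \<psi>') I"
    by (simp add: int_prod_def \<psi>)
  also have "\<dots> = pullback L (int_prod V \<psi>') I"
    unfolding int_prod_pullback matrix_vector_mul_assoc LE by simp
  finally show ?thesis .
qed

lemma pullback_compose: "pullback L (pullback E \<alpha>) I = pullback (E ** L) \<alpha> I"
proof -
  have "pullback L (pullback E \<alpha>) I = (\<Sum>M | length M = length I. (\<Sum>K | length K = length I.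
      (\<Prod>r<length I. E $ (M ! r) $ (K ! r)) * (\<Prod>r<length I. L $ (K ! r) $ (I ! r))) * \<alpha> M)"
    unfolding pullback_def sum_distrib_left sum_distrib_right
    by (subst sum.swap, intro sum.cong refl) (simp_all add: mult_ac)
  also have "\<dots> = pullback (E ** L) \<alpha> I"
  proof -
    have "(\<Sum>K | length K = length I. (\<Prod>r<length I. E $ (M ! r) $ (K ! r)) * (\<Prod>r<length I. L $ (K ! r) $ (I ! r)))
        = (\<Prod>r<length I. (E ** L) $ (M ! r) $ (I ! r))" for M
      using sum_prod_mult[of "\<lambda>r k. E $ (M ! r) $ k" "length I" "\<lambda>r k. L $ k $ (I ! r)"]
      by (simp add: matrix_matrix_mult_def)
    then show ?thesis by (simp add: pullback_def)
  qed
  finally show ?thesis .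
qed

lemma pullback_mat_1: "pullback (mat 1) \<alpha> I = \<alpha> I"
proof -
  have "pullback (mat 1) \<alpha> I = (\<Sum>K | length K = length I. of_bool (K = I) * \<alpha> K)"
    unfolding pullback_def
    by (intro sum.cong refl arg_cong2[where f = "(*)"]) (auto simp: mat_def of_bool_def list_eq_iff_nth_eq)
  also have "\<dots> = (\<Sum>K\<in>{I}. of_bool (K = I) * \<alpha> K)"
    by (intro sum.mono_neutral_right) (auto simp: finite_length_eq)
  finally show ?thesis by simp
qed

lemma pullback_3_swap:
  assumes \<alpha>: "\<And>i j k. \<alpha> [j,i,k] = - \<alpha> [i,j,k]" "\<And>i j k. \<alpha> [i,k,j] = - \<alpha> [i,j,k]"
  shows "pullback L \<alpha> [j,i,k] = - pullback L \<alpha> [i,j,k]" "pullback L \<alpha> [i,k,j] = - pullback L \<alpha> [i,j,k]"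
  unfolding pullback_3 sum_negf[symmetric]
   apply (rule trans[OF sum.swap], intro sum.cong refl, subst \<alpha>(1), simp add: mult_ac)
  apply (rule sum.cong[OF refl], rule trans[OF sum.swap], intro sum.cong refl, subst \<alpha>(2), simp add: mult_ac)
  done

lemma act_cong: "(\<And>K. length K = length I \<Longrightarrow> \<alpha> K = \<beta> K) \<Longrightarrow> act A \<alpha> I = act A \<beta> I"
  by (simp add: act_def)

lemma sum_rotate5:
  "(\<Sum>a\<in>A. \<Sum>b\<in>B. \<Sum>c\<in>C. \<Sum>d\<in>D. \<Sum>e\<in>X. F a b c d e) = (\<Sum>e\<in>X. \<Sum>a\<in>A. \<Sum>b\<in>B. \<Sum>c\<in>C. \<Sum>d\<in>D. F a b c d e)"
  by (rule trans[OF sum.cong[OF refl sum_rotate4] sum.swap])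

lemma pullback_3_cong:
  "(\<And>a b c. \<alpha> [a,b,c] = \<beta> [a,b,c]) \<Longrightarrow> pullback L \<alpha> [i,j,k] = pullback L \<beta> [i,j,k]"
  by (simp add: pullback_3)

section \<open>Pointwise identities for an arbitrary G2-form\<close>

context
  fixes f :: tensor
  assumes f: "G2_form f"
begin

lemma G2_form_swap: "f [j,i,k] = - f [i,j,k]" "f [i,k,j] = - f [i,j,k]"
proof -
  obtain L E where LE: "L ** E = mat 1" and EL: "E ** L = mat 1" and L: "\<And>I. length I = 3 \<Longrightarrow> f I = pullback L phi0 I"
    and G: "G2_metric f = transpose L ** L" and v: "G2_vol f = - det L"
    and Gi: "G2_inv_metric f = E ** transpose E" and \<psi>: "\<And>J. length J = 4 \<Longrightarrow> G2_psi f J = pullback L psi_tensor J"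
    by (rule G2_frame[OF f]) blast
  show "f [j,i,k] = - f [i,j,k]"
    unfolding L[of "[_,_,_]", simplified] by (rule pullback_3_swap(1); rule phi0_swap)
  show "f [i,k,j] = - f [i,j,k]"
    unfolding L[of "[_,_,_]", simplified] by (rule pullback_3_swap(2); rule phi0_swap)
qed

lemma transpose_G2_metric: "transpose (G2_metric f) = G2_metric f"
proof -
  obtain L E where LE: "L ** E = mat 1" and EL: "E ** L = mat 1" and L: "\<And>I. length I = 3 \<Longrightarrow> f I = pullback L phi0 I"
    and G: "G2_metric f = transpose L ** L" and v: "G2_vol f = - det L"
    and Gi: "G2_inv_metric f = E ** transpose E" and \<psi>: "\<And>J. length J = 4 \<Longrightarrow> G2_psi f J = pullback L psi_tensor J"
    by (rule G2_frame[OF f]) blast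
  show ?thesis by (simp add: G matrix_transpose_mul)
qed

lemma G2_metric_inv: "G2_metric f ** G2_inv_metric f = mat 1" "G2_inv_metric f ** G2_metric f = mat 1"
proof -
  obtain L E where LE: "L ** E = mat 1" and EL: "E ** L = mat 1" and L: "\<And>I. length I = 3 \<Longrightarrow> f I = pullback L phi0 I"
    and G: "G2_metric f = transpose L ** L" and v: "G2_vol f = - det L"
    and Gi: "G2_inv_metric f = E ** transpose E" and \<psi>: "\<And>J. length J = 4 \<Longrightarrow> G2_psi f J = pullback L psi_tensor J"
    by (rule G2_frame[OF f]) blast
  have t: "transpose L ** transpose E = mat 1" "transpose E ** transpose L = mat 1"
    by (simp_all add: matrix_transpose_mul[symmetric] LE EL transpose_mat)
  show "G2_metric f ** G2_inv_metric f = mat 1"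
    unfolding G Gi by (metis LE t(1) matrix_mul_assoc matrix_mul_lid)
  show "G2_inv_metric f ** G2_metric f = mat 1"
    unfolding G Gi by (metis EL t(2) matrix_mul_assoc matrix_mul_lid)
qed

lemma con2_f_f:
  "con2 (G2_inv_metric f) (\<lambda>i j. f [l,i,j]) (\<lambda>a b. f [a,b,q]) = 6 * G2_metric f $ l $ q"
proof -
  obtain L E where LE: "L ** E = mat 1" and EL: "E ** L = mat 1" and L: "\<And>I. length I = 3 \<Longrightarrow> f I = pullback L phi0 I"
    and G: "G2_metric f = transpose L ** L" and v: "G2_vol f = - det L"
    and Gi: "G2_inv_metric f = E ** transpose E" and \<psi>: "\<And>J. length J = 4 \<Longrightarrow> G2_psi f J = pullback L psi_tensor J"
    by (rule G2_frame[OF f]) blast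
  have 1: "(\<lambda>i j. f [l,i,j]) = sand L (\<lambda>b c. \<Sum>a\<in>UNIV. L $ a $ l * phi0 [a,b,c])"
    by (simp add: fun_eq_iff L pullback_3_sand23)
  have 2: "(\<lambda>a b. f [a,b,q]) = sand L (\<lambda>a b. \<Sum>c\<in>UNIV. L $ c $ q * phi0 [a,b,c])"
    by (simp add: fun_eq_iff L pullback_3_sand12)
  have "con2 (G2_inv_metric f) (\<lambda>i j. f [l,i,j]) (\<lambda>a b. f [a,b,q])
     = (\<Sum>m\<in>UNIV. \<Sum>n\<in>UNIV. \<Sum>c\<in>UNIV. \<Sum>d\<in>UNIV. L $ c $ l * L $ d $ q * (phi0 [c,m,n] * phi0 [m,n,d]))"
    unfolding Gi con2_sand 1 2 sand_inverse[OF LE] by (simp add: sum_product mult_ac)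
  also have "\<dots> = (\<Sum>c\<in>UNIV. \<Sum>d\<in>UNIV. L $ c $ l * L $ d $ q * (\<Sum>m\<in>UNIV. \<Sum>n\<in>UNIV. phi0 [c,m,n] * phi0 [m,n,d]))"
    unfolding sum_distrib_left by (subst sum_rotate4, subst sum_rotate4) (rule refl)
  also have "\<dots> = 6 * G2_metric f $ l $ q"
    unfolding phi0_phi0_23 G
    by (simp add: matrix_matrix_mult_def transpose_def sum_distrib_left mult_ac of_bool_def if_distrib[of "\<lambda>x. _ * x"] cong: if_cong)
  finally show ?thesis .
qed

lemma con2_psi_f:
  "con2 (G2_inv_metric f) (\<lambda>i j. G2_psi f [n,l,i,j]) (\<lambda>a b. f [a,b,q]) = - 4 * f [n,l,q]"
proof -
  obtain L E where LE: "L ** E = mat 1" and EL: "E ** L = mat 1" and L: "\<And>I. length I = 3 \<Longrightarrow> f I = pullback L phi0 I"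
    and G: "G2_metric f = transpose L ** L" and v: "G2_vol f = - det L"
    and Gi: "G2_inv_metric f = E ** transpose E" and \<psi>: "\<And>J. length J = 4 \<Longrightarrow> G2_psi f J = pullback L psi_tensor J"
    by (rule G2_frame[OF f]) blast
  have 1: "(\<lambda>i j. G2_psi f [n,l,i,j]) = sand L (\<lambda>c d. \<Sum>a\<in>UNIV. \<Sum>b\<in>UNIV. L $ a $ n * L $ b $ l * psi0 a b c d)"
    by (simp add: fun_eq_iff \<psi> pullback_4_sand34 psi_tensor_def)
  have 2: "(\<lambda>a b. f [a,b,q]) = sand L (\<lambda>a b. \<Sum>c\<in>UNIV. L $ c $ q * phi0 [a,b,c])"
    by (simp add: fun_eq_iff L pullback_3_sand12)
  have "con2 (G2_inv_metric f) (\<lambda>i j. G2_psi f [n,l,i,j]) (\<lambda>a b. f [a,b,q])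
     = (\<Sum>m\<in>UNIV. \<Sum>m'\<in>UNIV. \<Sum>a\<in>UNIV. \<Sum>b\<in>UNIV. \<Sum>c\<in>UNIV. L $ a $ n * L $ b $ l * L $ c $ q * (psi0 a b m m' * phi0 [m,m',c]))"
    unfolding Gi con2_sand 1 2 sand_inverse[OF LE] by (simp add: sum_distrib_left sum_distrib_right mult_ac)
  also have "\<dots> = (\<Sum>a\<in>UNIV. \<Sum>b\<in>UNIV. \<Sum>c\<in>UNIV. L $ a $ n * L $ b $ l * L $ c $ q * (\<Sum>m\<in>UNIV. \<Sum>m'\<in>UNIV. psi0 a b m m' * phi0 [m,m',c]))"
    unfolding sum_distrib_left by (subst sum_rotate5, subst sum_rotate5, subst sum_rotate5) (rule refl)
  also have "\<dots> = - 4 * f [n,l,q]"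
    unfolding psi0_phi0 by (simp add: L pullback_3 sum_distrib_left sum_negf mult_ac)
  finally show ?thesis .
qed

lemma surj_act:
  assumes \<alpha>: "\<And>i j k. \<alpha> [j,i,k] = - \<alpha> [i,j,k]" "\<And>i j k. \<alpha> [i,k,j] = - \<alpha> [i,j,k]"
  obtains B where "\<And>i j k. \<alpha> [i,j,k] = act B f [i,j,k]"
proof -
  obtain L E where LE: "L ** E = mat 1" and EL: "E ** L = mat 1" and L: "\<And>I. length I = 3 \<Longrightarrow> f I = pullback L phi0 I"
    and G: "G2_metric f = transpose L ** L" and v: "G2_vol f = - det L"
    and Gi: "G2_inv_metric f = E ** transpose E" and \<psi>: "\<And>J. length J = 4 \<Longrightarrow> G2_psi f J = pullback L psi_tensor J"
    by (rule G2_frame[OF f]) blast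
  obtain B' where B': "\<And>i j k. pullback E \<alpha> [i,j,k] = act B' phi0 [i,j,k]"
    using surj_act_phi0[of "pullback E \<alpha>", OF pullback_3_swap[of \<alpha> E, OF \<alpha>]] by metis
  have LB: "L ** (E ** B' ** L) = B' ** L"
    by (simp add: matrix_mul_assoc LE)
  have "\<alpha> [i,j,k] = act (E ** B' ** L) f [i,j,k]" for i j k
  proof -
    have "act (E ** B' ** L) f [i,j,k] = act (E ** B' ** L) (pullback L phi0) [i,j,k]"
      by (rule act_cong) (simp add: L)
    also have "\<dots> = pullback L (act B' phi0) [i,j,k]"
      by (rule act_pullback[OF LB])
    also have "\<dots> = pullback L (pullback E \<alpha>) [i,j,k]"
      by (rule pullback_3_cong) (simp add: B')
    also have "\<dots> = \<alpha> [i,j,k]"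
      by (simp add: pullback_compose EL pullback_mat_1)
    finally show ?thesis ..
  qed
  then show ?thesis by (rule that)
qed

lemma act_skew:
  assumes S: "transpose (G2_metric f ** S) = - (G2_metric f ** S)"
  obtains V where "\<And>i j k. act S f [i,j,k] = int_prod V (G2_psi f) [i,j,k]"
    "\<And>q. (G2_metric f *v V) $ q = con2 (G2_inv_metric f) (\<lambda>i j. (G2_metric f ** S) $ i $ j) (\<lambda>a b. f [a,b,q]) / 2"
proof -
  obtain L E where LE: "L ** E = mat 1" and EL: "E ** L = mat 1" and L: "\<And>I. length I = 3 \<Longrightarrow> f I = pullback L phi0 I"
    and G: "G2_metric f = transpose L ** L" and v: "G2_vol f = - det L"
    and Gi: "G2_inv_metric f = E ** transpose E" and \<psi>: "\<And>J. length J = 4 \<Longrightarrow> G2_psi f J = pullback L psi_tensor J"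
    by (rule G2_frame[OF f]) blast
  define S' where "S' = L ** S ** E"
  have LS: "L ** S = S' ** L"
    by (simp add: S'_def matrix_mul_assoc[symmetric] EL)
  \<comment> \<open>In an orthonormal frame lowering an index changes nothing, so the skewness of
    \<open>G ** S\<close> becomes that of \<open>S'\<close>.\<close>
  have S'_eq: "S' = transpose E ** (G2_metric f ** S) ** E"
  proof -
    have "transpose E ** (G2_metric f ** S) ** E = (transpose (L ** E)) ** (L ** S ** E)"
      by (simp add: G matrix_transpose_mul matrix_mul_assoc)
    then show ?thesis by (simp add: LE S'_def transpose_mat)
  qed
  have "transpose S' = transpose E ** (transpose (G2_metric f ** S)) ** E"
    by (simp add: S'_eq matrix_transpose_mul matrix_mul_assoc)
  also have "\<dots> = - S'"
    unfolding S S'_eq by (simp add: vec_eq_iff matrix_matrix_mult_def sum_negf)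
  finally have t: "transpose S' = - S'" .
  have skew: "S' $ j $ i = - S' $ i $ j" for i j
    using arg_cong[OF t, of "\<lambda>M. M $ i $ j"] by (simp only: transpose_def vec_lambda_beta vector_uminus_component)
  define V' :: "real^7" where "V' = (\<chi> n. (\<Sum>a\<in>UNIV. \<Sum>b\<in>UNIV. S' $ a $ b * phi0 [a,b,n]) / 2)"
  show ?thesis
  proof (rule that)
    show "act S f [i,j,k] = int_prod (E *v V') (G2_psi f) [i,j,k]" for i j k
    proof -
      have "act S f [i,j,k] = act S (pullback L phi0) [i,j,k]"
        by (rule act_cong) (simp add: L)
      also have "\<dots> = pullback L (act S' phi0) [i,j,k]"
        by (rule act_pullback[OF LS])
      also have "\<dots> = pullback L (int_prod V' psi_tensor) [i,j,k]"
        by (rule pullback_3_cong) (simp add: act_skew_phi0[OF skew] int_prod_def psi_tensor_def V'_def)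
      also have "\<dots> = int_prod (E *v V') (G2_psi f) [i,j,k]"
        by (rule int_prod_pullback_frame[OF LE, symmetric]) (simp add: \<psi>)
      finally show ?thesis .
    qed
    show "(G2_metric f *v (E *v V')) $ q = con2 (G2_inv_metric f) (\<lambda>i j. (G2_metric f ** S) $ i $ j) (\<lambda>a b. f [a,b,q]) / 2" for q
    proof -
      have "G2_metric f *v (E *v V') = transpose L *v V'"
        by (simp add: G matrix_vector_mul_assoc matrix_mul_assoc[symmetric] LE)
      then have "(G2_metric f *v (E *v V')) $ q = (\<Sum>c\<in>UNIV. L $ c $ q * V' $ c)"
        by (simp add: matrix_vector_mult_def transpose_def)
      also have "\<dots> = (\<Sum>c\<in>UNIV. \<Sum>m\<in>UNIV. \<Sum>n\<in>UNIV. S' $ m $ n * (L $ c $ q * phi0 [m,n,c])) / 2"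
        by (simp add: V'_def sum_distrib_left sum_divide_distrib mult_ac)
      also have "\<dots> = (\<Sum>m\<in>UNIV. \<Sum>n\<in>UNIV. S' $ m $ n * (\<Sum>c\<in>UNIV. L $ c $ q * phi0 [m,n,c])) / 2"
        unfolding sum_distrib_left by (subst sum_rotate3[symmetric]) (rule refl)
      also have "\<dots> = con2 (G2_inv_metric f) (\<lambda>i j. (G2_metric f ** S) $ i $ j) (\<lambda>a b. f [a,b,q]) / 2"
      proof -
        have 2: "(\<lambda>a b. f [a,b,q]) = sand L (\<lambda>a b. \<Sum>c\<in>UNIV. L $ c $ q * phi0 [a,b,c])"
          by (simp add: fun_eq_iff L pullback_3_sand12)
        have "sand E (\<lambda>i j. (G2_metric f ** S) $ i $ j) m n = S' $ m $ n" for m n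
          unfolding S'_eq sand_def matrix_matrix_mult_def[of _ E] matrix_matrix_mult_def[of "transpose E"]
          by (subst sum.swap) (simp add: transpose_def sum_distrib_left sum_distrib_right mult_ac)
        then show ?thesis
          unfolding Gi con2_sand 2 sand_inverse[OF LE] by simp
      qed
      finally show ?thesis .
    qed
  qed
qed

end

section \<open>Functions of class $C^k$\<close>

lemma Ck_on_cong:
  assumes "open S" "\<And>x. x \<in> S \<Longrightarrow> f x = g x" "Ck_on k f S"
  shows "Ck_on k g S"
  using assms(2,3)
proof (induction k arbitrary: f g)
  case 0
  then show ?case by (auto intro: continuous_on_eq)
next
  case (Suc k)
  have d: "f differentiable (at x)" if "x \<in> S" for x
    using Suc.prems(2) that \<open>open S\<close> by (auto simp: differentiable_on_eq_differentiable_at)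
  have "(g has_derivative frechet_derivative f (at x)) (at x)" if "x \<in> S" for x
    by (rule has_derivative_transform_within_open[OF frechet_derivative_works[THEN iffD1, OF d[OF that]] \<open>open S\<close> that])
      (rule Suc.prems(1))
  then have "g differentiable_on S" "\<And>x. x \<in> S \<Longrightarrow> frechet_derivative g (at x) = frechet_derivative f (at x)"
    using \<open>open S\<close> by (auto simp: differentiable_on_eq_differentiable_at differentiable_def frechet_derivative_at[symmetric])
  then show ?case
    using Suc.prems(2) Suc.IH[of "\<lambda>x. frechet_derivative f (at x) _" "\<lambda>x. frechet_derivative g (at x) _"] by simp
qed

lemma Ck_on_subset: "Ck_on k f S \<Longrightarrow> T \<subseteq> S \<Longrightarrow> Ck_on k f T"
  by (induction k arbitrary: f) (auto intro: continuous_on_subset differentiable_on_subset)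

lemma Ck_on_Suc_imp: "Ck_on (Suc k) f S \<Longrightarrow> Ck_on k f S"
  by (induction k arbitrary: f) (auto intro: differentiable_imp_continuous_on)

lemma Ck_on_differentiable_at:
  "Ck_on (Suc k) f S \<Longrightarrow> open S \<Longrightarrow> x \<in> S \<Longrightarrow> f differentiable (at x)"
  by (auto simp: differentiable_on_eq_differentiable_at)

lemma Ck_on_const: "Ck_on k (\<lambda>x. a) S"
proof (induction k arbitrary: a)
  case (Suc k)
  then show ?case by (simp add: frechet_derivative_const)
qed simp

text \<open>The derivative of \<open>f\<close> at \<open>x\<close> in an arbitrary direction is a combination of those in the
  directions of the basis.\<close>

lemma Ck_on_SucI:
  assumes "open S" "\<And>x. x \<in> S \<Longrightarrow> (f has_derivative f' x) (at x)" "\<And>b. b \<in> Basis \<Longrightarrow> Ck_on k (\<lambda>x. f' x b) S"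
  shows "Ck_on (Suc k) f S"
proof -
  have "frechet_derivative f (at x) = f' x" if "x \<in> S" for x
    using assms(2)[OF that] by (metis frechet_derivative_at)
  then have "Ck_on k (\<lambda>x. frechet_derivative f (at x) b) S" if "b \<in> Basis" for b
    using Ck_on_cong[OF assms(1) _ assms(3)[OF that], of "\<lambda>x. frechet_derivative f (at x) b"] by simp
  moreover have "f differentiable_on S"
    using assms(1,2) by (auto simp: differentiable_on_eq_differentiable_at differentiable_def)
  ultimately show ?thesis by simp
qed

lemma Ck_on_has_derivative:
  "Ck_on (Suc k) f S \<Longrightarrow> open S \<Longrightarrow> x \<in> S \<Longrightarrow> (f has_derivative frechet_derivative f (at x)) (at x)"
  using Ck_on_differentiable_at frechet_derivative_works by blast

lemma Ck_on_frechet_derivative: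
  "Ck_on (Suc k) f S \<Longrightarrow> b \<in> Basis \<Longrightarrow> Ck_on k (\<lambda>x. frechet_derivative f (at x) b) S"
  by simp

lemma Ck_on_add:
  assumes "open S" "Ck_on k f S" "Ck_on k g S"
  shows "Ck_on k (\<lambda>x. f x + g x) S"
  using assms(2,3)
proof (induction k arbitrary: f g)
  case 0
  then show ?case by (simp add: continuous_on_add)
next
  case (Suc k)
  note d = Ck_on_has_derivative[OF Suc.prems(1) \<open>open S\<close>] Ck_on_has_derivative[OF Suc.prems(2) \<open>open S\<close>]
  show ?case
    by (rule Ck_on_SucI[OF \<open>open S\<close> has_derivative_add[OF d]]) (use Suc in auto)
qed

lemma Ck_on_mult:
  fixes f g :: "'v::euclidean_space \<Rightarrow> real"
  assumes "open S" "Ck_on k f S" "Ck_on k g S"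
  shows "Ck_on k (\<lambda>x. f x * g x) S"
  using assms(2,3)
proof (induction k arbitrary: f g)
  case 0
  then show ?case by (simp add: continuous_on_mult)
next
  case (Suc k)
  note d = Ck_on_has_derivative[OF Suc.prems(1) \<open>open S\<close>] Ck_on_has_derivative[OF Suc.prems(2) \<open>open S\<close>]
  show ?case
    by (rule Ck_on_SucI[OF \<open>open S\<close> has_derivative_mult[OF d]])
      (auto intro!: Ck_on_add[OF \<open>open S\<close>] Suc.IH Ck_on_Suc_imp[OF Suc.prems(1)] Ck_on_Suc_imp[OF Suc.prems(2)]
        Ck_on_frechet_derivative[OF Suc.prems(1)] Ck_on_frechet_derivative[OF Suc.prems(2)])
qed

lemma Ck_on_inverse:
  fixes f :: "'v::euclidean_space \<Rightarrow> real"
  assumes "open S" "\<And>x. x \<in> S \<Longrightarrow> f x \<noteq> 0" "Ck_on k f S"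
  shows "Ck_on k (\<lambda>x. inverse (f x)) S"
  using assms(2,3)
proof (induction k arbitrary: f)
  case 0
  then show ?case by (simp add: continuous_on_inverse)
next
  case (Suc k)
  note d = Ck_on_has_derivative[OF Suc.prems(2) \<open>open S\<close>]
  \<comment> \<open>The derivative is a product of the inverse itself, of class C^k by induction,
    and the derivative of \<open>f\<close>; hence the rules for products and constants
    suffice.\<close>
  have d': "((\<lambda>x. inverse (f x)) has_derivative (\<lambda>h. - 1 * (inverse (f x) * (frechet_derivative f (at x) h * inverse (f x))))) (at x)" if "x \<in> S" for x
    using Deriv.has_derivative_inverse[OF Suc.prems(1)[OF that] d[OF that]] by (simp add: mult.assoc)
  have i: "Ck_on k (\<lambda>x. inverse (f x)) S"
    by (rule Suc.IH[OF Suc.prems(1) Ck_on_Suc_imp[OF Suc.prems(2)]])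
  show ?case
    by (intro Ck_on_SucI[OF \<open>open S\<close> d'] Ck_on_mult[OF \<open>open S\<close>] Ck_on_const i) (use Suc.prems in auto)
qed

text \<open>The derivative of the root is rational in the root itself, so the induction on
  \<open>k\<close> closes. An odd root is needed because the volume coefficient may be
  negative.\<close>

lemma Ck_on_root:
  fixes f :: "'v::euclidean_space \<Rightarrow> real"
  assumes "open S" "\<And>x. x \<in> S \<Longrightarrow> f x \<noteq> 0" "Ck_on k f S" "odd n"
  shows "Ck_on k (\<lambda>x. root n (f x)) S"
  using assms(3)
proof (induction k)
  case 0
  then show ?case by (simp add: continuous_on_real_root)
next
  case (Suc k)
  note d = Ck_on_has_derivative[OF Suc.prems \<open>open S\<close>]
  have "n > 0" using \<open>odd n\<close> by (cases n) auto
  have d': "((\<lambda>x. root n (f x)) has_derivative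
      (\<lambda>h. frechet_derivative f (at x) h * (inverse (real n) * (\<Prod>i<n - Suc 0. inverse (root n (f x)))))) (at x)" if "x \<in> S" for x
  proof -
    have "DERIV (root n) (f x) :> inverse (real n * root n (f x) ^ (n - Suc 0))"
      by (rule DERIV_odd_real_root) (use assms that in auto)
    from has_derivative_compose[OF d[OF that] this[unfolded has_field_derivative_def]]
    show ?thesis
      by (simp add: prod_constant power_inverse mult.commute)
  qed
  have i: "Ck_on k (\<lambda>x. inverse (root n (f x))) S"
    using Suc.IH[OF Ck_on_Suc_imp[OF Suc.prems]] \<open>n > 0\<close> assms(2)
    by (intro Ck_on_inverse[OF \<open>open S\<close>]) auto
  have "Ck_on k (\<lambda>x. \<Prod>i<m. inverse (root n (f x))) S" for m :: nat
    by (induction m) (use i in \<open>auto intro: Ck_on_const Ck_on_mult[OF \<open>open S\<close>]\<close>)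
  then show ?case
    by (intro Ck_on_SucI[OF \<open>open S\<close> d'] Ck_on_mult[OF \<open>open S\<close>] Ck_on_const) (use Suc.prems in auto)
qed

section \<open>Symmetry of mixed second derivatives\<close>

lemma Ck_on_has_real_derivative_line:
  fixes u :: "'v::euclidean_space \<Rightarrow> real"
  assumes "Ck_on (Suc k) u W" "open W" "z + x *\<^sub>R a \<in> W"
  shows "((\<lambda>x. u (z + x *\<^sub>R a)) has_real_derivative frechet_derivative u (at (z + x *\<^sub>R a)) a) (at x)"
proof -
  have "(u has_derivative frechet_derivative u (at (z + x *\<^sub>R a))) (at (z + x *\<^sub>R a))"
    by (rule Ck_on_has_derivative[OF assms])
  moreover have "((\<lambda>x. z + x *\<^sub>R a) has_derivative (\<lambda>h. h *\<^sub>R a)) (at x)"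
    by (auto intro!: derivative_eq_intros)
  ultimately have "((\<lambda>x. u (z + x *\<^sub>R a)) has_derivative (\<lambda>h. frechet_derivative u (at (z + x *\<^sub>R a)) (h *\<^sub>R a))) (at x)"
    using has_derivative_compose by blast
  moreover have "frechet_derivative u (at (z + x *\<^sub>R a)) (h *\<^sub>R a) = frechet_derivative u (at (z + x *\<^sub>R a)) a * h" for h
    using linear_frechet_derivative[OF Ck_on_differentiable_at[OF assms]] by (simp add: linear_scale)
  ultimately show ?thesis
    by (simp add: has_field_derivative_def)
qed

text \<open>The second difference of \<open>u\<close> in the directions \<open>a\<close>, \<open>b\<close>, evaluated by applying the mean value
  theorem first along \<open>a\<close> and then along \<open>b\<close>.\<close>

lemma second_difference_mvt:
  fixes u :: "'v::euclidean_space \<Rightarrow> real"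
  assumes C: "Ck_on 2 u W" and W: "open W" and a: "a \<in> Basis" and h: "h > 0"
    and box: "\<And>x y. 0 \<le> x \<Longrightarrow> x \<le> h \<Longrightarrow> 0 \<le> y \<Longrightarrow> y \<le> h \<Longrightarrow> z + x *\<^sub>R a + y *\<^sub>R b \<in> W"
  obtains x y where "0 \<le> x" "x \<le> h" "0 \<le> y" "y \<le> h"
    "u (z + h *\<^sub>R a + h *\<^sub>R b) - u (z + h *\<^sub>R a) - u (z + h *\<^sub>R b) + u z =
      h * h * frechet_derivative (\<lambda>w. frechet_derivative u (at w) a) (at (z + x *\<^sub>R a + y *\<^sub>R b)) b"
proof -
  define v where "v w = frechet_derivative u (at w) a" for w
  have C2: "Ck_on (Suc (Suc 0)) u W" and Cv: "Ck_on (Suc 0) v W"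
    using C a by (simp_all add: numeral_2_eq_2 v_def[abs_def])
  define f where "f x = u (z + x *\<^sub>R a + h *\<^sub>R b) - u (z + x *\<^sub>R a)" for x
  have df: "(f has_real_derivative v (z + x *\<^sub>R a + h *\<^sub>R b) - v (z + x *\<^sub>R a)) (at x)" if "0 \<le> x" "x \<le> h" for x
  proof -
    have "(z + h *\<^sub>R b) + x *\<^sub>R a \<in> W" "z + x *\<^sub>R a \<in> W"
      using box[of x h] box[of x 0] that h by (simp_all add: algebra_simps)
    from DERIV_diff[OF this[THEN Ck_on_has_real_derivative_line[OF C2 W]]]
    show ?thesis by (simp add: f_def[abs_def] v_def algebra_simps)
  qed
  obtain x where x: "0 < x" "x < h" "f h - f 0 = (h - 0) * (v (z + x *\<^sub>R a + h *\<^sub>R b) - v (z + x *\<^sub>R a))"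
    using MVT2[OF h df] by auto
  have dv: "((\<lambda>y. v (z + x *\<^sub>R a + y *\<^sub>R b)) has_real_derivative frechet_derivative v (at (z + x *\<^sub>R a + y *\<^sub>R b)) b) (at y)"
    if "0 \<le> y" "y \<le> h" for y
    using Ck_on_has_real_derivative_line[OF Cv W box[of x y]] that x by simp
  obtain y where y: "0 < y" "y < h"
    "v (z + x *\<^sub>R a + h *\<^sub>R b) - v (z + x *\<^sub>R a + 0 *\<^sub>R b) = (h - 0) * frechet_derivative v (at (z + x *\<^sub>R a + y *\<^sub>R b)) b"
    using MVT2[OF h dv] by auto
  show ?thesis
  proof (rule that[of x y])
    have "u (z + h *\<^sub>R a + h *\<^sub>R b) - u (z + h *\<^sub>R a) - u (z + h *\<^sub>R b) + u z = f h - f 0"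
      by (simp add: f_def)
    then show "u (z + h *\<^sub>R a + h *\<^sub>R b) - u (z + h *\<^sub>R a) - u (z + h *\<^sub>R b) + u z =
      h * h * frechet_derivative (\<lambda>w. frechet_derivative u (at w) a) (at (z + x *\<^sub>R a + y *\<^sub>R b)) b"
      using x(3) y(3) by (simp add: v_def[abs_def])
  qed (use x y in auto)
qed

text \<open>The same second difference, divided by \<open>h^2\<close>, is a value of either mixed
  derivative at some point of a small square. If the two differed at \<open>z\<close>, continuity
  would keep their values on the square apart.\<close>

lemma Ck_on_2_symmetric:
  fixes u :: "'v::euclidean_space \<Rightarrow> real"
  assumes C: "Ck_on 2 u W" and W: "open W" "z \<in> W" and a: "a \<in> Basis" and b: "b \<in> Basis"
  shows "frechet_derivative (\<lambda>w. frechet_derivative u (at w) a) (at z) b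
       = frechet_derivative (\<lambda>w. frechet_derivative u (at w) b) (at z) a"
proof (rule ccontr)
  define P where "P w = frechet_derivative (\<lambda>w. frechet_derivative u (at w) a) (at w) b" for w
  define Q where "Q w = frechet_derivative (\<lambda>w. frechet_derivative u (at w) b) (at w) a" for w
  assume "\<not> ?thesis"
  then have ne: "P z - Q z \<noteq> 0" by (simp add: P_def Q_def)
  \<comment> \<open>Half the gap, so that values within \<open>e\<close> of \<open>P z\<close> and
    of \<open>Q z\<close> cannot coincide.\<close>
  define e where "e = \<bar>P z - Q z\<bar> / 2"
  have "e > 0" using ne by (simp add: e_def)
  have "continuous_on W P" "continuous_on W Q"
    using C a b by (simp_all add: numeral_2_eq_2 P_def[abs_def] Q_def[abs_def])
  then have "isCont P z" "isCont Q z"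
    using W continuous_on_eq_continuous_at by blast+
  then have "\<forall>\<^sub>F w in nhds z. dist (P w) (P z) < e" "\<forall>\<^sub>F w in nhds z. dist (Q w) (Q z) < e"
    using \<open>e > 0\<close> by (simp_all add: continuous_at tendsto_at_iff_tendsto_nhds tendstoD)
  moreover have "\<forall>\<^sub>F w in nhds z. w \<in> W"
    using W by (rule eventually_nhds_in_open)
  ultimately have "\<forall>\<^sub>F w in nhds z. dist (P w) (P z) < e \<and> dist (Q w) (Q z) < e \<and> w \<in> W"
    by eventually_elim auto
  then obtain d where d: "d > 0" "\<And>w. dist w z < d \<Longrightarrow> dist (P w) (P z) < e \<and> dist (Q w) (Q z) < e \<and> w \<in> W"
    by (auto simp: eventually_nhds_metric)
  \<comment> \<open>The square has side \<open>h\<close> along unit vectors, so its points are at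
    distance at most \<open>2 h < d\<close> from \<open>z\<close>.\<close>
  define h where "h = d / 4"
  have h: "h > 0" using d by (simp add: h_def)
  have near: "dist (z + x *\<^sub>R a' + y *\<^sub>R b') z < d"
    if "0 \<le> x" "x \<le> h" "0 \<le> y" "y \<le> h" "a' \<in> Basis" "b' \<in> Basis" for x y and a' b' :: 'v
  proof -
    have "dist (z + x *\<^sub>R a' + y *\<^sub>R b') z = norm (x *\<^sub>R a' + y *\<^sub>R b')"
      by (simp add: dist_norm algebra_simps)
    also have "\<dots> \<le> norm (x *\<^sub>R a') + norm (y *\<^sub>R b')"
      by (rule norm_triangle_ineq)
    also have "\<dots> < d"
      using that d by (simp add: h_def)
    finally show ?thesis .
  qed
  obtain x y where xy: "0 \<le> x" "x \<le> h" "0 \<le> y" "y \<le> h"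
    "u (z + h *\<^sub>R a + h *\<^sub>R b) - u (z + h *\<^sub>R a) - u (z + h *\<^sub>R b) + u z = h * h * P (z + x *\<^sub>R a + y *\<^sub>R b)"
    unfolding P_def by (rule second_difference_mvt[OF C W(1) a h, of z b]) (use near d a b in auto)
  obtain x' y' where xy': "0 \<le> x'" "x' \<le> h" "0 \<le> y'" "y' \<le> h"
    "u (z + h *\<^sub>R b + h *\<^sub>R a) - u (z + h *\<^sub>R b) - u (z + h *\<^sub>R a) + u z = h * h * Q (z + x' *\<^sub>R b + y' *\<^sub>R a)"
    unfolding Q_def by (rule second_difference_mvt[OF C W(1) b h, of z a]) (use near d a b in auto)
  have "h * h * P (z + x *\<^sub>R a + y *\<^sub>R b) = h * h * Q (z + x' *\<^sub>R b + y' *\<^sub>R a)"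
    using xy(5) xy'(5) by (simp add: algebra_simps)
  then have "P (z + x *\<^sub>R a + y *\<^sub>R b) = Q (z + x' *\<^sub>R b + y' *\<^sub>R a)"
    using h by simp
  moreover have "\<bar>P (z + x *\<^sub>R a + y *\<^sub>R b) - P z\<bar> < e" "\<bar>Q (z + x' *\<^sub>R b + y' *\<^sub>R a) - Q z\<bar> < e"
    using d(2)[OF near[OF xy(1-4) a b]] d(2)[OF near[OF xy'(1-4) b a]] by (simp_all add: dist_real_def)
  moreover have "\<bar>P z - Q z\<bar> \<le> \<bar>x - P z\<bar> + \<bar>x - Q z\<bar>" for x
    by linarith
  ultimately show False
    unfolding e_def by (smt (verit) field_sum_of_halves)
qed


text \<open>At an end point of \<open>J\<close> the derivative is one-sided; it is still unique
  because a nondegenerate interval has no isolated points.\<close>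

lemma has_real_derivative_interval_unique:
  assumes "(g has_real_derivative d) (at t within J)" "(g has_real_derivative d') (at t within J)"
    "is_interval J" "interior J \<noteq> {}" "t \<in> J"
  shows "d = (d' :: real)"
proof -
  have "t islimpt J"
  proof -
    have "connected J" using assms(3) by (simp add: is_interval_connected)
    moreover have "\<nexists>a. J = {a}" using assms(4) by force
    ultimately show ?thesis using assms(5) connected_imp_perfect by blast
  qed
  then show ?thesis
    using assms(1,2) trivial_limit_within by (metis has_field_derivative_unique)
qed

section \<open>Exchange of time and space derivatives\<close>

context
  fixes J :: "real set" and W :: "(real \<times> (real^7)) set" and U :: "(real^7) set"
    and u :: "real \<times> (real^7) \<Rightarrow> real" and g :: "real \<Rightarrow> real^7 \<Rightarrow> real" and t :: real and y :: "real^7"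
  assumes J: "is_interval J" "interior J \<noteq> {}" and tJ: "t \<in> J" and U: "open U" "y \<in> U"
    and W: "open W" "(t, y) \<in> W" and C: "Ck_on 2 u W"
    and eq: "\<And>s z. s \<in> J \<Longrightarrow> z \<in> U \<Longrightarrow> (s, z) \<in> W \<Longrightarrow> g s z = u (s, z)"
begin

lemma spatial_derivative:
  assumes "s \<in> J" "(s, y) \<in> W"
  shows "(g s has_derivative (\<lambda>v. frechet_derivative u (at (s, y)) (0, v))) (at y)"
proof -
  have "(u has_derivative frechet_derivative u (at (s, y))) (at (s, y))"
    using C W(1) assms(2) by (intro Ck_on_has_derivative[of 1]) (simp_all add: numeral_2_eq_2)
  moreover have "((\<lambda>z. (s, z)) has_derivative (\<lambda>v. (0, v))) (at y)"
    by (intro derivative_intros has_derivative_Pair)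
  ultimately have d: "((\<lambda>z. u (s, z)) has_derivative (\<lambda>v. frechet_derivative u (at (s, y)) (0, v))) (at y)"
    using has_derivative_compose by blast
  have "open (U \<inter> {z. (s, z) \<in> W})"
    using U(1) W(1) by (intro open_Int open_vimage[of W "\<lambda>z. (s, z)", unfolded vimage_def] continuous_intros)
  then show ?thesis
    by (rule has_derivative_transform_within_open[OF d]) (use U assms eq in auto)
qed

lemma eventually_slice: "\<forall>\<^sub>F s in at t within J. s \<in> J \<and> (s, y) \<in> W"
proof -
  have "open {s. (s, y) \<in> W}"
    using W(1) by (intro open_vimage[of W "\<lambda>s. (s, y)", unfolded vimage_def] continuous_intros)
  then show ?thesis
    using W(2) by (auto simp: eventually_at_filter eventually_nhds)
qed

text \<open>The mixed derivatives of the extension \<open>u\<close> on the open set \<open>W\<close>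
  are symmetric, and restricting the time to \<open>J\<close> gives the one-sided statement for
  \<open>g\<close>.\<close>

lemma time_spatial_derivative:
  assumes g': "\<And>z. z \<in> U \<Longrightarrow> ((\<lambda>s. g s z) has_real_derivative g' z) (at t within J)"
  shows "g' differentiable (at y)"
    "((\<lambda>s. frechet_derivative (g s) (at y) (axis k 1)) has_real_derivative frechet_derivative g' (at y) (axis k 1)) (at t within J)"
proof -
  let ?a = "(1, 0) :: real \<times> (real^7)" and ?b = "(0, axis k 1) :: real \<times> (real^7)"
  have basis: "?a \<in> Basis" "?b \<in> Basis"
    by (auto simp: Basis_prod_def)
  define ut where "ut w = frechet_derivative u (at w) ?a" for w
  have Cu: "Ck_on (Suc 1) u W" and Ct: "Ck_on (Suc 0) ut W" and Cb: "Ck_on (Suc 0) (\<lambda>w. frechet_derivative u (at w) ?b) W"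
    using C basis by (simp_all add: numeral_2_eq_2 ut_def[abs_def])
  have o: "open (U \<inter> {z. (t, z) \<in> W})"
    using U(1) W(1) by (intro open_Int open_vimage[of W "\<lambda>z. (t, z)", unfolded vimage_def] continuous_intros)
  \<comment> \<open>Needed for all \<open>z\<close> near \<open>y\<close>, because \<open>g'\<close>
    is then differentiated in space. Uniqueness of derivatives on \<open>J\<close> makes it
    independent of how \<open>u\<close> continues beyond \<open>J\<close>.\<close>
  have e: "ut (t, z) = g' z" if "z \<in> U \<inter> {z. (t, z) \<in> W}" for z
  proof -
    have "((\<lambda>s. u ((0, z) + s *\<^sub>R ?a)) has_real_derivative ut ((0, z) + t *\<^sub>R ?a)) (at t)"
      unfolding ut_def using that by (intro Ck_on_has_real_derivative_line[OF Cu W(1)]) simp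
    then have "((\<lambda>s. u (s, z)) has_real_derivative ut (t, z)) (at t within J)"
      by (simp add: has_field_derivative_at_within)
    moreover have "\<forall>\<^sub>F s in at t within J. u (s, z) = g s z"
    proof -
      have "open {s. (s, z) \<in> W}"
        using W(1) by (intro open_vimage[of W "\<lambda>s. (s, z)", unfolded vimage_def] continuous_intros)
      then show ?thesis
        using that eq by (auto simp: eventually_at_filter eventually_nhds)
    qed
    moreover have "u (t, z) = g t z"
      using that tJ eq by auto
    ultimately have "((\<lambda>s. g s z) has_real_derivative ut (t, z)) (at t within J)"
      by (simp add: has_field_derivative_cong_eventually)
    then show ?thesis
      using has_real_derivative_interval_unique g' that J tJ by blast
  qed
  have d: "((\<lambda>z. ut (t, z)) has_derivative (\<lambda>v. frechet_derivative ut (at (t, y)) (0, v))) (at y)"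
  proof -
    have "(ut has_derivative frechet_derivative ut (at (t, y))) (at (t, y))"
      by (rule Ck_on_has_derivative[OF Ct W])
    moreover have "((\<lambda>z. (t, z)) has_derivative (\<lambda>v. (0, v))) (at y)"
      by (intro derivative_intros has_derivative_Pair)
    ultimately show ?thesis
      using has_derivative_compose by blast
  qed
  have d': "(g' has_derivative (\<lambda>v. frechet_derivative ut (at (t, y)) (0, v))) (at y)"
    by (rule has_derivative_transform_within_open[OF d o _ e]) (use U W in auto)
  then show "g' differentiable (at y)"
    by (auto simp: differentiable_def)
  have "((\<lambda>s. frechet_derivative u (at ((0, y) + s *\<^sub>R ?a)) ?b) has_real_derivative
      frechet_derivative (\<lambda>w. frechet_derivative u (at w) ?b) (at ((0, y) + t *\<^sub>R ?a)) ?a) (at t)"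
    using W by (intro Ck_on_has_real_derivative_line[OF Cb W(1)]) simp
  then have "((\<lambda>s. frechet_derivative u (at (s, y)) ?b) has_real_derivative
      frechet_derivative (\<lambda>w. frechet_derivative u (at w) ?b) (at (t, y)) ?a) (at t within J)"
    by (simp add: has_field_derivative_at_within)
  also have "frechet_derivative (\<lambda>w. frechet_derivative u (at w) ?b) (at (t, y)) ?a = frechet_derivative ut (at (t, y)) ?b"
    unfolding ut_def[abs_def] by (rule Ck_on_2_symmetric[OF C W basis(2,1)])
  also have "\<dots> = frechet_derivative g' (at y) (axis k 1)"
    using frechet_derivative_at[OF d'] by metis
  finally have "((\<lambda>s. frechet_derivative u (at (s, y)) ?b) has_real_derivative frechet_derivative g' (at y) (axis k 1)) (at t within J)" .
  moreover have "frechet_derivative u (at (s, y)) ?b = frechet_derivative (g s) (at y) (axis k 1)" if "s \<in> J" "(s, y) \<in> W" for s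
    using frechet_derivative_at[OF spatial_derivative[OF that]] by metis
  then have "\<forall>\<^sub>F s in at t within J. frechet_derivative u (at (s, y)) ?b = frechet_derivative (g s) (at y) (axis k 1)"
    "frechet_derivative u (at (t, y)) ?b = frechet_derivative (g t) (at y) (axis k 1)"
    using eventually_mono[OF eventually_slice] tJ W(2) by auto
  ultimately show "((\<lambda>s. frechet_derivative (g s) (at y) (axis k 1)) has_real_derivative frechet_derivative g' (at y) (axis k 1)) (at t within J)"
    by (simp add: has_field_derivative_cong_eventually)
qed

end

section \<open>Algebraic functions of the components of a 3-form\<close>

text \<open>The ninth root is the only one needed: the bilinear form \<open>v g\<close> defined by \<open>\<phi>\<close> has determinant \<open>v\<^sup>9\<close>.\<close>

inductive alg :: "tensor \<Rightarrow> (tensor \<Rightarrow> real) \<Rightarrow> bool" for f0 where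
  alg_component: "length I = 3 \<Longrightarrow> alg f0 (\<lambda>f. f I)"
| alg_const: "alg f0 (\<lambda>f. a)"
| alg_add: "alg f0 \<Psi> \<Longrightarrow> alg f0 \<Phi> \<Longrightarrow> alg f0 (\<lambda>f. \<Psi> f + \<Phi> f)"
| alg_mult: "alg f0 \<Psi> \<Longrightarrow> alg f0 \<Phi> \<Longrightarrow> alg f0 (\<lambda>f. \<Psi> f * \<Phi> f)"
| alg_inverse: "alg f0 \<Psi> \<Longrightarrow> \<Psi> f0 \<noteq> 0 \<Longrightarrow> alg f0 (\<lambda>f. inverse (\<Psi> f))"
| alg_root: "alg f0 \<Psi> \<Longrightarrow> \<Psi> f0 \<noteq> 0 \<Longrightarrow> alg f0 (\<lambda>f. root 9 (\<Psi> f))"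

lemma alg_sum: "(\<And>i. i \<in> A \<Longrightarrow> alg f0 (\<Psi> i)) \<Longrightarrow> alg f0 (\<lambda>f. \<Sum>i\<in>A. \<Psi> i f)"
  by (induction A rule: infinite_finite_induct) (auto intro: alg_const alg_add)

lemma alg_prod: "(\<And>i. i \<in> A \<Longrightarrow> alg f0 (\<Psi> i)) \<Longrightarrow> alg f0 (\<lambda>f. \<Prod>i\<in>A. \<Psi> i f)"
  by (induction A rule: infinite_finite_induct) (auto intro: alg_const alg_mult)

lemma alg_minus: "alg f0 \<Psi> \<Longrightarrow> alg f0 (\<lambda>f. - \<Psi> f)"
  using alg_mult[OF alg_const[of f0 "- 1"]] by simp

lemma alg_divide: "alg f0 \<Psi> \<Longrightarrow> alg f0 \<Phi> \<Longrightarrow> \<Phi> f0 \<noteq> 0 \<Longrightarrow> alg f0 (\<lambda>f. \<Psi> f / \<Phi> f)"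
  using alg_mult[OF _ alg_inverse] by (simp add: divide_inverse)

lemma alg_det:
  fixes M :: "tensor \<Rightarrow> real^'n^'n"
  shows "(\<And>i j. alg f0 (\<lambda>f. M f $ i $ j)) \<Longrightarrow> alg f0 (\<lambda>f. det (M f))"
  unfolding det_def by (intro alg_sum alg_mult alg_const alg_prod)

definition curve_jet :: "tensor \<Rightarrow> tensor \<Rightarrow> (real \<Rightarrow> tensor) \<Rightarrow> real \<Rightarrow> real set \<Rightarrow> bool" where
  "curve_jet f0 d c \<sigma> S \<longleftrightarrow>
     (\<forall>I. length I = 3 \<longrightarrow> c \<sigma> I = f0 I \<and> ((\<lambda>s. c s I) has_real_derivative d I) (at \<sigma> within S))"

text \<open>The derivative of an algebraic function along a curve depends only on the first jet of the curve.\<close>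

lemma alg_jet:
  assumes "alg f0 \<Psi>"
  shows "\<exists>D. \<forall>c \<sigma> S. curve_jet f0 d c \<sigma> S \<longrightarrow> ((\<lambda>s. \<Psi> (c s)) has_real_derivative D) (at \<sigma> within S)"
proof -
  have "\<exists>D. \<forall>c \<sigma> S. curve_jet f0 d c \<sigma> S \<longrightarrow>
      \<Psi> (c \<sigma>) = \<Psi> f0 \<and> ((\<lambda>s. \<Psi> (c s)) has_real_derivative D) (at \<sigma> within S)"
    using assms
  proof induction
    case (alg_component I)
    then show ?case unfolding curve_jet_def by blast
  next
    case (alg_const a)
    then show ?case by (intro exI[of _ 0]) simp
  next
    case (alg_add \<Psi> \<Phi>)
    then obtain D E where
      D: "\<And>c \<sigma> S. curve_jet f0 d c \<sigma> S \<Longrightarrow> \<Psi> (c \<sigma>) = \<Psi> f0 \<and> ((\<lambda>s. \<Psi> (c s)) has_real_derivative D) (at \<sigma> within S)" and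
      E: "\<And>c \<sigma> S. curve_jet f0 d c \<sigma> S \<Longrightarrow> \<Phi> (c \<sigma>) = \<Phi> f0 \<and> ((\<lambda>s. \<Phi> (c s)) has_real_derivative E) (at \<sigma> within S)"
      by metis
    show ?case
      by (intro exI[of _ "D + E"] allI impI conjI) (use D E in \<open>auto intro!: DERIV_add\<close>)
  next
    case (alg_mult \<Psi> \<Phi>)
    then obtain D E where
      D: "\<And>c \<sigma> S. curve_jet f0 d c \<sigma> S \<Longrightarrow> \<Psi> (c \<sigma>) = \<Psi> f0 \<and> ((\<lambda>s. \<Psi> (c s)) has_real_derivative D) (at \<sigma> within S)" and
      E: "\<And>c \<sigma> S. curve_jet f0 d c \<sigma> S \<Longrightarrow> \<Phi> (c \<sigma>) = \<Phi> f0 \<and> ((\<lambda>s. \<Phi> (c s)) has_real_derivative E) (at \<sigma> within S)"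
      by metis
    have "((\<lambda>s. \<Psi> (c s) * \<Phi> (c s)) has_real_derivative D * \<Phi> f0 + E * \<Psi> f0) (at \<sigma> within S)" if "curve_jet f0 d c \<sigma> S" for c \<sigma> S
      using DERIV_mult[OF D[OF that, THEN conjunct2] E[OF that, THEN conjunct2]] D[OF that] E[OF that] by simp
    with D E show ?case by auto
  next
    case (alg_inverse \<Psi>)
    then obtain D where
      D: "\<And>c \<sigma> S. curve_jet f0 d c \<sigma> S \<Longrightarrow> \<Psi> (c \<sigma>) = \<Psi> f0 \<and> ((\<lambda>s. \<Psi> (c s)) has_real_derivative D) (at \<sigma> within S)"
      by metis
    have "((\<lambda>s. inverse (\<Psi> (c s))) has_real_derivative - (inverse (\<Psi> f0) * D * inverse (\<Psi> f0))) (at \<sigma> within S)" if "curve_jet f0 d c \<sigma> S" for c \<sigma> S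
      using DERIV_inverse'[OF D[OF that, THEN conjunct2]] D[OF that] alg_inverse(2) by simp
    with D show ?case by metis
  next
    case (alg_root \<Psi>)
    then obtain D where
      D: "\<And>c \<sigma> S. curve_jet f0 d c \<sigma> S \<Longrightarrow> \<Psi> (c \<sigma>) = \<Psi> f0 \<and> ((\<lambda>s. \<Psi> (c s)) has_real_derivative D) (at \<sigma> within S)"
      by metis
    have r: "DERIV (root 9) (\<Psi> f0) :> inverse (real 9 * root 9 (\<Psi> f0) ^ (9 - Suc 0))"
      by (rule DERIV_odd_real_root) (use alg_root(2) in auto)
    have "((\<lambda>s. root 9 (\<Psi> (c s))) has_real_derivative inverse (real 9 * root 9 (\<Psi> f0) ^ (9 - Suc 0)) * D) (at \<sigma> within S)"
      if "curve_jet f0 d c \<sigma> S" for c \<sigma> S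
      by (rule DERIV_chain2[OF _ D[OF that, THEN conjunct2]]) (use D[OF that] r in simp)
    with D show ?case by metis
  qed
  then show ?thesis by blast
qed

text \<open>\<open>alg\<close> demands non-vanishing only at the base point, so every inverse or
  root may shrink the neighbourhood to where its argument stays nonzero.\<close>

lemma alg_Ck:
  fixes F :: "'v::euclidean_space \<Rightarrow> tensor"
  assumes "alg (F z) \<Psi>" and W: "open W" "z \<in> W" and F: "\<And>I k. length I = 3 \<Longrightarrow> Ck_on k (\<lambda>w. F w I) W"
  shows "\<exists>W'. open W' \<and> z \<in> W' \<and> W' \<subseteq> W \<and> (\<forall>k. Ck_on k (\<lambda>w. \<Psi> (F w)) W')"
  using assms(1)
proof induction
  case (alg_component I)
  then show ?case using W F by blast
next
  case (alg_const a)
  then show ?case using W Ck_on_const by blast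
next
  case (alg_add \<Psi> \<Phi>)
  then obtain V V' where "open V" "z \<in> V" "V \<subseteq> W" "\<forall>k. Ck_on k (\<lambda>w. \<Psi> (F w)) V"
    "open V'" "z \<in> V'" "V' \<subseteq> W" "\<forall>k. Ck_on k (\<lambda>w. \<Phi> (F w)) V'" by blast
  then show ?case
    by (intro exI[of _ "V \<inter> V'"]) (auto intro!: Ck_on_add intro: Ck_on_subset)
next
  case (alg_mult \<Psi> \<Phi>)
  then obtain V V' where "open V" "z \<in> V" "V \<subseteq> W" "\<forall>k. Ck_on k (\<lambda>w. \<Psi> (F w)) V"
    "open V'" "z \<in> V'" "V' \<subseteq> W" "\<forall>k. Ck_on k (\<lambda>w. \<Phi> (F w)) V'" by blast
  then show ?case
    by (intro exI[of _ "V \<inter> V'"]) (auto intro!: Ck_on_mult intro: Ck_on_subset)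
next
  case (alg_inverse \<Psi>)
  then obtain V where V: "open V" "z \<in> V" "V \<subseteq> W" "\<forall>k. Ck_on k (\<lambda>w. \<Psi> (F w)) V" by blast
  then have "continuous_on V (\<lambda>w. \<Psi> (F w))" by (metis Ck_on.simps(1))
  then have "open (V \<inter> (\<lambda>w. \<Psi> (F w)) -` (- {0}))"
    using V(1) by (intro continuous_open_preimage) auto
  with V alg_inverse(2) show ?case
    by (intro exI[of _ "V \<inter> (\<lambda>w. \<Psi> (F w)) -` (- {0})"]) (auto intro!: Ck_on_inverse intro: Ck_on_subset)
next
  case (alg_root \<Psi>)
  then obtain V where V: "open V" "z \<in> V" "V \<subseteq> W" "\<forall>k. Ck_on k (\<lambda>w. \<Psi> (F w)) V" by blast
  then have "continuous_on V (\<lambda>w. \<Psi> (F w))" by (metis Ck_on.simps(1))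
  then have "open (V \<inter> (\<lambda>w. \<Psi> (F w)) -` (- {0}))"
    using V(1) by (intro continuous_open_preimage) auto
  with V alg_root(2) show ?case
    by (intro exI[of _ "V \<inter> (\<lambda>w. \<Psi> (F w)) -` (- {0})"]) (auto intro!: Ck_on_root intro: Ck_on_subset)
qed

text \<open>This and the next three definitions are closed formulas that agree on G2-forms with the
  objects given by description or by \<open>matrix_inv\<close>, but are visibly algebraic in the
  components.\<close>

definition vol_of :: "tensor \<Rightarrow> real" where
  "vol_of f = root 9 (det (b_form f))"

definition metric_of :: "tensor \<Rightarrow> real^7^7" where
  "metric_of f = (\<chi> i j. b_form f $ i $ j / vol_of f)"

text \<open>Cramer's rule.\<close>

definition inv_metric_of :: "tensor \<Rightarrow> real^7^7" where
  "inv_metric_of f = (\<chi> k m. det (\<chi> i j. if j = k then axis m 1 $ i else metric_of f $ i $ j) / det (metric_of f))"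

definition psi_of :: "tensor \<Rightarrow> tensor" where
  "psi_of f J = (\<Sum>I | length I = 3. \<Sum>K | length K = 3.
        (\<Prod>r<3. inv_metric_of f $ (I ! r) $ (K ! r)) * f K * (vol_of f * eps (I @ J))) / 6"

lemma G2_form_explicit:
  assumes "G2_form f"
  shows "G2_vol f = vol_of f" "G2_metric f = metric_of f" "G2_inv_metric f = inv_metric_of f" "G2_psi f = psi_of f"
    "vol_of f \<noteq> 0" "det (metric_of f) \<noteq> 0"
proof -
  obtain L where L: "invertible L" "\<And>I. length I = 3 \<Longrightarrow> f I = pullback L phi0 I"
    using assms by (auto simp: G2_form_def)
  note vol = is_G2_metric_vol_pullback[OF L]
  show v: "G2_vol f = vol_of f" and v0: "vol_of f \<noteq> 0"
    using is_G2_metric_vol_explicit[OF vol] G2_metric_vol_eq[OF vol] by (simp_all add: vol_of_def)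
  show G: "G2_metric f = metric_of f"
    using is_G2_metric_vol_explicit[OF vol] G2_metric_vol_eq[OF vol]
    by (simp add: metric_of_def vol_of_def vec_eq_iff divide_inverse mult.commute)
  show d: "det (metric_of f) \<noteq> 0"
    using is_G2_metric_vol_explicit(3,4)[OF vol] G2_metric_vol_eq[OF vol] G by auto
  show Gi: "G2_inv_metric f = inv_metric_of f"
  proof -
    have "G2_inv_metric f $ k $ m = inv_metric_of f $ k $ m" for k m
    proof -
      have "metric_of f *v (G2_inv_metric f *v axis m 1) = axis m 1"
        using G2_metric_inv(1)[OF assms] by (simp add: G matrix_vector_mul_assoc)
      then have "G2_inv_metric f *v axis m 1 = (\<chi> k. det (\<chi> i j. if j = k then axis m 1 $ i else metric_of f $ i $ j) / det (metric_of f))"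
        using cramer[OF d] by blast
      then show ?thesis
        by (simp add: inv_metric_of_def matrix_vector_mul_component inner_axis vec_eq_iff)
    qed
    then show ?thesis by (simp add: vec_eq_iff)
  qed
  show "G2_psi f = psi_of f"
    using Gi by (simp add: fun_eq_iff G2_psi_def hodge_def psi_of_def v top_form_eps G2_inv_metric_def fact_numeral)
qed

lemma alg_b_form: "alg f0 (\<lambda>f. b_form f $ i $ j)"
  unfolding b_form_def eps_form_def tensor_prod_def int_prod_axis vec_lambda_beta
  by (intro alg_divide alg_minus alg_sum alg_mult alg_const alg_component) auto

lemma alg_G2:
  assumes "G2_form f0"
  shows alg_vol: "alg f0 vol_of"
    and alg_metric: "alg f0 (\<lambda>f. metric_of f $ i $ j)"
    and alg_inv_metric: "alg f0 (\<lambda>f. inv_metric_of f $ i $ j)"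
    and alg_psi: "alg f0 (\<lambda>f. psi_of f J)"
proof -
  note nz = G2_form_explicit(5,6)[OF assms]
  show v: "alg f0 vol_of"
    unfolding vol_of_def[abs_def] by (intro alg_root alg_det alg_b_form) (use nz in \<open>auto simp: vol_of_def\<close>)
  have G: "alg f0 (\<lambda>f. metric_of f $ i $ j)" for i j
    unfolding metric_of_def vec_lambda_beta by (intro alg_divide alg_b_form v nz)
  then show "alg f0 (\<lambda>f. metric_of f $ i $ j)" .
  have Gi: "alg f0 (\<lambda>f. inv_metric_of f $ i $ j)" for i j
    unfolding inv_metric_of_def vec_lambda_beta
  proof (intro alg_divide alg_det G nz)
    show "alg f0 (\<lambda>f. (\<chi> i' j'. if j' = i then axis j 1 $ i' else metric_of f $ i' $ j') $ i' $ j')" for i' j'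
      using G alg_const by (cases "j' = i") auto
  qed
  then show "alg f0 (\<lambda>f. inv_metric_of f $ i $ j)" .
  show "alg f0 (\<lambda>f. psi_of f J)"
    unfolding psi_of_def by (intro alg_divide alg_sum alg_mult alg_prod alg_const Gi v alg_component) auto
qed


section \<open>Derivatives along curves, by naturality\<close>

lemma has_real_derivative_pullback:
  "((\<lambda>s. pullback (mat 1 + (s - \<sigma>) *\<^sub>R B) \<alpha> I) has_real_derivative act B \<alpha> I) (at \<sigma> within S)"
proof (rule has_field_derivative_at_within)
  define n where "n = length I"
  have "((\<lambda>s. (mat 1 + (s - \<sigma>) *\<^sub>R B) $ i $ j) has_real_derivative B $ i $ j) (at \<sigma>)" for i j
    by (auto intro!: derivative_eq_intros)
  then have "((\<lambda>s. \<Prod>r<n. (mat 1 + (s - \<sigma>) *\<^sub>R B) $ (K ! r) $ (I ! r)) has_real_derivative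
      (\<Sum>r<n. B $ (K ! r) $ (I ! r) * (\<Prod>q\<in>{..<n} - {r}. mat 1 $ (K ! q) $ (I ! q)))) (at \<sigma>)" for K
    by (intro DERIV_cong[OF has_field_derivative_prod[where f = "\<lambda>r s. (mat 1 + (s - \<sigma>) *\<^sub>R B) $ (K ! r) $ (I ! r)" and f' = "\<lambda>r. B $ (K ! r) $ (I ! r)"]]) simp_all
  then have "((\<lambda>s. pullback (mat 1 + (s - \<sigma>) *\<^sub>R B) \<alpha> I) has_real_derivative
      (\<Sum>K | length K = n. (\<Sum>r<n. B $ (K ! r) $ (I ! r) * (\<Prod>q\<in>{..<n} - {r}. mat 1 $ (K ! q) $ (I ! q))) * \<alpha> K)) (at \<sigma>)"
    unfolding pullback_def n_def[symmetric] by (intro DERIV_sum DERIV_cmult_right)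
  also have "(\<Sum>K | length K = n. (\<Sum>r<n. B $ (K ! r) $ (I ! r) * (\<Prod>q\<in>{..<n} - {r}. mat 1 $ (K ! q) $ (I ! q))) * \<alpha> K)
      = (\<Sum>r<n. \<Sum>K | length K = n. B $ (K ! r) $ (I ! r) * (\<Prod>q\<in>{..<n} - {r}. mat 1 $ (K ! q) $ (I ! q)) * \<alpha> K)"
    unfolding sum_distrib_right by (rule sum.swap)
  also have "\<dots> = act B \<alpha> I"
    unfolding act_def n_def[symmetric]
  proof (rule sum.cong[OF refl])
    fix r assume "r \<in> {..<n}"
    then have r: "r < n" by simp
    \<comment> \<open>At \<open>s = \<sigma>\<close> the factors that are not differentiated are
      Kronecker deltas, so only lists differing from \<open>I\<close> at most in position
      \<open>r\<close> survive.\<close>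
    have p: "(\<Prod>q\<in>{..<n} - {r}. (mat 1 :: real^7^7) $ (K ! q) $ (I ! q)) = of_bool (\<forall>q\<in>{..<n} - {r}. K ! q = I ! q)" for K
      by (auto simp: mat_def of_bool_def intro!: prod.neutral)
    have "(\<Sum>K | length K = n. B $ (K ! r) $ (I ! r) * (\<Prod>q\<in>{..<n} - {r}. mat 1 $ (K ! q) $ (I ! q)) * \<alpha> K)
        = (\<Sum>K\<in>(\<lambda>m. I[r := m]) ` UNIV. B $ (K ! r) $ (I ! r) * (\<Prod>q\<in>{..<n} - {r}. mat 1 $ (K ! q) $ (I ! q)) * \<alpha> K)"
    proof (rule sum.mono_neutral_right)
      show "\<forall>K\<in>{K. length K = n} - (\<lambda>m. I[r := m]) ` UNIV. B $ (K ! r) $ (I ! r) * (\<Prod>q\<in>{..<n} - {r}. mat 1 $ (K ! q) $ (I ! q)) * \<alpha> K = 0"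
      proof
        fix K assume K: "K \<in> {K. length K = n} - (\<lambda>m. I[r := m]) ` UNIV"
        have "\<not> (\<forall>q\<in>{..<n} - {r}. K ! q = I ! q)"
        proof
          assume "\<forall>q\<in>{..<n} - {r}. K ! q = I ! q"
          then have "K = I[r := K ! r]"
            using K r by (auto simp: list_eq_iff_nth_eq n_def nth_list_update)
          then show False using K by blast
        qed
        then show "B $ (K ! r) $ (I ! r) * (\<Prod>q\<in>{..<n} - {r}. mat 1 $ (K ! q) $ (I ! q)) * \<alpha> K = 0"
          by (simp add: p)
      qed
    qed (auto simp: finite_length_eq n_def)
    also have "\<dots> = (\<Sum>m\<in>UNIV. B $ m $ (I ! r) * \<alpha> (I[r := m]))"
    proof -
      have "inj (\<lambda>m. I[r := m])"
        using r by (intro injI) (metis n_def nth_list_update_eq)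
      then show ?thesis
        using r by (simp add: sum.reindex n_def mat_def)
    qed
    finally show "(\<Sum>K | length K = n. B $ (K ! r) $ (I ! r) * (\<Prod>q\<in>{..<n} - {r}. mat 1 $ (K ! q) $ (I ! q)) * \<alpha> K)
        = (\<Sum>m\<in>UNIV. B $ m $ (I ! r) * \<alpha> (I[r := m]))" .
  qed
  finally show "((\<lambda>s. pullback (mat 1 + (s - \<sigma>) *\<^sub>R B) \<alpha> I) has_real_derivative act B \<alpha> I) (at \<sigma>)" .
qed

lemma eventually_invertible: "\<forall>\<^sub>F s in at \<sigma>. invertible (mat 1 + (s - \<sigma>) *\<^sub>R B :: real^7^7)"
proof -
  have "isCont (\<lambda>s. det (mat 1 + (s - \<sigma>) *\<^sub>R B :: real^7^7)) \<sigma>"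
    unfolding det_def by (intro continuous_intros)
  then have "((\<lambda>s. det (mat 1 + (s - \<sigma>) *\<^sub>R B :: real^7^7)) \<longlongrightarrow> 1) (at \<sigma>)"
    by (simp add: isCont_def)
  then have "\<forall>\<^sub>F s in at \<sigma>. det (mat 1 + (s - \<sigma>) *\<^sub>R B :: real^7^7) \<noteq> 0"
    by (rule tendsto_imp_eventually_ne) simp
  then show ?thesis by (simp add: invertible_det_nz)
qed

lemma pullback_tensor2: "pullback L (tensor2 G) [i,j] = (transpose L ** G ** L) $ i $ j"
  unfolding matrix_matrix_mult_def[of _ L] matrix_matrix_mult_def[of "transpose L"]
  by (simp add: pullback_def sum_length_Suc numeral_2_eq_2 lessThan_Suc tensor2_def transpose_def sum_distrib_left sum_distrib_right mult_ac)
    (subst sum.swap, simp add: mult_ac)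

lemma matrix_inv_gram:
  fixes L E :: "real^'n^'n"
  assumes "L ** E = mat 1" "E ** L = mat 1"
  shows "matrix_inv (transpose L ** L) = E ** transpose E"
proof -
  have t: "transpose L ** transpose E = mat 1" "transpose E ** transpose L = mat 1"
    by (simp_all add: matrix_transpose_mul[symmetric] assms transpose_mat)
  have "transpose L ** L ** (E ** transpose E) = transpose L ** (L ** E) ** transpose E"
    "E ** transpose E ** (transpose L ** L) = E ** (transpose E ** transpose L) ** L"
    by (simp_all only: matrix_mul_assoc)
  then show ?thesis
    by (intro matrix_inv_eqI) (simp_all add: assms t)
qed

text \<open>If \<open>L\<close> is a frame for \<open>f\<close>, then \<open>L ** M\<close> is one
  for the pullback, and all three objects are expressed through frames.\<close>

lemma G2_pullback:
  assumes f: "G2_form f" and M: "invertible M"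
  shows "G2_form (pullback M f)" "G2_metric (pullback M f) = transpose M ** G2_metric f ** M"
    "\<And>J. length J = 4 \<Longrightarrow> G2_psi (pullback M f) J = pullback M (G2_psi f) J"
proof -
  obtain L E where LE: "L ** E = mat 1" and EL: "E ** L = mat 1" and L: "\<And>I. length I = 3 \<Longrightarrow> f I = pullback L phi0 I"
    and G: "G2_metric f = transpose L ** L" and v: "G2_vol f = - det L"
    and Gi: "G2_inv_metric f = E ** transpose E" and \<psi>: "\<And>J. length J = 4 \<Longrightarrow> G2_psi f J = pullback L psi_tensor J"
    by (rule G2_frame[OF f]) blast
  obtain M' where M': "M ** M' = mat 1" "M' ** M = mat 1"
    using M by (auto simp: invertible_def)
  have inv: "(L ** M) ** (M' ** E) = mat 1" "(M' ** E) ** (L ** M) = mat 1"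
    by (metis LE M'(1) matrix_mul_assoc matrix_mul_lid, metis EL M'(2) matrix_mul_assoc matrix_mul_lid)
  then have i: "invertible (L ** M)" by (auto simp: invertible_def)
  have f': "pullback M f I = pullback (L ** M) phi0 I" if "length I = 3" for I
  proof -
    have "pullback M f I = pullback M (pullback L phi0) I"
      by (rule pullback_cong) (simp add: L that)
    then show ?thesis by (simp add: pullback_compose)
  qed
  show "G2_form (pullback M f)"
    using i f' by (auto simp: G2_form_def)
  note vol = G2_metric_vol_eq[OF is_G2_metric_vol_pullback[OF i, of "pullback M f", OF f']]
  show G': "G2_metric (pullback M f) = transpose M ** G2_metric f ** M"
    by (simp add: vol G matrix_transpose_mul matrix_mul_assoc)
  fix J :: "7 list" assume J: "length J = 4"
  have Gi': "matrix_inv (G2_metric (pullback M f)) = (M' ** E) ** transpose (M' ** E)"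
    using matrix_inv_gram[OF inv] vol(1) by simp
  have "G2_psi (pullback M f) J = pullback (L ** M) psi_tensor J"
    using hodge_phi0_pullback[OF inv(1) J, of "pullback M f", OF f' Gi'] vol(2)
    by (simp add: G2_psi_def)
  also have "\<dots> = pullback M (pullback L psi_tensor) J"
    by (simp add: pullback_compose)
  also have "\<dots> = pullback M (G2_psi f) J"
    by (rule pullback_cong) (simp add: \<psi> J)
  finally show "G2_psi (pullback M f) J = pullback M (G2_psi f) J" .
qed

text \<open>A curve of \<open>G\<^sub>2\<close>-forms with velocity \<open>act B f\<close> has the same first jet as the curve of pullbacks
  of \<open>f\<close> by \<open>1 + sB\<close>, on which the metric and the dual form are explicit by naturality.\<close>

lemma G2_derivative:
  assumes S: "\<sigma> \<in> S" "\<And>s. s \<in> S \<Longrightarrow> G2_form (c s)"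
    and c: "\<And>I. length I = 3 \<Longrightarrow> ((\<lambda>s. c s I) has_real_derivative act B (c \<sigma>) I) (at \<sigma> within S)"
  shows "((\<lambda>s. G2_metric (c s) $ i $ j) has_real_derivative act B (tensor2 (G2_metric (c \<sigma>))) [i,j]) (at \<sigma> within S)"
    "length J = 4 \<Longrightarrow> ((\<lambda>s. G2_psi (c s) J) has_real_derivative act B (G2_psi (c \<sigma>)) J) (at \<sigma> within S)"
    "\<exists>D. ((\<lambda>s. G2_inv_metric (c s) $ i $ j) has_real_derivative D) (at \<sigma> within S)"
proof -
  let ?M = "\<lambda>s. mat 1 + (s - \<sigma>) *\<^sub>R B"
  let ?c = "\<lambda>s. pullback (?M s) (c \<sigma>)"
  have f: "G2_form (c \<sigma>)" using S by blast
  have jets: "curve_jet (c \<sigma>) (act B (c \<sigma>)) c \<sigma> S" "curve_jet (c \<sigma>) (act B (c \<sigma>)) ?c \<sigma> UNIV"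
    unfolding curve_jet_def using c by (auto simp: pullback_mat_1 intro: has_real_derivative_pullback)
  \<comment> \<open>\<Phi> is the geometric quantity, \<Psi> its algebraic formula. The latter gives
    both curves one common derivative \<open>D\<close>; naturality of \<Phi> along the pullbacks
    identifies \<open>D\<close>.\<close>
  have key: "((\<lambda>s. \<Phi> (c s)) has_real_derivative act B \<alpha> K) (at \<sigma> within S)"
    if \<Psi>: "alg (c \<sigma>) \<Psi>" "\<And>f. G2_form f \<Longrightarrow> \<Phi> f = \<Psi> f"
      and \<Phi>: "\<And>M. invertible M \<Longrightarrow> \<Phi> (pullback M (c \<sigma>)) = pullback M \<alpha> K" for \<Phi> \<Psi> \<alpha> K
  proof -
    obtain D where D: "\<forall>c' \<sigma>' S. curve_jet (c \<sigma>) (act B (c \<sigma>)) c' \<sigma>' S \<longrightarrow> ((\<lambda>s. \<Psi> (c' s)) has_real_derivative D) (at \<sigma>' within S)"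
      using alg_jet[OF \<Psi>(1)] by blast
    note D = D[rule_format]
    have "((\<lambda>s. \<Psi> (?c s)) has_real_derivative D) (at \<sigma>)"
      using D[OF jets(2)] by simp
    moreover have eq: "\<Psi> (?c s) = pullback (?M s) \<alpha> K" if "invertible (?M s)" for s
      using \<Psi>(2)[OF G2_pullback(1)[OF f that]] \<Phi>[OF that] by simp
    have "\<forall>\<^sub>F s in at \<sigma>. \<Psi> (?c s) = pullback (?M s) \<alpha> K"
      using eventually_invertible by eventually_elim (rule eq)
    moreover have "\<Psi> (?c \<sigma>) = pullback (?M \<sigma>) \<alpha> K"
      by (rule eq) (simp add: invertible_det_nz)
    ultimately have "((\<lambda>s. pullback (?M s) \<alpha> K) has_real_derivative D) (at \<sigma>)"
      by (simp add: has_field_derivative_cong_eventually)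
    then have "D = act B \<alpha> K"
      using DERIV_unique has_real_derivative_pullback by blast
    then show ?thesis
      using has_field_derivative_transform_within[OF D[OF jets(1)] zero_less_one S(1), of "\<lambda>s. \<Phi> (c s)"] S(2) \<Psi>(2) by simp
  qed
  show "((\<lambda>s. G2_metric (c s) $ i $ j) has_real_derivative act B (tensor2 (G2_metric (c \<sigma>))) [i,j]) (at \<sigma> within S)"
    by (rule key[OF alg_metric[OF f]], simp add: G2_form_explicit, simp add: pullback_tensor2 G2_pullback[OF f])
  show "((\<lambda>s. G2_psi (c s) J) has_real_derivative act B (G2_psi (c \<sigma>)) J) (at \<sigma> within S)" if "length J = 4"
    by (rule key[OF alg_psi[OF f]], simp add: G2_form_explicit, simp add: that G2_pullback[OF f])
  \<comment> \<open>Existence suffices here: the inverse metric serves to show that \<Gamma> and the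
    torsion are differentiable in time, while their rates are found from other equations.\<close>
  show "\<exists>D. ((\<lambda>s. G2_inv_metric (c s) $ i $ j) has_real_derivative D) (at \<sigma> within S)"
  proof -
    obtain D where D: "((\<lambda>s. inv_metric_of (c s) $ i $ j) has_real_derivative D) (at \<sigma> within S)"
      using alg_jet[OF alg_inv_metric[OF f]] jets(1) by metis
    have "((\<lambda>s. G2_inv_metric (c s) $ i $ j) has_real_derivative D) (at \<sigma> within S)"
      using has_field_derivative_transform_within[OF D zero_less_one S(1), of "\<lambda>s. G2_inv_metric (c s) $ i $ j"] S(2) G2_form_explicit(3) by simp
    then show ?thesis by blast
  qed
qed

section \<open>Levi-Civita connection and torsion in coordinates\<close>

text \<open>The connection form in direction \<open>k\<close> as an endomorphism. A covariant
  derivative is then a partial derivative minus an \<open>act\<close>, the same operation that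
  describes the flow.\<close>

definition chr_mat :: "(7 \<Rightarrow> 7 \<Rightarrow> 7 \<Rightarrow> real) \<Rightarrow> 7 \<Rightarrow> real^7^7" where
  "chr_mat \<Gamma> k = (\<chi> m i. \<Gamma> m k i)"

lemma cov_deriv_act:
  "cov_deriv c \<Gamma> k S p I = partial_deriv c k (\<lambda>q. S q I) p - act (chr_mat \<Gamma> k) (S p) I"
  by (simp add: cov_deriv_def act_def chr_mat_def)

lemma act_tensor2: "act A (tensor2 G) [i,j] = (\<Sum>m\<in>UNIV. A $ m $ i * G $ m $ j) + (\<Sum>m\<in>UNIV. A $ m $ j * G $ i $ m)"
  by (simp add: act_2 tensor2_def)

definition christoffel :: "real^7^7 \<Rightarrow> (7 \<Rightarrow> 7 \<Rightarrow> 7 \<Rightarrow> real) \<Rightarrow> 7 \<Rightarrow> 7 \<Rightarrow> 7 \<Rightarrow> real" where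
  "christoffel H d m i j = (\<Sum>r\<in>UNIV. H $ m $ r * (d i r j + d j r i - d r i j)) / 2"

text \<open>\<open>d k i j\<close> stands for \<open>\<partial>\<^sub>k G\<^sub>i\<^sub>j\<close>. The symbols with lowered index are determined by cyclic permutation.\<close>

lemma lowered_symbols_unique:
  fixes N d :: "7 \<Rightarrow> 7 \<Rightarrow> 7 \<Rightarrow> real"
  assumes "\<And>i k j. N i k j = N i j k" "\<And>k i j. N i k j + N j k i = d k i j"
  shows "2 * N i k j = d k i j + d j i k - d i k j"
  using assms(2)[of i k j] assms(2)[of i j k] assms(2)[of k i j] assms(1)[of i k j] assms(1)[of j k i] assms(1)[of k i j]
  by linarith

text \<open>With the upper index lowered by \<open>G\<close> the two conditions become the
  hypotheses of \<open>lowered_symbols_unique\<close>; \<open>H\<close> raises the index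
  again.\<close>

lemma christoffel_unique:
  fixes G H :: "real^7^7"
  assumes GH: "G ** H = mat 1" "H ** G = mat 1" and G: "transpose G = G"
    and d: "\<And>k i j. d k i j = d k j i"
  shows "((\<forall>m i j. \<Gamma> m i j = \<Gamma> m j i) \<and> (\<forall>k i j. d k i j = act (chr_mat \<Gamma> k) (tensor2 G) [i,j]))
    \<longleftrightarrow> \<Gamma> = christoffel H d"
proof -
  have Gs: "G $ i $ j = G $ j $ i" for i j
    using arg_cong[OF G, of "\<lambda>M. M $ j $ i"] by (simp add: transpose_def)
  have GHs: "(\<Sum>m\<in>UNIV. G $ i $ m * H $ m $ j) = of_bool (i = j)" "(\<Sum>m\<in>UNIV. H $ i $ m * G $ m $ j) = of_bool (i = j)" for i j
    using GH by (simp_all add: vec_eq_iff matrix_matrix_mult_def mat_def of_bool_def)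
  have low: "(\<Sum>m\<in>UNIV. G $ i $ m * christoffel H d m k j) = (d k i j + d j i k - d i k j) / 2" for i k j
  proof -
    have "(\<Sum>m\<in>UNIV. G $ i $ m * christoffel H d m k j) = (\<Sum>r\<in>UNIV. (\<Sum>m\<in>UNIV. G $ i $ m * H $ m $ r) * (d k r j + d j r k - d r k j)) / 2"
      unfolding christoffel_def sum_divide_distrib sum_distrib_left sum_distrib_right
      by (subst sum.swap) (simp add: mult_ac)
    also have "\<dots> = (d k i j + d j i k - d i k j) / 2"
      unfolding GHs by (simp add: eq_commute[of i])
    finally show ?thesis .
  qed
  have act: "act (chr_mat \<Gamma> k) (tensor2 G) [i,j] = (\<Sum>m\<in>UNIV. G $ i $ m * \<Gamma> m k j) + (\<Sum>m\<in>UNIV. G $ j $ m * \<Gamma> m k i)" for \<Gamma> k i j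
    unfolding act_tensor2 chr_mat_def by (simp add: mult.commute Gs[of _ j])
  show ?thesis
  proof
    assume \<Gamma>: "(\<forall>m i j. \<Gamma> m i j = \<Gamma> m j i) \<and> (\<forall>k i j. d k i j = act (chr_mat \<Gamma> k) (tensor2 G) [i,j])"
    define N where "N i k j = (\<Sum>m\<in>UNIV. G $ i $ m * \<Gamma> m k j)" for i k j
    have "2 * N i k j = d k i j + d j i k - d i k j" for i k j
    proof (rule lowered_symbols_unique)
      show "N i k j = N i j k" for i k j using \<Gamma> unfolding N_def by metis
      show "N i k j + N j k i = d k i j" for i k j using \<Gamma> by (simp add: act N_def)
    qed
    then have eq: "N i k j = (\<Sum>m\<in>UNIV. G $ i $ m * christoffel H d m k j)" for i k j
      unfolding low by (simp add: field_simps)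
    show "\<Gamma> = christoffel H d"
    proof (intro ext)
      fix n k j
      have inv: "(\<Sum>i\<in>UNIV. H $ n $ i * (\<Sum>m\<in>UNIV. G $ i $ m * x m)) = x n" for x :: "7 \<Rightarrow> real"
      proof -
        have "(\<Sum>i\<in>UNIV. H $ n $ i * (\<Sum>m\<in>UNIV. G $ i $ m * x m)) = (\<Sum>m\<in>UNIV. (\<Sum>i\<in>UNIV. H $ n $ i * G $ i $ m) * x m)"
          unfolding sum_distrib_left sum_distrib_right by (subst sum.swap) (simp add: mult_ac)
        then show ?thesis unfolding GHs by (simp add: eq_commute[of n])
      qed
      show "\<Gamma> n k j = christoffel H d n k j"
        using inv[of "\<lambda>m. \<Gamma> m k j"] inv[of "\<lambda>m. christoffel H d m k j"] eq[of _ k j, unfolded N_def] by simp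
    qed
  next
    assume "\<Gamma> = christoffel H d"
    moreover have "christoffel H d m i j = christoffel H d m j i" for m i j
      unfolding christoffel_def by (intro arg_cong2[where f = "(/)"] sum.cong refl) (simp add: d[of _ i j])
    moreover have "d k i j = act (chr_mat (christoffel H d) k) (tensor2 G) [i,j]" for k i j
    proof -
      have "x = (x + y - z) / 2 + (x + z - y) / 2" for x y z :: real
        by (simp add: field_simps)
      then show ?thesis
        unfolding act low by (simp only: d[of k j i] d[of j k i] d[of i k j])
    qed
    ultimately show "(\<forall>m i j. \<Gamma> m i j = \<Gamma> m j i) \<and> (\<forall>k i j. d k i j = act (chr_mat \<Gamma> k) (tensor2 G) [i,j])"
      by simp
  qed
qed

lemma levi_civita_christoffel:
  fixes G :: "'a \<Rightarrow> real^7^7"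
  assumes GH: "G p ** H = mat 1" "H ** G p = mat 1" and G: "transpose (G p) = G p"
    and d: "\<And>k i j. partial_deriv c k (\<lambda>q. G q $ i $ j) p = partial_deriv c k (\<lambda>q. G q $ j $ i) p"
  shows "levi_civita c G p = christoffel H (\<lambda>k i j. partial_deriv c k (\<lambda>q. G q $ i $ j) p)" (is "_ = christoffel H ?d")
    "partial_deriv c k (\<lambda>q. G q $ i $ j) p = act (chr_mat (levi_civita c G p) k) (tensor2 (G p)) [i,j]"
    "levi_civita c G p m i j = levi_civita c G p m j i"
proof -
  have iff: "((\<forall>m i j. \<Gamma> m i j = \<Gamma> m j i) \<and> (\<forall>k i j. cov_deriv c \<Gamma> k (\<lambda>q. tensor2 (G q)) p [i, j] = 0))
      \<longleftrightarrow> \<Gamma> = christoffel H ?d" for \<Gamma>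
    using christoffel_unique[OF GH G d, of \<Gamma>]
    by (simp add: cov_deriv_act tensor2_def[of _ "[_,_]"])
  show 1: "levi_civita c G p = christoffel H ?d"
    unfolding levi_civita_def iff by simp
  have "(\<forall>m i j. levi_civita c G p m i j = levi_civita c G p m j i) \<and> (\<forall>k i j. ?d k i j = act (chr_mat (levi_civita c G p) k) (tensor2 (G p)) [i,j])"
    by (rule iffD2[OF christoffel_unique[OF GH G d] 1])
  then show "partial_deriv c k (\<lambda>q. G q $ i $ j) p = act (chr_mat (levi_civita c G p) k) (tensor2 (G p)) [i,j]"
    "levi_civita c G p m i j = levi_civita c G p m j i" by blast+
qed


section \<open>Recovering the torsion from the derivative of the 3-form\<close>

text \<open>Solves \<open>\<alpha> = V \<lrcorner> \<psi>\<close> for the covector of \<open>V\<close>: contracting twice with \<open>\<phi>\<close> multiplies it by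
  \<open>- 4 \<cdot> 6\<close>.\<close>

definition frame_torsion :: "tensor \<Rightarrow> tensor \<Rightarrow> 7 \<Rightarrow> real" where
  "frame_torsion f \<alpha> q = - con2 (G2_inv_metric f)
     (\<lambda>i l. con2 (G2_inv_metric f) (\<lambda>j k. \<alpha> [i,j,k]) (\<lambda>a b. f [a,b,l])) (\<lambda>a b. f [a,b,q]) / 24"

lemma con2_sum_left:
  "con2 H (\<lambda>i j. \<Sum>n\<in>UNIV. v n * \<beta> n i j) \<gamma> = (\<Sum>n\<in>UNIV. v n * con2 H (\<beta> n) \<gamma>)"
  unfolding con2_def sum_distrib_left sum_distrib_right
  by (subst sum_rotate5[symmetric]) (simp add: mult_ac)

lemma frame_torsion_int_prod:
  assumes f: "G2_form f" and \<alpha>: "\<And>i j k. \<alpha> [i,j,k] = int_prod V (G2_psi f) [i,j,k]"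
  shows "frame_torsion f \<alpha> q = (G2_metric f *v V) $ q"
proof -
  have sym: "G2_metric f $ i $ j = G2_metric f $ j $ i" for i j
    using arg_cong[OF transpose_G2_metric[OF f], of "\<lambda>M. M $ j $ i"] by (simp add: transpose_def)
  have "con2 (G2_inv_metric f) (\<lambda>j k. \<alpha> [i,j,k]) (\<lambda>a b. f [a,b,l]) = (\<Sum>n\<in>UNIV. (- 4 * V $ n) * f [n,i,l])" for i l
    unfolding \<alpha> int_prod_def con2_sum_left con2_psi_f[OF f] by (simp add: mult_ac)
  then have "frame_torsion f \<alpha> q = - (\<Sum>n\<in>UNIV. (- 4 * V $ n) * (6 * G2_metric f $ n $ q)) / 24"
    unfolding frame_torsion_def by (simp only: con2_sum_left con2_f_f[OF f])
  also have "\<dots> = (G2_metric f *v V) $ q"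
    by (simp add: matrix_vector_mult_def sum_negf sum_divide_distrib sym[of q] mult_ac)
  finally show ?thesis .
qed

lemma int_prod_psi_inj:
  assumes f: "G2_form f" and "\<And>i j k. int_prod V (G2_psi f) [i,j,k] = int_prod V' (G2_psi f) [i,j,k]"
  shows "V = V'"
proof -
  have "G2_metric f *v V = G2_metric f *v V'"
    unfolding vec_eq_iff using frame_torsion_int_prod[OF f refl] frame_torsion_int_prod[OF f assms(2)] by metis
  then have "(G2_inv_metric f ** G2_metric f) *v V = (G2_inv_metric f ** G2_metric f) *v V'"
    by (simp add: matrix_vector_mul_assoc[symmetric])
  then show ?thesis by (simp add: G2_metric_inv(2)[OF f])
qed

text \<open>Because V \<lrcorner> \<psi> determines V, the equation defining the torsion has exactly
  one solution as soon as each covariant derivative of \<phi> has this form.\<close>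

lemma full_torsion_eq:
  assumes f: "G2_form (\<phi> c p)"
    and V: "\<And>l i j k. G2_nabla \<phi> c l (\<phi> c) p [i,j,k] = int_prod (V l) (G2_psi (\<phi> c p)) [i,j,k]"
  shows "full_torsion \<phi> c p $ l = G2_metric (\<phi> c p) *v V l"
    "full_torsion \<phi> c p $ l $ q = frame_torsion (\<phi> c p) (G2_nabla \<phi> c l (\<phi> c) p) q"
proof -
  let ?f = "\<phi> c p"
  define T0 :: "real^7^7" where "T0 = (\<chi> l. G2_metric ?f *v V l)"
  have sym: "transpose (G2_inv_metric ?f) = G2_inv_metric ?f"
  proof -
    have "transpose (G2_inv_metric ?f) ** G2_metric ?f = transpose (G2_metric ?f ** G2_inv_metric ?f)"
      by (simp add: matrix_transpose_mul transpose_G2_metric[OF f])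
    also have "\<dots> = mat 1" by (simp add: G2_metric_inv(1)[OF f] transpose_mat)
    finally have "transpose (G2_inv_metric ?f) ** (G2_metric ?f ** G2_inv_metric ?f) = G2_inv_metric ?f"
      by (simp add: matrix_mul_assoc)
    then show ?thesis by (simp add: G2_metric_inv(1)[OF f])
  qed
  have sym': "G2_inv_metric ?f $ i $ j = G2_inv_metric ?f $ j $ i" for i j
    using arg_cong[OF sym, of "\<lambda>M. M $ j $ i"] by (simp add: transpose_def)
  have rhs: "(\<Sum>m\<in>UNIV. \<Sum>n\<in>UNIV. T $ l $ m * G2_inv_metric ?f $ m $ n * G2_psi ?f [n,i,j,k])
      = int_prod (G2_inv_metric ?f *v (T $ l)) (G2_psi ?f) [i,j,k]" for T :: "real^7^7" and l i j k
    unfolding int_prod_def matrix_vector_mult_def sum_distrib_right vec_lambda_beta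
    by (subst sum.swap) (simp add: sym'[of _ m for m] mult_ac)
  have "(\<forall>l i j k. G2_nabla \<phi> c l (\<phi> c) p [i,j,k] =
        (\<Sum>m\<in>UNIV. \<Sum>n\<in>UNIV. T $ l $ m * G2_inv_metric ?f $ m $ n * G2_psi ?f [n,i,j,k])) \<longleftrightarrow> T = T0" for T
  proof -
    have "(\<forall>l i j k. G2_nabla \<phi> c l (\<phi> c) p [i,j,k] =
        (\<Sum>m\<in>UNIV. \<Sum>n\<in>UNIV. T $ l $ m * G2_inv_metric ?f $ m $ n * G2_psi ?f [n,i,j,k]))
      \<longleftrightarrow> (\<forall>l. V l = G2_inv_metric ?f *v (T $ l))"
      unfolding rhs V using int_prod_psi_inj[OF f] by metis
    also have "\<dots> \<longleftrightarrow> (\<forall>l. T $ l = G2_metric ?f *v V l)"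
    proof -
      have "V l = G2_inv_metric ?f *v (T $ l) \<longleftrightarrow> T $ l = G2_metric ?f *v V l" for l
        by (metis G2_metric_inv[OF f] matrix_vector_mul_assoc matrix_vector_mul_lid)
      then show ?thesis by blast
    qed
    finally show ?thesis by (simp add: T0_def vec_eq_iff)
  qed
  then have "full_torsion \<phi> c p = T0"
    unfolding full_torsion_def by simp
  then show 1: "full_torsion \<phi> c p $ l = G2_metric ?f *v V l"
    by (simp add: T0_def)
  show "full_torsion \<phi> c p $ l $ q = frame_torsion ?f (G2_nabla \<phi> c l (\<phi> c) p) q"
    unfolding 1 by (rule frame_torsion_int_prod[OF f V, symmetric])
qed

section \<open>Spatial derivatives in a chart\<close>

lemma chart_on_facts:
  assumes "chart_on M c"
  shows "open (chart_image c)" "x \<in> chart_dom c \<Longrightarrow> chart_map c x \<in> chart_image c"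
    "x \<in> chart_dom c \<Longrightarrow> chart_inv c (chart_map c x) = x"
    "z \<in> chart_image c \<Longrightarrow> chart_inv c z \<in> chart_dom c"
proof -
  have "topspace (subtopology M (chart_dom c)) = chart_dom c"
    using assms openin_subset by (fastforce simp: chart_on_def)
  then have inj: "inj_on (chart_map c) (chart_dom c)"
    using assms by (auto simp: chart_on_def dest: homeomorphic_imp_injective_map)
  show "open (chart_image c)" using assms by (simp add: chart_on_def)
  show "x \<in> chart_dom c \<Longrightarrow> chart_map c x \<in> chart_image c" by (simp add: chart_image_def)
  show "x \<in> chart_dom c \<Longrightarrow> chart_inv c (chart_map c x) = x"
    using inj by (simp add: chart_inv_def)
  show "z \<in> chart_image c \<Longrightarrow> chart_inv c z \<in> chart_dom c"
    by (simp add: chart_inv_def chart_image_def inv_into_into)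
qed

text \<open>Holds also at points of non-differentiability: both sides choose from the same set of
  derivatives.\<close>

lemma frechet_derivative_cong_open:
  assumes "open U" "y \<in> U" "\<And>z. z \<in> U \<Longrightarrow> f z = g z"
  shows "frechet_derivative f (at y) = frechet_derivative g (at y)"
proof -
  have "(f has_derivative D) (at y) \<longleftrightarrow> (g has_derivative D) (at y)" for D
    using has_derivative_transform_within_open[OF _ assms(1,2), of f D UNIV g]
      has_derivative_transform_within_open[OF _ assms(1,2), of g D UNIV f] assms(3) by auto
  then show ?thesis by (simp add: frechet_derivative_def)
qed

lemma act_diff: "act (A - B) S I = act A S I - act B S I"
  by (simp add: act_def left_diff_distrib sum_subtractf)

lemma act_add: "act (A + B) S I = act A S I + act B S I"
  by (simp add: act_def distrib_right sum.distrib)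

lemma has_real_derivative_act:
  assumes "\<And>m i. ((\<lambda>s. A s $ m $ i) has_real_derivative A' $ m $ i) F"
    and "\<And>K. length K = length I \<Longrightarrow> ((\<lambda>s. S s K) has_real_derivative S' K) F" and F: "F = at \<sigma> within X"
  shows "((\<lambda>s. act (A s) (S s) I) has_real_derivative act A' (S \<sigma>) I + act (A \<sigma>) S' I) F"
proof -
  have "((\<lambda>s. act (A s) (S s) I) has_real_derivative
    (\<Sum>r<length I. \<Sum>m\<in>UNIV. A' $ m $ (I ! r) * S \<sigma> (I[r := m]) + S' (I[r := m]) * A \<sigma> $ m $ (I ! r))) F"
    unfolding act_def F using assms(1,2)[unfolded F] by (intro DERIV_sum DERIV_mult) auto
  then show ?thesis
    by (simp add: act_def sum.distrib mult.commute)
qed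

context
  fixes c :: "'a chart" and x :: 'a and M :: "'a topology"
  assumes chart: "chart_on M c" and x: "x \<in> chart_dom c"
begin

lemma partial_deriv_cong:
  assumes "\<And>q. q \<in> chart_dom c \<Longrightarrow> h q = h' q"
  shows "partial_deriv c k h x = partial_deriv c k h' x"
  unfolding partial_deriv_def comp_def
  by (subst frechet_derivative_cong_open[OF chart_on_facts(1,2)[OF chart]], rule x, simp add: assms chart_on_facts(4)[OF chart]) (rule refl)

text \<open>Reduces partial derivatives to curves along coordinate lines, so that
  \<open>G2_derivative\<close> applies in space as well as in time.\<close>

lemma partial_deriv_curve:
  assumes "(\<lambda>z. h (chart_inv c z)) differentiable (at (chart_map c x))"
  shows "((\<lambda>\<sigma>. h (chart_inv c (chart_map c x + \<sigma> *\<^sub>R axis k 1))) has_real_derivative partial_deriv c k h x) (at 0)"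
proof -
  let ?y = "chart_map c x" and ?D = "frechet_derivative (\<lambda>z. h (chart_inv c z)) (at (chart_map c x))"
  have D: "((\<lambda>z. h (chart_inv c z)) has_derivative ?D) (at (?y + 0 *\<^sub>R axis k 1))"
    using frechet_derivative_works[THEN iffD1, OF assms] by simp
  have "((\<lambda>\<sigma>. ?y + \<sigma> *\<^sub>R axis k 1) has_derivative (\<lambda>v. v *\<^sub>R axis k 1)) (at 0)"
    by (auto intro!: derivative_eq_intros)
  from has_derivative_compose[OF this D]
  have "((\<lambda>\<sigma>. h (chart_inv c (?y + \<sigma> *\<^sub>R axis k 1))) has_derivative (\<lambda>v. ?D (v *\<^sub>R axis k 1))) (at 0)" .
  moreover have "?D (v *\<^sub>R axis k 1) = ?D (axis k 1) * v" for v
    using linear_frechet_derivative[OF assms] by (simp add: linear_scale)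
  ultimately show ?thesis
    by (simp add: has_field_derivative_def partial_deriv_def comp_def)
qed

lemma partial_deriv_eqI:
  assumes "(\<lambda>z. h (chart_inv c z)) differentiable (at (chart_map c x))"
    "((\<lambda>\<sigma>. h (chart_inv c (chart_map c x + \<sigma> *\<^sub>R axis k 1))) has_real_derivative d) (at 0)"
  shows "partial_deriv c k h x = d"
  using partial_deriv_curve[OF assms(1)] assms(2) by (rule DERIV_unique)

context
  fixes f :: "'a \<Rightarrow> tensor"
  assumes f: "\<And>q. q \<in> chart_dom c \<Longrightarrow> G2_form (f q)"
    and df: "\<And>I. length I = 3 \<Longrightarrow> (\<lambda>z. f (chart_inv c z) I) differentiable (at (chart_map c x))"
    and dG: "\<And>i j. (\<lambda>z. G2_metric (f (chart_inv c z)) $ i $ j) differentiable (at (chart_map c x))"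
begin

lemma partial_deriv_metric_sym:
  "partial_deriv c k (\<lambda>q. G2_metric (f q) $ i $ j) x = partial_deriv c k (\<lambda>q. G2_metric (f q) $ j $ i) x"
proof (rule partial_deriv_cong)
  fix q assume "q \<in> chart_dom c"
  from arg_cong[OF transpose_G2_metric[OF f[OF this]], of "\<lambda>M. M $ j $ i"]
  show "G2_metric (f q) $ i $ j = G2_metric (f q) $ j $ i"
    by (simp add: transpose_def)
qed

abbreviation "LC \<equiv> levi_civita c (\<lambda>q. G2_metric (f q)) x"

lemmas levi_civita_G2 =
  levi_civita_christoffel[where G = "\<lambda>q. G2_metric (f q)" and p = x and c = c, OF G2_metric_inv[OF f[OF x]] transpose_G2_metric[OF f[OF x]] partial_deriv_metric_sym]

lemma nabla_phi_int_prod: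
  obtains V where "\<And>l i j k. partial_deriv c l (\<lambda>q. f q [i,j,k]) x - act (chr_mat LC l) (f x) [i,j,k] = int_prod (V l) (G2_psi (f x)) [i,j,k]"
proof -
  have "\<exists>V. \<forall>i j k. partial_deriv c l (\<lambda>q. f q [i,j,k]) x - act (chr_mat LC l) (f x) [i,j,k] = int_prod V (G2_psi (f x)) [i,j,k]" for l
  proof -
    let ?y = "\<lambda>\<sigma>. chart_map c x + \<sigma> *\<^sub>R axis l 1"
    define \<alpha> :: tensor where "\<alpha> I = partial_deriv c l (\<lambda>q. f q I) x" for I
    have neg: "partial_deriv c l (\<lambda>q. f q I) x = - partial_deriv c l (\<lambda>q. f q I') x"
      if "length I = 3" "length I' = 3" "\<And>q. q \<in> chart_dom c \<Longrightarrow> f q I = - f q I'" for I I'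
    proof -
      have "partial_deriv c l (\<lambda>q. f q I) x = partial_deriv c l (\<lambda>q. - f q I') x"
        by (rule partial_deriv_cong) (rule that(3))
      also have "\<dots> = - partial_deriv c l (\<lambda>q. f q I') x"
        using df[OF that(2)] by (intro partial_deriv_eqI differentiable_minus DERIV_minus partial_deriv_curve)
      finally show ?thesis .
    qed
    \<comment> \<open>The partial derivative of \<phi> is again a skew tensor, hence the
      infinitesimal action of some endomorphism.\<close>
    obtain B where B: "\<And>i j k. \<alpha> [i,j,k] = act B (f x) [i,j,k]"
    proof (rule surj_act[OF f[OF x], of \<alpha>])
      show "\<alpha> [j,i,k] = - \<alpha> [i,j,k]" "\<alpha> [i,k,j] = - \<alpha> [i,j,k]" for i j k
        unfolding \<alpha>_def by (rule neg; simp add: G2_form_swap(1)[OF f, of _ j i] G2_form_swap(2)[OF f, of _ i k])+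
    qed blast
    define S where "S = {\<sigma>. ?y \<sigma> \<in> chart_image c}"
    have S: "open S" "0 \<in> S"
      using chart_on_facts(1,2)[OF chart] x
      by (auto simp: S_def intro!: open_vimage[of _ ?y, unfolded vimage_def] continuous_intros)
    have x0: "chart_inv c (?y 0) = x"
      using chart_on_facts(3)[OF chart x] by simp
    have "((\<lambda>\<sigma>. G2_metric (f (chart_inv c (?y \<sigma>))) $ i $ j) has_real_derivative act B (tensor2 (G2_metric (f x))) [i,j]) (at 0)" for i j
    proof -
      have "((\<lambda>\<sigma>. f (chart_inv c (?y \<sigma>)) I) has_real_derivative act B (f (chart_inv c (?y 0))) I) (at 0 within S)" if len: "length I = 3" for I
      proof -
        obtain a b d where I: "I = [a,b,d]"
          using len by (auto simp: numeral_eq_Suc length_Suc_conv)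
        show ?thesis
          using partial_deriv_curve[OF df[OF len], of l] B[of a b d] x0
          by (simp add: I \<alpha>_def has_field_derivative_at_within)
      qed
      moreover have "G2_form (f (chart_inv c (?y \<sigma>)))" if "\<sigma> \<in> S" for \<sigma>
        using that by (intro f chart_on_facts(4)[OF chart]) (simp add: S_def)
      ultimately show ?thesis
        using G2_derivative(1)[OF S(2), of "\<lambda>\<sigma>. f (chart_inv c (?y \<sigma>))" B i j]
        unfolding at_within_open[OF S(2,1)] x0 by blast
    qed
    \<comment> \<open>By naturality \<open>B\<close> generates the partial derivative of the metric;
      by compatibility so does the connection matrix. Their difference annihilates the metric, that
      is, it is skew.\<close>
    then have "act B (tensor2 (G2_metric (f x))) [i,j] = act (chr_mat LC l) (tensor2 (G2_metric (f x))) [i,j]" for i j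
      using partial_deriv_eqI[OF dG] levi_civita_G2(2) by metis
    then have z: "act (B - chr_mat LC l) (tensor2 (G2_metric (f x))) [i,j] = 0" for i j
      by (simp add: act_diff)
    have "transpose (G2_metric (f x) ** (B - chr_mat LC l)) = - (G2_metric (f x) ** (B - chr_mat LC l))"
    proof -
      have "G2_metric (f x) $ i $ j = G2_metric (f x) $ j $ i" for i j
        using arg_cong[OF transpose_G2_metric[OF f[OF x]], of "\<lambda>M. M $ j $ i"] by (simp add: transpose_def)
      then show ?thesis
        using z by (simp add: vec_eq_iff transpose_def matrix_matrix_mult_def act_tensor2 eq_neg_iff_add_eq_0 mult.commute)
    qed
    then obtain V where "\<And>i j k. act (B - chr_mat LC l) (f x) [i,j,k] = int_prod V (G2_psi (f x)) [i,j,k]"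
      using act_skew[OF f[OF x]] by metis
    then show ?thesis
      using B by (auto simp: act_diff \<alpha>_def)
  qed
  then show ?thesis using that by metis
qed

end

end

section \<open>The flow as an infinitesimal change of frame\<close>

text \<open>Acting twice in the same slot composes the matrices, in reversed order since
  \<open>act\<close> differentiates a pullback. The terms with two different slots are symmetric in
  \<open>A\<close> and \<open>B\<close> and cancel.\<close>

lemma act_commutator:
  "act A (act B S) I - act B (act A S) I = act (B ** A - A ** B) S I"
proof -
  define n where "n = length I"
  define X where "X A B = (\<Sum>r<n. \<Sum>s\<in>{..<n} - {r}. \<Sum>m\<in>UNIV. \<Sum>k\<in>UNIV.
      A $ m $ (I ! r) * (B $ k $ (I ! s) * S (I[r := m, s := k])))" for A B :: "real^7^7"
  have split: "act A (act B S) I = act (B ** A) S I + X A B" for A B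
  proof -
    have "act A (act B S) I = (\<Sum>r<n. \<Sum>m\<in>UNIV. A $ m $ (I ! r) * (\<Sum>s<n. \<Sum>k\<in>UNIV. B $ k $ (I[r := m] ! s) * S (I[r := m, s := k])))"
      by (simp add: act_def n_def)
    also have "\<dots> = (\<Sum>r<n. (\<Sum>k\<in>UNIV. (B ** A) $ k $ (I ! r) * S (I[r := k]))
        + (\<Sum>s\<in>{..<n} - {r}. \<Sum>m\<in>UNIV. \<Sum>k\<in>UNIV. A $ m $ (I ! r) * (B $ k $ (I ! s) * S (I[r := m, s := k]))))"
    proof (rule sum.cong[OF refl])
      fix r assume "r \<in> {..<n}"
      then have r: "r < n" by simp
      have "(\<Sum>s<n. \<Sum>k\<in>UNIV. B $ k $ (I[r := m] ! s) * S (I[r := m, s := k]))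
          = (\<Sum>k\<in>UNIV. B $ k $ m * S (I[r := k])) + (\<Sum>s\<in>{..<n} - {r}. \<Sum>k\<in>UNIV. B $ k $ (I ! s) * S (I[r := m, s := k]))" for m
        using r by (subst sum.remove[of _ r]) (auto simp: n_def)
      then have "(\<Sum>m\<in>UNIV. A $ m $ (I ! r) * (\<Sum>s<n. \<Sum>k\<in>UNIV. B $ k $ (I[r := m] ! s) * S (I[r := m, s := k])))
          = (\<Sum>m\<in>UNIV. \<Sum>k\<in>UNIV. A $ m $ (I ! r) * (B $ k $ m * S (I[r := k])))
          + (\<Sum>m\<in>UNIV. \<Sum>s\<in>{..<n} - {r}. \<Sum>k\<in>UNIV. A $ m $ (I ! r) * (B $ k $ (I ! s) * S (I[r := m, s := k])))"
        by (simp add: distrib_left sum.distrib sum_distrib_left)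
      also have "(\<Sum>m\<in>UNIV. \<Sum>k\<in>UNIV. A $ m $ (I ! r) * (B $ k $ m * S (I[r := k])))
          = (\<Sum>k\<in>UNIV. (B ** A) $ k $ (I ! r) * S (I[r := k]))"
        by (subst sum.swap) (simp add: matrix_matrix_mult_def sum_distrib_left sum_distrib_right mult_ac)
      also have "(\<Sum>m\<in>UNIV. \<Sum>s\<in>{..<n} - {r}. \<Sum>k\<in>UNIV. A $ m $ (I ! r) * (B $ k $ (I ! s) * S (I[r := m, s := k])))
          = (\<Sum>s\<in>{..<n} - {r}. \<Sum>m\<in>UNIV. \<Sum>k\<in>UNIV. A $ m $ (I ! r) * (B $ k $ (I ! s) * S (I[r := m, s := k])))"
        by (rule sum.swap)
      finally show "(\<Sum>m\<in>UNIV. A $ m $ (I ! r) * (\<Sum>s<n. \<Sum>k\<in>UNIV. B $ k $ (I[r := m] ! s) * S (I[r := m, s := k])))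
        = (\<Sum>k\<in>UNIV. (B ** A) $ k $ (I ! r) * S (I[r := k]))
        + (\<Sum>s\<in>{..<n} - {r}. \<Sum>m\<in>UNIV. \<Sum>k\<in>UNIV. A $ m $ (I ! r) * (B $ k $ (I ! s) * S (I[r := m, s := k])))" .
    qed
    also have "\<dots> = act (B ** A) S I + X A B"
      by (simp add: sum.distrib act_def n_def X_def)
    finally show ?thesis .
  qed
  have "X A B = X B A"
  proof -
    have "X A B = (\<Sum>r<n. \<Sum>s<n. of_bool (r \<noteq> s) * (\<Sum>m\<in>UNIV. \<Sum>k\<in>UNIV. A $ m $ (I ! r) * (B $ k $ (I ! s) * S (I[r := m, s := k]))))" for A B
      unfolding X_def by (intro sum.cong[OF refl] sum.mono_neutral_cong_left) auto
    note X = this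
    show ?thesis
      unfolding X
    proof (rule trans[OF sum.swap], rule sum.cong[OF refl], rule sum.cong[OF refl])
      fix s r
      show "of_bool (r \<noteq> s) * (\<Sum>m\<in>UNIV. \<Sum>k\<in>UNIV. A $ m $ (I ! r) * (B $ k $ (I ! s) * S (I[r := m, s := k])))
          = of_bool (s \<noteq> r) * (\<Sum>m\<in>UNIV. \<Sum>k\<in>UNIV. B $ m $ (I ! s) * (A $ k $ (I ! r) * S (I[s := m, r := k])))"
      proof (cases "r = s")
        case False
        then have "I[s := m, r := k] = I[r := k, s := m]" for m k
          by (simp add: list_update_swap)
        then show ?thesis
          using False by (subst sum.swap) (simp add: mult_ac)
      qed simp
    qed
  qed
  then show ?thesis
    unfolding split act_diff by simp
qed

text \<open>\<open>act A\<close> on \<psi> has one term more than on the contraction, namely the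
  slot filled by \<open>W\<close>, where \<open>A\<close> is transferred to the vector.\<close>

lemma int_prod_act:
  "int_prod W (act A \<psi>) I = act A (int_prod W \<psi>) I + int_prod (A *v W) \<psi> I"
proof -
  have "act A \<psi> (i # I) = (\<Sum>m\<in>UNIV. A $ m $ i * \<psi> (m # I)) + (\<Sum>r<length I. \<Sum>m\<in>UNIV. A $ m $ (I ! r) * \<psi> (i # I[r := m]))" for i
    by (simp add: act_def sum.lessThan_Suc_shift del: sum.lessThan_Suc)
  then have "int_prod W (act A \<psi>) I = (\<Sum>i\<in>UNIV. \<Sum>m\<in>UNIV. W $ i * (A $ m $ i * \<psi> (m # I)))
      + (\<Sum>i\<in>UNIV. \<Sum>r<length I. \<Sum>m\<in>UNIV. W $ i * (A $ m $ (I ! r) * \<psi> (i # I[r := m])))"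
    by (simp add: int_prod_def distrib_left sum.distrib sum_distrib_left)
  also have "(\<Sum>i\<in>UNIV. \<Sum>m\<in>UNIV. W $ i * (A $ m $ i * \<psi> (m # I))) = int_prod (A *v W) \<psi> I"
    by (subst sum.swap) (simp add: int_prod_def matrix_vector_mult_def sum_distrib_left mult_ac)
  also have "(\<Sum>i\<in>UNIV. \<Sum>r<length I. \<Sum>m\<in>UNIV. W $ i * (A $ m $ (I ! r) * \<psi> (i # I[r := m]))) = act A (int_prod W \<psi>) I"
    by (subst sum_rotate3[symmetric]) (simp add: int_prod_def act_def sum_distrib_left mult_ac)
  finally show ?thesis by simp
qed

text \<open>With lowered index, the endomorphism whose action on \<open>\<phi>\<close> is the velocity of the flow. The factor
  \<open>1/3\<close> appears because \<open>X\<^sup>l\<phi>\<^sub>l\<^sub>i\<^sub>j\<close> acts on \<open>\<phi>\<close> as \<open>3 X \<lrcorner> \<psi>\<close>.\<close>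

definition flow_low :: "tensor \<Rightarrow> real^7^7 \<Rightarrow> real^7 \<Rightarrow> real^7^7" where
  "flow_low f h X = transpose h + (\<chi> i j. \<Sum>l\<in>UNIV. X $ l / 3 * f [l,i,j])"

definition flow_mat :: "tensor \<Rightarrow> real^7^7 \<Rightarrow> real^7 \<Rightarrow> real^7^7" where
  "flow_mat f h X = G2_inv_metric f ** flow_low f h X"

lemma flow_rhs_act:
  assumes f: "G2_form f"
  shows "flow_rhs f h X i j k = act (flow_mat f h X) f [i,j,k]"
proof -
  define N :: "real^7^7" where "N = (\<chi> i j. \<Sum>l\<in>UNIV. X $ l / 3 * f [l,i,j])"
  define S where "S = G2_inv_metric f ** N"
  have GS: "G2_metric f ** S = N"
    by (simp add: S_def matrix_mul_assoc G2_metric_inv(1)[OF f])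
  have n: "N $ j $ i = - N $ i $ j" for i j
  proof -
    have "f [l,j,i] = - f [l,i,j]" for l by (rule G2_form_swap(2)[OF f])
    then show ?thesis by (simp add: N_def sum_negf)
  qed
  have N: "transpose N = - N"
    unfolding vec_eq_iff transpose_def vec_lambda_beta vector_uminus_component by (intro allI n)
  have "transpose (G2_metric f ** S) = - (G2_metric f ** S)"
    unfolding GS by (rule N)
  then obtain V where V: "\<And>i j k. act S f [i,j,k] = int_prod V (G2_psi f) [i,j,k]"
    "\<And>q. (G2_metric f *v V) $ q = con2 (G2_inv_metric f) (\<lambda>i j. (G2_metric f ** S) $ i $ j) (\<lambda>a b. f [a,b,q]) / 2"
    using act_skew[OF f] by metis
  have sym: "G2_metric f $ i $ j = G2_metric f $ j $ i" for i j
    using arg_cong[OF transpose_G2_metric[OF f], of "\<lambda>M. M $ j $ i"] by (simp add: transpose_def)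
  have "(G2_metric f *v V) $ q = (G2_metric f *v X) $ q" for q
  proof -
    \<comment> \<open>With the factor 1/3, the 6 of \<open>con2_f_f\<close> and the half of
      \<open>act_skew\<close> the coefficient becomes 1, so \<open>V\<close> is \<open>X\<close>
      itself.\<close>
    have "(G2_metric f *v V) $ q = (\<Sum>l\<in>UNIV. X $ l / 3 * (6 * G2_metric f $ l $ q)) / 2"
      unfolding V(2) GS N_def vec_lambda_beta con2_sum_left con2_f_f[OF f] ..
    then show ?thesis
      by (simp add: matrix_vector_mult_def sum_divide_distrib sym[of q] mult_ac)
  qed
  then have "G2_metric f *v V = G2_metric f *v X"
    by (simp add: vec_eq_iff)
  then have "G2_inv_metric f *v (G2_metric f *v V) = G2_inv_metric f *v (G2_metric f *v X)"
    by simp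
  then have "V = X"
    by (simp add: matrix_vector_mul_assoc G2_metric_inv(2)[OF f])
  have "flow_mat f h X = G2_inv_metric f ** transpose h + S"
    by (simp add: flow_mat_def flow_low_def S_def N_def matrix_add_ldistrib)
  then have "act (flow_mat f h X) f [i,j,k] = act (G2_inv_metric f ** transpose h) f [i,j,k] + int_prod X (G2_psi f) [i,j,k]"
    using V(1) \<open>V = X\<close> by (simp add: act_add)
  also have "\<dots> = flow_rhs f h X i j k"
    by (simp add: flow_rhs_def act_3 int_prod_def raise_def matrix_matrix_mult_def transpose_def sum.distrib)
  finally show ?thesis ..
qed

section \<open>Joint regularity of algebraic functions of the family\<close>

lemma smooth_extension:
  assumes sm: "\<And>I. length I = 3 \<Longrightarrow> smooth_on (\<lambda>(t, y). \<phi> t c (chart_inv c y) I) (J \<times> U)"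
    and t: "t \<in> J" and y: "y \<in> (U :: (real^7) set)"
  obtains W and F :: "real \<times> (real^7) \<Rightarrow> tensor" where "open W" "(t, y) \<in> W" "\<And>I k. length I = 3 \<Longrightarrow> Ck_on k (\<lambda>z. F z I) W"
    "\<And>s z. s \<in> J \<Longrightarrow> z \<in> U \<Longrightarrow> (s, z) \<in> W \<Longrightarrow> F (s, z) = \<phi> s c (chart_inv c z)"
proof -
  have "\<forall>I\<in>{I. length I = 3}. \<exists>WF. open (fst WF) \<and> (t, y) \<in> fst WF \<and> (\<forall>k. Ck_on k (snd WF) (fst WF)) \<and>
      (\<forall>s\<in>J. \<forall>z\<in>U. (s, z) \<in> fst WF \<longrightarrow> snd WF (s, z) = \<phi> s c (chart_inv c z) I)"
  proof
    fix I :: "7 list" assume "I \<in> {I. length I = 3}"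
    then obtain W F where "open W" "(t, y) \<in> W" "\<forall>k. Ck_on k F W" "\<forall>w\<in>(J \<times> U) \<inter> W. F w = (case w of (t, y) \<Rightarrow> \<phi> t c (chart_inv c y) I)"
      using sm[of I] t y unfolding smooth_on_def by blast
    then show "\<exists>WF. open (fst WF) \<and> (t, y) \<in> fst WF \<and> (\<forall>k. Ck_on k (snd WF) (fst WF)) \<and>
      (\<forall>s\<in>J. \<forall>z\<in>U. (s, z) \<in> fst WF \<longrightarrow> snd WF (s, z) = \<phi> s c (chart_inv c z) I)"
      by (intro exI[of _ "(W, F)"]) auto
  qed
  from bchoice[OF this] obtain WF where WF: "\<And>I. length I = 3 \<Longrightarrow> open (fst (WF I)) \<and> (t, y) \<in> fst (WF I) \<and> (\<forall>k. Ck_on k (snd (WF I)) (fst (WF I))) \<and>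
      (\<forall>s\<in>J. \<forall>z\<in>U. (s, z) \<in> fst (WF I) \<longrightarrow> snd (WF I) (s, z) = \<phi> s c (chart_inv c z) I)"
    by auto
  \<comment> \<open>Each component extends on its own neighbourhood; there are finitely many
    components, so the intersection is still open.\<close>
  define W where "W = (\<Inter>I\<in>{I. length I = 3}. fst (WF I))"
  \<comment> \<open>On lists of other lengths \<open>F\<close> copies the family, so the two agree
    as tensors and can be exchanged inside \<Psi>.\<close>
  define F where "F z I = (if length I = 3 then snd (WF I) z else \<phi> (fst z) c (chart_inv c (snd z)) I)" for z I
  show ?thesis
  proof (rule that[of W F])
    show "open W" unfolding W_def using WF by (intro open_INT) (auto simp: finite_length_eq)
    show "(t, y) \<in> W" unfolding W_def using WF by blast
    show "Ck_on k (\<lambda>z. F z I) W" if "length I = 3" for I k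
    proof -
      have "W \<subseteq> fst (WF I)" using that by (auto simp: W_def)
      moreover have "Ck_on k (snd (WF I)) (fst (WF I))" using WF[OF that] by blast
      ultimately have "Ck_on k (snd (WF I)) W" by (rule Ck_on_subset[rotated])
      then show ?thesis using that by (simp add: F_def)
    qed
    show "F (s, z) = \<phi> s c (chart_inv c z)" if sz: "s \<in> J" "z \<in> U" "(s, z) \<in> W" for s z
    proof
      fix I
      show "F (s, z) I = \<phi> s c (chart_inv c z) I"
      proof (cases "length I = 3")
        case True
        then have "(s, z) \<in> fst (WF I)" using sz by (auto simp: W_def)
        then show ?thesis using WF[OF True] sz True by (simp add: F_def)
      qed (simp add: F_def)
    qed
  qed
qed

context
  fixes \<phi> :: "real \<Rightarrow> 'a chart \<Rightarrow> 'a \<Rightarrow> tensor" and c and J :: "real set" and U :: "(real^7) set" and t y \<Psi> and g :: "real \<Rightarrow> real^7 \<Rightarrow> real"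
  assumes sm: "\<And>I. length I = 3 \<Longrightarrow> smooth_on (\<lambda>(t, y). \<phi> t c (chart_inv c y) I) (J \<times> U)"
    and J: "is_interval J" "interior J \<noteq> {}" and t: "t \<in> J" and U: "open U" and y: "y \<in> U"
    and \<Psi>: "alg (\<phi> t c (chart_inv c y)) \<Psi>"
    and g: "\<And>s z. s \<in> J \<Longrightarrow> z \<in> U \<Longrightarrow> g s z = \<Psi> (\<phi> s c (chart_inv c z))"
begin

lemma alg_family_extension:
  obtains W u where "open W" "(t, y) \<in> W" "Ck_on 2 u W"
    "\<And>s z. s \<in> J \<Longrightarrow> z \<in> U \<Longrightarrow> (s, z) \<in> W \<Longrightarrow> g s z = u (s, z)"
proof -
  obtain W F where W: "open W" "(t, y) \<in> W" and F: "\<And>I k. length I = 3 \<Longrightarrow> Ck_on k (\<lambda>z. F z I) W"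
    "\<And>s z. s \<in> J \<Longrightarrow> z \<in> U \<Longrightarrow> (s, z) \<in> W \<Longrightarrow> F (s, z) = \<phi> s c (chart_inv c z)"
    using smooth_extension[of \<phi> c J U t y, OF sm t y] by blast
  have "alg (F (t, y)) \<Psi>" using \<Psi> F(2)[OF t y W(2)] by simp
  from alg_Ck[OF this W F(1)] obtain W' where "open W'" "(t, y) \<in> W'" "W' \<subseteq> W" "Ck_on 2 (\<lambda>w. \<Psi> (F w)) W'"
    by blast
  then show ?thesis
    using F(2) g by (intro that[of W' "\<lambda>w. \<Psi> (F w)"]) auto
qed

lemma alg_family_differentiable: "g t differentiable (at y)"
proof -
  obtain W u where W: "open W" "(t, y) \<in> W" "Ck_on 2 u W"
    "\<And>s z. s \<in> J \<Longrightarrow> z \<in> U \<Longrightarrow> (s, z) \<in> W \<Longrightarrow> g s z = u (s, z)"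
    using alg_family_extension by blast
  from spatial_derivative[OF J t U y W t W(2)] show ?thesis
    by (auto simp: differentiable_def)
qed

lemma alg_family_time_spatial:
  assumes "\<And>z. z \<in> U \<Longrightarrow> ((\<lambda>s. g s z) has_real_derivative g' z) (at t within J)"
  shows "g' differentiable (at y)"
    "((\<lambda>s. frechet_derivative (g s) (at y) (axis k 1)) has_real_derivative frechet_derivative g' (at y) (axis k 1)) (at t within J)"
proof -
  obtain W u where W: "open W" "(t, y) \<in> W" "Ck_on 2 u W"
    "\<And>s z. s \<in> J \<Longrightarrow> z \<in> U \<Longrightarrow> (s, z) \<in> W \<Longrightarrow> g s z = u (s, z)"
    using alg_family_extension by blast
  from time_spatial_derivative[OF J t U y W assms]
  show "g' differentiable (at y)"
    "((\<lambda>s. frechet_derivative (g s) (at y) (axis k 1)) has_real_derivative frechet_derivative g' (at y) (axis k 1)) (at t within J)"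
    by auto
qed

end

section \<open>Pointwise algebra of the torsion rate\<close>

lemma act_tensor2_matrix: "act A (tensor2 S) [i,j] = (transpose A ** S + S ** A) $ i $ j"
  by (simp add: act_tensor2 matrix_matrix_mult_def transpose_def mult.commute)

lemma con2_add: "con2 H (\<lambda>i j. \<beta> i j + \<beta>' i j) \<gamma> = con2 H \<beta> \<gamma> + con2 H \<beta>' \<gamma>"
  by (simp add: con2_def distrib_right sum.distrib)

lemma con2_minus: "con2 H (\<lambda>i j. - \<beta> i j) \<gamma> = - con2 H \<beta> \<gamma>" "con2 H \<beta> (\<lambda>i j. - \<gamma> i j) = - con2 H \<beta> \<gamma>"
  by (simp_all add: con2_def sum_negf)

lemma con2_swap: "con2 H (\<lambda>i j. \<beta> j i) \<gamma> = con2 H \<beta> (\<lambda>a b. \<gamma> b a)"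
  unfolding con2_def
  by (rule trans[OF sum.swap], rule sum.cong[OF refl], rule sum.cong[OF refl],
      rule trans[OF sum.swap], rule sum.cong[OF refl], rule sum.cong[OF refl]) (simp add: mult_ac)

lemma G2_metric_sym: "G2_form f \<Longrightarrow> G2_metric f $ i $ j = G2_metric f $ j $ i"
  using arg_cong[OF transpose_G2_metric[of f], of "\<lambda>M. M $ j $ i"] by (simp add: transpose_def)

lemma G2_inv_metric_sym:
  assumes f: "G2_form f"
  shows "G2_inv_metric f $ i $ j = G2_inv_metric f $ j $ i"
proof -
  have "transpose (G2_inv_metric f) ** G2_metric f = transpose (G2_metric f ** G2_inv_metric f)"
    by (simp add: matrix_transpose_mul transpose_G2_metric[OF f])
  also have "\<dots> = mat 1" by (simp add: G2_metric_inv(1)[OF f] transpose_mat)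
  finally have "transpose (G2_inv_metric f) ** (G2_metric f ** G2_inv_metric f) = G2_inv_metric f"
    by (simp add: matrix_mul_assoc)
  then have t: "transpose (G2_inv_metric f) = G2_inv_metric f"
    by (simp add: G2_metric_inv(1)[OF f])
  show ?thesis
    using arg_cong[OF t, of "\<lambda>M. M $ j $ i"] by (simp add: transpose_def)
qed

text \<open>The pointwise algebra of the theorem: \<open>A\<close> generates the flow, \<open>\<Gamma>\<close> and \<open>W\<close> give the connection and the
  torsion, primes are time derivatives. By \<open>e1\<close> the endomorphism in \<open>e1\<close>, \<open>e2\<close> is skew, so \<open>W'\<close> is
  given by its contraction with \<open>\<phi>\<close>. Vanishing of its symmetric part expresses \<open>\<Gamma>'\<close>,
  which is symmetric in its lower indices, in terms of \<open>\<nabla>h\<close> by the Christoffel argument.\<close>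

lemma torsion_rate:
  fixes f :: tensor and h :: "real^7^7" and X :: "real^7"
    and \<Gamma> \<Gamma>' dA C :: "7 \<Rightarrow> real^7^7" and W W' Y :: "7 \<Rightarrow> real^7" and Hn :: "7 \<Rightarrow> 7 \<Rightarrow> 7 \<Rightarrow> real"
  defines "G \<equiv> G2_metric f" and "H \<equiv> G2_inv_metric f" and "A \<equiv> flow_mat f h X"
  assumes f: "G2_form f" and h: "transpose h = h"
    and \<Gamma>': "\<And>k m i. \<Gamma>' k $ m $ i = \<Gamma>' i $ m $ k"
    and Hn: "\<And>k i j. Hn k i j = Hn k j i"
    and C: "\<And>k. G ** (dA k + \<Gamma> k ** A - A ** \<Gamma> k) = C k"
    and C_eq: "\<And>k i j. C k $ i $ j = Hn k i j + (\<Sum>l\<in>UNIV. Y k $ l / 3 * f [l,i,j])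
        + (\<Sum>l\<in>UNIV. X $ l / 3 * int_prod (W k) (G2_psi f) [l,i,j])"
    and e1: "\<And>k i j. act (dA k + \<Gamma> k ** A - A ** \<Gamma> k - \<Gamma>' k) (tensor2 G) [i,j] = 0"
    and e2: "\<And>k i j l. act (dA k + \<Gamma> k ** A - A ** \<Gamma> k - \<Gamma>' k) f [i,j,l] = int_prod (W' k + A *v W k) (G2_psi f) [i,j,l]"
  shows "(transpose A *v (G *v W p) + G *v (W' p + A *v W p)) $ q =
      (\<Sum>l\<in>UNIV. \<Sum>m\<in>UNIV. (G *v W p) $ l * H $ l $ m * h $ m $ q)
    + (\<Sum>l\<in>UNIV. \<Sum>m\<in>UNIV. (G *v W p) $ l * H $ l $ m * (\<Sum>k\<in>UNIV. X $ k * f [k,m,q]))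
    + (\<Sum>k\<in>UNIV. \<Sum>i\<in>UNIV. \<Sum>a\<in>UNIV. \<Sum>b\<in>UNIV. Hn k i p * H $ k $ a * H $ i $ b * f [a,b,q])
    + (G *v Y p) $ q"
proof -
  define D where "D k = dA k + \<Gamma> k ** A - A ** \<Gamma> k - \<Gamma>' k" for k
  have GD: "G ** D k = C k - G ** \<Gamma>' k" for k
    unfolding D_def C[symmetric] by (simp add: vec_eq_iff matrix_matrix_mult_def right_diff_distrib sum_subtractf)
  have Gs: "G $ i $ j = G $ j $ i" for i j
    unfolding G_def by (rule G2_metric_sym[OF f])
  have skew: "(G ** D k) $ i $ j + (G ** D k) $ j $ i = 0" for k i j
    using e1[of k i j] unfolding D_def[symmetric] act_tensor2
    by (simp add: matrix_matrix_mult_def Gs[of _ j] mult.commute add.commute)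
  define N where "N i k j = (G ** \<Gamma>' k) $ i $ j" for i k j
  have f0: "f [l,i,j] + f [l,j,i] = 0" for l i j
    using G2_form_swap(2)[OF f, of l i j] by simp
  have \<psi>0: "int_prod V (G2_psi f) [l,i,j] + int_prod V (G2_psi f) [l,j,i] = 0" for V l i j
  proof -
    obtain L where L: "\<And>J. length J = 4 \<Longrightarrow> G2_psi f J = pullback L psi_tensor J"
      by (rule G2_frame[OF f]) blast
    have "G2_psi f [n,l,j,i] = - G2_psi f [n,l,i,j]" for n
    proof -
      have "pullback L psi_tensor [n,l,j,i] = - pullback L psi_tensor [n,l,i,j]"
        unfolding pullback_4 sum_negf[symmetric]
        by (rule sum.cong[OF refl], rule sum.cong[OF refl], rule trans[OF sum.swap], intro sum.cong[OF refl])
          (simp add: psi_tensor_def, subst psi0_swap34, simp add: mult_ac)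
      then show ?thesis by (simp add: L)
    qed
    then show ?thesis by (simp add: int_prod_def sum_negf)
  qed
  \<comment> \<open>The terms from \<open>X\<close> are skew in the last two indices, so only the
    derivative of \<open>h\<close> survives symmetrisation.\<close>
  have sumC: "C k $ i $ j + C k $ j $ i = 2 * Hn k i j" for k i j
  proof -
    have "C k $ i $ j + C k $ j $ i = 2 * Hn k i j + (\<Sum>l\<in>UNIV. Y k $ l / 3 * (f [l,i,j] + f [l,j,i]))
        + (\<Sum>l\<in>UNIV. X $ l / 3 * (int_prod (W k) (G2_psi f) [l,i,j] + int_prod (W k) (G2_psi f) [l,j,i]))"
      unfolding C_eq using Hn[of k i j] by (simp only: distrib_left sum.distrib)
    then show ?thesis by (simp add: f0 \<psi>0)
  qed
  \<comment> \<open>\<open>N\<close> is \<Gamma>' with its upper index lowered. Since the metric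
    moves with velocity 2h, it is the Christoffel expression of 2h.\<close>
  have N_eq: "N i k j = Hn k i j + Hn j i k - Hn i k j" for i k j
  proof -
    have "2 * N i k j = 2 * Hn k i j + 2 * Hn j i k - 2 * Hn i k j"
    proof (rule lowered_symbols_unique)
      show "N i k j = N i j k" for i k j
        unfolding N_def matrix_matrix_mult_def by (simp add: \<Gamma>'[of j _ k])
      show "N i k j + N j k i = 2 * Hn k i j" for k i j
        using skew[of k i j] sumC[of k i j] unfolding GD N_def by simp
    qed
    then show ?thesis by simp
  qed
  \<comment> \<open>The derivative of \<open>h\<close> in direction \<open>p\<close> cancels between
    \<open>C\<close> and \<Gamma>', leaving an antisymmetrised derivative in \<open>i\<close>,
    \<open>j\<close>.\<close>
  have GD_eq: "(G ** D p) $ i $ j = (Hn i j p + - Hn j i p) + ((\<Sum>l\<in>UNIV. Y p $ l / 3 * f [l,i,j])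
        + (\<Sum>l\<in>UNIV. X $ l / 3 * int_prod (W p) (G2_psi f) [l,i,j]))" for i j
    unfolding GD using N_eq[of i p j, unfolded N_def] C_eq[of p i j] Hn[of i p j] by simp
  have fs: "(\<lambda>a b. f [b,a,q]) = (\<lambda>a b. - f [a,b,q])"
    by (intro ext, rule G2_form_swap(1)[OF f])
  \<comment> \<open>The antisymmetrised term doubles because \<open>f\<close> is skew; the other
    constants are 6/3 from \<open>con2_f_f\<close> and -4/3 from \<open>con2_psi_f\<close>.\<close>
  have con: "con2 H (\<lambda>i j. (G ** D p) $ i $ j) (\<lambda>a b. f [a,b,q]) =
      2 * con2 H (\<lambda>i j. Hn i j p) (\<lambda>a b. f [a,b,q]) + 2 * (\<Sum>l\<in>UNIV. Y p $ l * G $ l $ q)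
      - 4 / 3 * (\<Sum>l\<in>UNIV. \<Sum>n\<in>UNIV. X $ l * W p $ n * f [n,l,q])"
  proof -
    have "con2 H (\<lambda>i j. Hn j i p) (\<lambda>a b. f [a,b,q]) = - con2 H (\<lambda>i j. Hn i j p) (\<lambda>a b. f [a,b,q])"
      using con2_swap[of H "\<lambda>i j. Hn i j p" "\<lambda>a b. f [a,b,q]"] unfolding fs con2_minus .
    moreover have "con2 H (\<lambda>i j. \<Sum>l\<in>UNIV. Y p $ l / 3 * f [l,i,j]) (\<lambda>a b. f [a,b,q]) = 2 * (\<Sum>l\<in>UNIV. Y p $ l * G $ l $ q)"
      unfolding con2_sum_left H_def con2_f_f[OF f] G_def by (simp add: sum_distrib_left mult_ac)
    moreover have "con2 H (\<lambda>i j. \<Sum>l\<in>UNIV. X $ l / 3 * int_prod (W p) (G2_psi f) [l,i,j]) (\<lambda>a b. f [a,b,q])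
       = - 4 / 3 * (\<Sum>l\<in>UNIV. \<Sum>n\<in>UNIV. X $ l * W p $ n * f [n,l,q])"
      unfolding con2_sum_left int_prod_def H_def con2_psi_f[OF f] by (simp add: sum_distrib_left sum_negf mult_ac)
    ultimately show ?thesis
      unfolding GD_eq con2_add con2_minus by simp
  qed
  have V: "(G *v (W' p + A *v W p)) $ q = con2 H (\<lambda>i j. (G ** D p) $ i $ j) (\<lambda>a b. f [a,b,q]) / 2"
  proof -
    have "transpose (G2_metric f ** D p) = - (G2_metric f ** D p)"
      using skew[of p, unfolded G_def] by (simp add: vec_eq_iff transpose_def eq_neg_iff_add_eq_0)
    then obtain V where V: "\<And>i j k. act (D p) f [i,j,k] = int_prod V (G2_psi f) [i,j,k]"
      "\<And>q. (G2_metric f *v V) $ q = con2 (G2_inv_metric f) (\<lambda>i j. (G2_metric f ** D p) $ i $ j) (\<lambda>a b. f [a,b,q]) / 2"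
      using act_skew[OF f] by metis
    have "V = W' p + A *v W p"
      using V(1) e2[of p, folded D_def] by (intro int_prod_psi_inj[OF f]) simp
    then show ?thesis using V(2) by (simp add: G_def H_def)
  qed
  have T: "(transpose A *v (G *v W p)) $ q = (\<Sum>l\<in>UNIV. \<Sum>m\<in>UNIV. (G *v W p) $ l * H $ l $ m * h $ m $ q)
    + (\<Sum>l\<in>UNIV. \<Sum>m\<in>UNIV. (G *v W p) $ l * H $ l $ m * (\<Sum>k\<in>UNIV. X $ k * f [k,m,q])) / 3"
  proof -
    have "A $ l $ q = (\<Sum>m\<in>UNIV. H $ l $ m * (h $ m $ q + (\<Sum>k\<in>UNIV. X $ k * f [k,m,q]) / 3))" for l
      by (simp add: A_def flow_mat_def flow_low_def h matrix_matrix_mult_def H_def sum_divide_distrib)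
    moreover have "(transpose A *v v) $ q = (\<Sum>l\<in>UNIV. A $ l $ q * v $ l)" for v
      by (simp add: matrix_vector_mult_def transpose_def)
    ultimately show ?thesis
      by (simp add: sum_distrib_left sum_distrib_right distrib_left sum.distrib sum_divide_distrib mult_ac)
  qed
  have HW: "(\<Sum>l\<in>UNIV. (G *v W p) $ l * H $ l $ m) = W p $ m" for m
  proof -
    have "(\<Sum>l\<in>UNIV. (G *v W p) $ l * H $ l $ m) = (H *v (G *v W p)) $ m"
      by (simp add: matrix_vector_mult_def[of H] G2_inv_metric_sym[OF f, of _ m, folded H_def] mult.commute)
    then show ?thesis
      by (simp add: matrix_vector_mul_assoc H_def G_def G2_metric_inv(2)[OF f])
  qed
  have XW: "(\<Sum>l\<in>UNIV. \<Sum>n\<in>UNIV. X $ l * W p $ n * f [n,l,q])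
      = - (\<Sum>l\<in>UNIV. \<Sum>m\<in>UNIV. (G *v W p) $ l * H $ l $ m * (\<Sum>k\<in>UNIV. X $ k * f [k,m,q]))"
  proof -
    have "(\<Sum>l\<in>UNIV. \<Sum>m\<in>UNIV. (G *v W p) $ l * H $ l $ m * (\<Sum>k\<in>UNIV. X $ k * f [k,m,q]))
        = (\<Sum>m\<in>UNIV. (\<Sum>l\<in>UNIV. (G *v W p) $ l * H $ l $ m) * (\<Sum>k\<in>UNIV. X $ k * f [k,m,q]))"
      unfolding sum_distrib_right by (rule sum.swap)
    also have "\<dots> = (\<Sum>m\<in>UNIV. \<Sum>k\<in>UNIV. X $ k * W p $ m * f [k,m,q])"
      unfolding HW by (simp add: sum_distrib_left mult_ac)
    also have "\<dots> = (\<Sum>k\<in>UNIV. \<Sum>m\<in>UNIV. X $ k * W p $ m * f [k,m,q])"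
      by (rule sum.swap)
    also have "\<dots> = - (\<Sum>l\<in>UNIV. \<Sum>n\<in>UNIV. X $ l * W p $ n * f [n,l,q])"
    proof -
      have "f [k,m,q] = - f [m,k,q]" for k m by (rule G2_form_swap(1)[OF f])
      then have "X $ k * W p $ m * f [k,m,q] = - (X $ k * W p $ m * f [m,k,q])" for k m
        by (metis mult_minus_right)
      then show ?thesis by (simp only: sum_negf)
    qed
    finally show ?thesis by simp
  qed
  have Y: "(\<Sum>l\<in>UNIV. Y p $ l * G $ l $ q) = (G *v Y p) $ q"
    by (simp add: matrix_vector_mult_def Gs[of q] mult.commute)
  \<comment> \<open>One third of the term in \<open>X\<close> comes from the rate of the metric,
    through \<open>transpose A\<close>; the other two thirds come from the torsion inside the
    derivative of \<phi>.\<close>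
  have "a + b / 3 + (2 * c + 2 * y - 4 / 3 * - b) / 2 = a + b + c + y" for a b c y :: real
    by (simp add: field_simps)
  then show ?thesis
    unfolding vector_add_component T V con XW Y con2_def[of H "\<lambda>i j. Hn i j p"] .
qed

section \<open>Differentiating the torsion along the flow\<close>

text \<open>Separates existence of a time derivative from its value: the rates of \<Gamma> and
  \<open>W\<close> are first only known to exist and are then characterised by equations.\<close>

definition has_deriv :: "real filter \<Rightarrow> (real \<Rightarrow> real) \<Rightarrow> bool" where
  "has_deriv F g \<longleftrightarrow> (\<exists>D. (g has_real_derivative D) F)"

lemma has_derivI: "(g has_real_derivative D) F \<Longrightarrow> has_deriv F g"
  by (auto simp: has_deriv_def)

lemma has_deriv_const: "has_deriv (at t within J) (\<lambda>s. a)"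
  by (rule has_derivI) (rule DERIV_const)

lemma has_deriv_add: "has_deriv (at t within J) f \<Longrightarrow> has_deriv (at t within J) g \<Longrightarrow> has_deriv (at t within J) (\<lambda>s. f s + g s)"
  by (auto simp: has_deriv_def intro: DERIV_add)

lemma has_deriv_diff: "has_deriv (at t within J) f \<Longrightarrow> has_deriv (at t within J) g \<Longrightarrow> has_deriv (at t within J) (\<lambda>s. f s - g s)"
  by (auto simp: has_deriv_def intro: DERIV_diff)

lemma has_deriv_minus: "has_deriv (at t within J) f \<Longrightarrow> has_deriv (at t within J) (\<lambda>s. - f s)"
  by (auto simp: has_deriv_def intro: DERIV_minus)

lemma has_deriv_mult: "has_deriv (at t within J) f \<Longrightarrow> has_deriv (at t within J) g \<Longrightarrow> has_deriv (at t within J) (\<lambda>s. f s * g s)"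
  by (auto simp: has_deriv_def intro: DERIV_mult)

lemma has_deriv_cdivide: "has_deriv (at t within J) f \<Longrightarrow> has_deriv (at t within J) (\<lambda>s. f s / a)"
  by (auto simp: has_deriv_def intro: DERIV_cdivide)

lemma has_deriv_sum: "(\<And>i. i \<in> I \<Longrightarrow> has_deriv (at t within J) (f i)) \<Longrightarrow> has_deriv (at t within J) (\<lambda>s. \<Sum>i\<in>I. f i s)"
  by (induction I rule: infinite_finite_induct) (auto intro: has_deriv_const has_deriv_add)

lemmas has_deriv_intros = has_deriv_const has_deriv_add has_deriv_diff has_deriv_minus has_deriv_mult has_deriv_cdivide has_deriv_sum

lemma has_deriv_cong_on:
  assumes "t \<in> J" "\<And>s. s \<in> J \<Longrightarrow> f s = g s" "has_deriv (at t within J) g"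
  shows "has_deriv (at t within J) f"
  using assms has_field_derivative_transform_within[OF _ zero_less_one assms(1), of g _ f] by (auto simp: has_deriv_def)

lemma smooth_on_differentiable:
  assumes "open U" "y \<in> U" "smooth_on f U"
  shows "f differentiable (at y)"
proof -
  obtain W F where W: "open W" "y \<in> W" "\<forall>k. Ck_on k F W" "\<forall>z\<in>U \<inter> W. F z = f z"
    using assms by (auto simp: smooth_on_def)
  then have "(F has_derivative frechet_derivative F (at y)) (at y)"
    using Ck_on_has_derivative by blast
  then have "(f has_derivative frechet_derivative F (at y)) (at y)"
    by (rule has_derivative_transform_within_open[of _ _ _ _ "U \<inter> W"]) (use W assms in auto)
  then show ?thesis by (auto simp: differentiable_def)
qed

lemma differentiable_vec_nth:
  "f differentiable (at y) \<Longrightarrow> (\<lambda>z. f z $ i) differentiable (at y)"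
  by (auto simp: differentiable_def intro: bounded_linear.has_derivative[OF bounded_linear_vec_nth])

lemma length_2_cases: "length K = 2 \<Longrightarrow> \<exists>a b. K = [a,b]"
  by (auto simp: numeral_eq_Suc length_Suc_conv)

lemma length_3_cases: "length K = 3 \<Longrightarrow> \<exists>a b c. K = [a,b,c]"
  by (auto simp: numeral_eq_Suc length_Suc_conv)

text \<open>One chart, one point and one time, with \<open>h\<close> and \<open>X\<close> the fields
  at that time. The flow equation is taken on the whole chart domain because it is differentiated in
  space.\<close>

locale G2_flow =
  fixes M :: "'a topology" and c :: "'a chart" and x :: 'a and J :: "real set"
    and \<phi> :: "real \<Rightarrow> 'a chart \<Rightarrow> 'a \<Rightarrow> tensor"
    and h :: "'a \<Rightarrow> real^7^7" and X :: "'a \<Rightarrow> real^7" and t :: real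
  assumes chart: "chart_on M c" and x: "x \<in> chart_dom c"
    and J: "is_interval J" "interior J \<noteq> {}" and t: "t \<in> J"
    and sm: "\<And>I. length I = 3 \<Longrightarrow> smooth_on (\<lambda>(t, y). \<phi> t c (chart_inv c y) I) (J \<times> chart_image c)"
    and G2: "\<And>s q. s \<in> J \<Longrightarrow> q \<in> chart_dom c \<Longrightarrow> G2_form (\<phi> s c q)"
    and h_smooth: "smooth_on (\<lambda>y. h (chart_inv c y)) (chart_image c)"
    and h_sym: "\<And>q. q \<in> chart_dom c \<Longrightarrow> transpose (h q) = h q"
    and X_smooth: "smooth_on (\<lambda>y. X (chart_inv c y)) (chart_image c)"
    and flow: "\<And>q i j k. q \<in> chart_dom c \<Longrightarrow>
      ((\<lambda>s. \<phi> s c q [i, j, k]) has_real_derivative flow_rhs (\<phi> t c q) (h q) (X q) i j k) (at t within J)"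
begin

abbreviation "y \<equiv> chart_map c x"
abbreviation "U \<equiv> chart_image c"

lemmas chart_facts = chart_on_facts[OF chart]

lemma y_in_image: "y \<in> U"
  using chart_facts(2) x by blast

lemma inv_y: "chart_inv c y = x"
  using chart_facts(3) x by blast

definition A :: "'a \<Rightarrow> real^7^7" where
  "A q = flow_mat (\<phi> t c q) (h q) (X q)"

lemma phi_dt:
  assumes "q \<in> chart_dom c" "length I = 3"
  shows "((\<lambda>s. \<phi> s c q I) has_real_derivative act (A q) (\<phi> t c q) I) (at t within J)"
proof -
  obtain i j k where "I = [i,j,k]" using length_3_cases[OF assms(2)] by blast
  then show ?thesis
    using flow[OF assms(1), of i j k] flow_rhs_act[OF G2[OF t assms(1)]] by (simp add: A_def)
qed

lemma metric_dt:
  "q \<in> chart_dom c \<Longrightarrow> ((\<lambda>s. G2_metric (\<phi> s c q) $ i $ j) has_real_derivative act (A q) (tensor2 (G2_metric (\<phi> t c q))) [i,j]) (at t within J)"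
  by (rule G2_derivative(1)[OF t]) (auto intro: G2 phi_dt)

lemma psi_dt:
  "length K = 4 \<Longrightarrow> ((\<lambda>s. G2_psi (\<phi> s c x) K) has_real_derivative act (A x) (G2_psi (\<phi> t c x)) K) (at t within J)"
  by (rule G2_derivative(2)[OF t]) (auto intro: G2 phi_dt x)

lemma inv_metric_dt: "has_deriv (at t within J) (\<lambda>s. G2_inv_metric (\<phi> s c x) $ i $ j)"
  unfolding has_deriv_def by (rule G2_derivative(3)[OF t]) (auto intro: G2 phi_dt x)

lemma family_dx:
  assumes "s \<in> J" "alg (\<phi> s c (chart_inv c y)) \<Psi>" "\<And>s z. s \<in> J \<Longrightarrow> z \<in> U \<Longrightarrow> g s z = \<Psi> (\<phi> s c (chart_inv c z))"
  shows "g s differentiable (at y)"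
  by (rule alg_family_differentiable[where \<phi> = \<phi> and c = c and J = J and U = U and \<Psi> = \<Psi>])
    (rule sm J assms chart_facts(1) y_in_image; assumption)+

lemma family_dt:
  assumes "alg (\<phi> t c (chart_inv c y)) \<Psi>" "\<And>s z. s \<in> J \<Longrightarrow> z \<in> U \<Longrightarrow> g s z = \<Psi> (\<phi> s c (chart_inv c z))"
    and "\<And>z. z \<in> U \<Longrightarrow> ((\<lambda>s. g s z) has_real_derivative g' z) (at t within J)"
  shows "g' differentiable (at y)"
    "((\<lambda>s. frechet_derivative (g s) (at y) (axis k 1)) has_real_derivative frechet_derivative g' (at y) (axis k 1)) (at t within J)"
  by ((rule alg_family_time_spatial[where \<phi> = \<phi> and c = c and J = J and U = U and \<Psi> = \<Psi>];
    (rule sm J t assms chart_facts(1) y_in_image; assumption)))+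

lemma G2_chart_inv: "s \<in> J \<Longrightarrow> z \<in> U \<Longrightarrow> G2_form (\<phi> s c (chart_inv c z))"
  using G2 chart_facts(4) by blast

lemma phi_dx:
  assumes s: "s \<in> J" and I: "length I = 3"
  shows "(\<lambda>z. \<phi> s c (chart_inv c z) I) differentiable (at y)"
  by (rule family_dx[where g = "\<lambda>s z. \<phi> s c (chart_inv c z) I" and \<Psi> = "\<lambda>f. f I"]) (simp_all add: s I alg_component)

lemma metric_dx:
  assumes s: "s \<in> J"
  shows "(\<lambda>z. G2_metric (\<phi> s c (chart_inv c z)) $ i $ j) differentiable (at y)"
  by (rule family_dx[where g = "\<lambda>s z. G2_metric (\<phi> s c (chart_inv c z)) $ i $ j", OF s alg_metric[OF G2_chart_inv[OF s y_in_image]]])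
    (simp add: G2_form_explicit(2)[OF G2_chart_inv])

lemma inv_metric_dx:
  assumes s: "s \<in> J"
  shows "(\<lambda>z. G2_inv_metric (\<phi> s c (chart_inv c z)) $ i $ j) differentiable (at y)"
  by (rule family_dx[where g = "\<lambda>s z. G2_inv_metric (\<phi> s c (chart_inv c z)) $ i $ j", OF s alg_inv_metric[OF G2_chart_inv[OF s y_in_image]]])
    (simp add: G2_form_explicit(3)[OF G2_chart_inv])

lemma partial_phi_dt:
  assumes "length I = 3"
  shows "((\<lambda>s. partial_deriv c k (\<lambda>q. \<phi> s c q I) x) has_real_derivative partial_deriv c k (\<lambda>q. act (A q) (\<phi> t c q) I) x) (at t within J)"
  unfolding partial_deriv_def comp_def
  by (rule family_dt(2)[where g = "\<lambda>s z. \<phi> s c (chart_inv c z) I" and \<Psi> = "\<lambda>f. f I"])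
    (simp_all add: assms alg_component phi_dt chart_facts(4))

lemma partial_metric_dt:
  "((\<lambda>s. partial_deriv c k (\<lambda>q. G2_metric (\<phi> s c q) $ i $ j) x) has_real_derivative
     partial_deriv c k (\<lambda>q. act (A q) (tensor2 (G2_metric (\<phi> t c q))) [i,j]) x) (at t within J)"
  unfolding partial_deriv_def comp_def
  by (rule family_dt(2)[where g = "\<lambda>s z. G2_metric (\<phi> s c (chart_inv c z)) $ i $ j", OF alg_metric[OF G2_chart_inv[OF t y_in_image]]])
    (simp_all add: G2_form_explicit(2)[OF G2_chart_inv] metric_dt chart_facts(4))

definition dx :: "('a \<Rightarrow> real) \<Rightarrow> bool" where
  "dx u \<longleftrightarrow> (\<lambda>z. u (chart_inv c z)) differentiable (at y)"

abbreviation "pd k u \<equiv> partial_deriv c k u x"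

lemmas pd_curve = partial_deriv_curve[OF chart x, folded dx_def]
lemmas pd_eqI = partial_deriv_eqI[OF chart x, folded dx_def]

lemma dx_sum_mult:
  assumes "\<And>m. dx (\<lambda>q. u q m)" "\<And>m. dx (\<lambda>q. v q m)"
  shows "dx (\<lambda>q. \<Sum>m\<in>(UNIV::7 set). u q m * v q m)"
  using assms unfolding dx_def by (intro differentiable_sum differentiable_mult ballI) auto

lemma pd_sum_mult:
  assumes "\<And>m. dx (\<lambda>q. u q m)" "\<And>m. dx (\<lambda>q. v q m)"
  shows "pd k (\<lambda>q. \<Sum>m\<in>(UNIV::7 set). u q m * v q m) = (\<Sum>m\<in>UNIV. pd k (\<lambda>q. u q m) * v x m + u x m * pd k (\<lambda>q. v q m))"
proof (rule pd_eqI)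
  show "dx (\<lambda>q. \<Sum>m\<in>(UNIV::7 set). u q m * v q m)"
    by (rule dx_sum_mult) (rule assms)+
  show "((\<lambda>\<sigma>. \<Sum>m\<in>(UNIV::7 set). u (chart_inv c (y + \<sigma> *\<^sub>R axis k 1)) m * v (chart_inv c (y + \<sigma> *\<^sub>R axis k 1)) m)
      has_real_derivative (\<Sum>m\<in>UNIV. pd k (\<lambda>q. u q m) * v x m + u x m * pd k (\<lambda>q. v q m))) (at 0)"
  proof (rule DERIV_sum)
    fix m :: 7
    show "((\<lambda>\<sigma>. u (chart_inv c (y + \<sigma> *\<^sub>R axis k 1)) m * v (chart_inv c (y + \<sigma> *\<^sub>R axis k 1)) m)
      has_real_derivative pd k (\<lambda>q. u q m) * v x m + u x m * pd k (\<lambda>q. v q m)) (at 0)"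
      using DERIV_mult[OF pd_curve[OF assms(1)[of m]] pd_curve[OF assms(2)[of m]], of k k]
      by (simp add: inv_y mult.commute)
  qed
qed

lemma pd_act:
  assumes "\<And>m i. dx (\<lambda>q. B q $ m $ i)" "\<And>K. length K = length I \<Longrightarrow> dx (\<lambda>q. S q K)"
  shows "pd k (\<lambda>q. act (B q) (S q) I) = act (\<chi> m i. pd k (\<lambda>q. B q $ m $ i)) (S x) I + act (B x) (\<lambda>K. pd k (\<lambda>q. S q K)) I"
proof (rule pd_eqI)
  show "dx (\<lambda>q. act (B q) (S q) I)"
    using assms unfolding dx_def act_def by (intro differentiable_sum differentiable_mult ballI) auto
  show "((\<lambda>\<sigma>. act (B (chart_inv c (y + \<sigma> *\<^sub>R axis k 1))) (S (chart_inv c (y + \<sigma> *\<^sub>R axis k 1))) I)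
     has_real_derivative act (\<chi> m i. pd k (\<lambda>q. B q $ m $ i)) (S x) I + act (B x) (\<lambda>K. pd k (\<lambda>q. S q K)) I) (at 0)"
    using has_real_derivative_act[where A = "\<lambda>\<sigma>. B (chart_inv c (y + \<sigma> *\<^sub>R axis k 1))" and S = "\<lambda>\<sigma>. S (chart_inv c (y + \<sigma> *\<^sub>R axis k 1))"
      and A' = "\<chi> m i. pd k (\<lambda>q. B q $ m $ i)" and S' = "\<lambda>K. pd k (\<lambda>q. S q K)" and I = I and F = "at 0" and \<sigma> = 0 and X = UNIV]
      pd_curve[OF assms(1)] pd_curve[OF assms(2)] by (simp add: inv_y)
qed

lemma dx_phi: "s \<in> J \<Longrightarrow> length I = 3 \<Longrightarrow> dx (\<lambda>q. \<phi> s c q I)"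
  unfolding dx_def by (rule phi_dx)

lemma dx_metric: "s \<in> J \<Longrightarrow> dx (\<lambda>q. G2_metric (\<phi> s c q) $ i $ j)"
  unfolding dx_def by (rule metric_dx)

lemma dx_h: "dx (\<lambda>q. h q $ i $ j)"
  unfolding dx_def by (intro differentiable_vec_nth smooth_on_differentiable[OF chart_facts(1) y_in_image h_smooth])

lemma dx_X: "dx (\<lambda>q. X q $ l)"
  unfolding dx_def by (intro differentiable_vec_nth smooth_on_differentiable[OF chart_facts(1) y_in_image X_smooth])

lemma dx_X3: "dx (\<lambda>q. X q $ l / 3)"
  using dx_X[of l] unfolding dx_def divide_inverse by (intro differentiable_mult) auto

abbreviation "low q \<equiv> flow_low (\<phi> t c q) (h q) (X q)"

lemma low_nth: "low q $ i $ j = h q $ j $ i + (\<Sum>l\<in>UNIV. X q $ l / 3 * \<phi> t c q [l,i,j])"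
  by (simp add: flow_low_def transpose_def)

lemma dx_low: "dx (\<lambda>q. low q $ i $ j)"
  using dx_h[of j i] dx_sum_mult[OF dx_X3 dx_phi[OF t], of "\<lambda>l. [l,i,j]"]
  unfolding low_nth dx_def by (simp add: differentiable_add)

lemma dx_A: "dx (\<lambda>q. A q $ m $ i)"
proof -
  have "dx (\<lambda>q. \<Sum>r\<in>UNIV. G2_inv_metric (\<phi> t c q) $ m $ r * low q $ r $ i)"
    using inv_metric_dx[OF t] dx_low by (intro dx_sum_mult) (simp_all add: dx_def)
  then show ?thesis by (simp add: A_def flow_mat_def matrix_matrix_mult_def)
qed

definition \<Gamma> :: "real \<Rightarrow> 7 \<Rightarrow> real^7^7" where
  "\<Gamma> s = chr_mat (levi_civita c (\<lambda>q. G2_metric (\<phi> s c q)) x)"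

definition W :: "real \<Rightarrow> 7 \<Rightarrow> real^7" where
  "W s k = G2_inv_metric (\<phi> s c x) *v full_torsion (\<phi> s) c x $ k"

lemmas levi_civita_flow = levi_civita_G2[OF chart x G2 phi_dx metric_dx]

lemma pd_metric:
  assumes s: "s \<in> J"
  shows "pd k (\<lambda>q. G2_metric (\<phi> s c q) $ i $ j) = act (\<Gamma> s k) (tensor2 (G2_metric (\<phi> s c x))) [i,j]"
  unfolding \<Gamma>_def by (rule levi_civita_flow(2)) (use s in auto)

lemma \<Gamma>_sym: "s \<in> J \<Longrightarrow> \<Gamma> s k $ m $ i = \<Gamma> s i $ m $ k"
  unfolding \<Gamma>_def chr_mat_def vec_lambda_beta by (rule levi_civita_flow(3)) auto

lemma \<Gamma>_eq:
  "s \<in> J \<Longrightarrow> \<Gamma> s k $ m $ i = christoffel (G2_inv_metric (\<phi> s c x)) (\<lambda>k i j. pd k (\<lambda>q. G2_metric (\<phi> s c q) $ i $ j)) m k i"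
  unfolding \<Gamma>_def chr_mat_def vec_lambda_beta by (subst levi_civita_flow(1)) auto

lemma torsion_W:
  assumes s: "s \<in> J"
  shows "full_torsion (\<phi> s) c x $ k = G2_metric (\<phi> s c x) *v W s k"
    "pd k (\<lambda>q. \<phi> s c q [i,j,l]) = act (\<Gamma> s k) (\<phi> s c x) [i,j,l] + int_prod (W s k) (G2_psi (\<phi> s c x)) [i,j,l]"
    "full_torsion (\<phi> s) c x $ k $ q = frame_torsion (\<phi> s c x) (\<lambda>I. pd k (\<lambda>q. \<phi> s c q I) - act (\<Gamma> s k) (\<phi> s c x) I) q"
proof -
  have f: "G2_form (\<phi> s c x)" by (rule G2[OF s x])
  obtain V where V: "\<And>l i j k. pd l (\<lambda>q. \<phi> s c q [i,j,k]) - act (\<Gamma> s l) (\<phi> s c x) [i,j,k] = int_prod (V l) (G2_psi (\<phi> s c x)) [i,j,k]"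
    using nabla_phi_int_prod[OF chart x G2[OF s] phi_dx[OF s] metric_dx[OF s]] unfolding \<Gamma>_def by blast
  then have N: "G2_nabla (\<phi> s) c l (\<phi> s c) x [i,j,k] = int_prod (V l) (G2_psi (\<phi> s c x)) [i,j,k]" for l i j k
    by (simp add: G2_nabla_def cov_deriv_act \<Gamma>_def)
  have "W s k = V k" for k
    by (simp add: W_def full_torsion_eq(1)[where \<phi> = "\<phi> s", OF f N] matrix_vector_mul_assoc G2_metric_inv(2)[OF f])
  then show "full_torsion (\<phi> s) c x $ k = G2_metric (\<phi> s c x) *v W s k"
    "pd k (\<lambda>q. \<phi> s c q [i,j,l]) = act (\<Gamma> s k) (\<phi> s c x) [i,j,l] + int_prod (W s k) (G2_psi (\<phi> s c x)) [i,j,l]"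
    using full_torsion_eq(1)[where \<phi> = "\<phi> s", OF f N] V[of k i j l] by simp_all
  show "full_torsion (\<phi> s) c x $ k $ q = frame_torsion (\<phi> s c x) (\<lambda>I. pd k (\<lambda>q. \<phi> s c q I) - act (\<Gamma> s k) (\<phi> s c x) I) q"
    unfolding full_torsion_eq(2)[where \<phi> = "\<phi> s", OF f N] G2_nabla_def cov_deriv_act[abs_def] \<Gamma>_def ..
qed

end

lemma act_add_right: "act A (\<lambda>K. S K + S' K) I = act A S I + act A S' I"
  by (simp add: act_def distrib_left sum.distrib)

lemma matrix_mul_add_rdistrib: "(P + Q) ** R = P ** R + Q ** (R :: real^'n^'n)"
  by (simp add: vec_eq_iff matrix_matrix_mult_def distrib_right sum.distrib)

lemma matrix_mul_diff_ldistrib: "R ** (P - Q) = R ** P - R ** (Q :: real^'n^'n)"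
  by (simp add: vec_eq_iff matrix_matrix_mult_def right_diff_distrib sum_subtractf)

section \<open>Time derivatives of the connection and the torsion\<close>

context G2_flow
begin

definition dt :: "(real \<Rightarrow> real) \<Rightarrow> real" where
  "dt g = (SOME D. (g has_real_derivative D) (at t within J))"

lemma dt_works: "has_deriv (at t within J) g \<Longrightarrow> (g has_real_derivative dt g) (at t within J)"
  unfolding has_deriv_def dt_def by (rule someI_ex)

lemma dt_unique:
  assumes "(g has_real_derivative D) (at t within J)" "(g has_real_derivative D') (at t within J)"
  shows "D = D'"
  by (rule has_real_derivative_interval_unique[OF assms J t])

text \<open>The Christoffel formula is polynomial in the inverse metric and the partial derivatives
  of the metric; the latter are differentiable in time by the exchange of derivatives.\<close>

lemma \<Gamma>_deriv: "has_deriv (at t within J) (\<lambda>s. \<Gamma> s k $ m $ i)"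
proof (rule has_deriv_cong_on[OF t \<Gamma>_eq])
  show "has_deriv (at t within J) (\<lambda>s. christoffel (G2_inv_metric (\<phi> s c x)) (\<lambda>k i j. pd k (\<lambda>q. G2_metric (\<phi> s c q) $ i $ j)) m k i)"
    unfolding christoffel_def by (intro has_deriv_intros inv_metric_dt has_derivI[OF partial_metric_dt])
qed

lemma act_\<Gamma>_deriv: "length I = 3 \<Longrightarrow> has_deriv (at t within J) (\<lambda>s. act (\<Gamma> s k) (\<phi> s c x) I)"
  unfolding act_def by (intro has_deriv_intros \<Gamma>_deriv has_derivI[OF phi_dt[OF x]]) simp

text \<open>\<open>frame_torsion\<close> expresses the torsion polynomially through quantities
  already known to be differentiable in time.\<close>

lemma torsion_deriv: "has_deriv (at t within J) (\<lambda>s. full_torsion (\<phi> s) c x $ k $ q)"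
proof (rule has_deriv_cong_on[OF t torsion_W(3)])
  show "has_deriv (at t within J) (\<lambda>s. frame_torsion (\<phi> s c x) (\<lambda>I. pd k (\<lambda>q. \<phi> s c q I) - act (\<Gamma> s k) (\<phi> s c x) I) q)"
    unfolding frame_torsion_def con2_def
    by (intro has_deriv_intros inv_metric_dt act_\<Gamma>_deriv has_derivI[OF phi_dt[OF x]] has_derivI[OF partial_phi_dt]) simp_all
qed

lemma W_deriv: "has_deriv (at t within J) (\<lambda>s. W s k $ m)"
  unfolding W_def matrix_vector_mult_def vec_lambda_beta by (intro has_deriv_intros inv_metric_dt torsion_deriv)

definition \<Gamma>' :: "7 \<Rightarrow> real^7^7" where
  "\<Gamma>' k = (\<chi> m i. dt (\<lambda>s. \<Gamma> s k $ m $ i))"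

definition W' :: "7 \<Rightarrow> real^7" where
  "W' k = (\<chi> m. dt (\<lambda>s. W s k $ m))"

definition dA :: "7 \<Rightarrow> real^7^7" where
  "dA k = (\<chi> m i. pd k (\<lambda>q. A q $ m $ i))"

lemma \<Gamma>_dt: "((\<lambda>s. \<Gamma> s k $ m $ i) has_real_derivative \<Gamma>' k $ m $ i) (at t within J)"
  by (simp add: \<Gamma>'_def dt_works \<Gamma>_deriv)

lemma W_dt: "((\<lambda>s. W s k $ m) has_real_derivative W' k $ m) (at t within J)"
  by (simp add: W'_def dt_works W_deriv)

lemma transfer_dt:
  assumes "\<And>s. s \<in> J \<Longrightarrow> g s = g' s" "(g' has_real_derivative D) (at t within J)"
  shows "(g has_real_derivative D) (at t within J)"
  by (rule has_field_derivative_transform_within[OF assms(2) zero_less_one t]) (simp add: assms(1))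

lemma \<Gamma>'_sym: "\<Gamma>' k $ m $ i = \<Gamma>' i $ m $ k"
  by (rule dt_unique[OF \<Gamma>_dt]) (rule transfer_dt[OF \<Gamma>_sym \<Gamma>_dt])

abbreviation "f \<equiv> \<phi> t c x"
abbreviation "G \<equiv> G2_metric f"

lemma f: "G2_form f" by (rule G2[OF t x])

text \<open>The time derivative of \<open>pd_metric\<close> is taken on both sides. On the left,
  exchanging derivatives gives \<open>dA\<close> acting on g plus \<open>A\<close> acting on
  \<Gamma>.g; on the right the product rule gives \<Gamma>'.g plus \<Gamma> acting on A.g.
  \<open>act_commutator\<close> collects the double actions.\<close>

lemma metric_rate:
  "act (dA k + \<Gamma> t k ** A x - A x ** \<Gamma> t k - \<Gamma>' k) (tensor2 G) [i,j] = 0"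
proof -
  have c: "act (A x) (\<lambda>K. pd k (\<lambda>q. tensor2 (G2_metric (\<phi> t c q)) K)) [i,j] = act (A x) (act (\<Gamma> t k) (tensor2 G)) [i,j]"
  proof (rule act_cong)
    fix K :: "7 list" assume "length K = length [i,j]"
    then obtain a b where "K = [a,b]" using length_2_cases[of K] by auto
    then show "pd k (\<lambda>q. tensor2 (G2_metric (\<phi> t c q)) K) = act (\<Gamma> t k) (tensor2 G) K"
      by (simp add: tensor2_def[of _ "[_,_]"] pd_metric[OF t])
  qed
  have "((\<lambda>s. act (\<Gamma> s k) (tensor2 (G2_metric (\<phi> s c x))) [i,j]) has_real_derivative
      act (\<Gamma>' k) (tensor2 G) [i,j] + act (\<Gamma> t k) (act (A x) (tensor2 G)) [i,j]) (at t within J)" (is "(_ has_real_derivative ?R) _")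
  proof (rule has_real_derivative_act[OF \<Gamma>_dt _ refl])
    fix K :: "7 list" assume "length K = length [i,j]"
    then obtain a b where "K = [a,b]" using length_2_cases[of K] by auto
    then show "((\<lambda>s. tensor2 (G2_metric (\<phi> s c x)) K) has_real_derivative act (A x) (tensor2 G) K) (at t within J)"
      using metric_dt[OF x, of a b] by (simp add: tensor2_def[of _ "[_,_]"])
  qed
  then have "pd k (\<lambda>q. act (A q) (tensor2 (G2_metric (\<phi> t c q))) [i,j]) = ?R"
    by (rule dt_unique[OF partial_metric_dt transfer_dt, rotated]) (rule pd_metric)
  then
  have "act (dA k) (tensor2 G) [i,j] + act (A x) (act (\<Gamma> t k) (tensor2 G)) [i,j]
      = act (\<Gamma>' k) (tensor2 G) [i,j] + act (\<Gamma> t k) (act (A x) (tensor2 G)) [i,j]"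
    unfolding c[symmetric] dA_def by (subst (asm) pd_act) (simp_all add: dx_A tensor2_def dx_metric t)
  then show ?thesis
    using act_commutator[of "A x" "\<Gamma> t k" "tensor2 G" "[i,j]"] by (simp add: act_diff act_add)
qed

text \<open>The argument of \<open>metric_rate\<close> applied to \<open>torsion_W(2)\<close>. The
  terms W \<lrcorner> (A.\<psi>) and A.(W \<lrcorner> \<psi>) differ by (A W) \<lrcorner> \<psi>, by
  \<open>int_prod_act\<close>, which explains the vector on the right.\<close>

lemma phi_rate:
  "act (dA k + \<Gamma> t k ** A x - A x ** \<Gamma> t k - \<Gamma>' k) f [i,j,l] = int_prod (W' k + A x *v W t k) (G2_psi f) [i,j,l]"
proof -
  let ?\<psi> = "\<lambda>s. G2_psi (\<phi> s c x)"
  have c: "act (A x) (\<lambda>K. pd k (\<lambda>q. \<phi> t c q K)) [i,j,l] = act (A x) (act (\<Gamma> t k) f) [i,j,l] + act (A x) (int_prod (W t k) (?\<psi> t)) [i,j,l]"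
    unfolding act_add_right[symmetric]
  proof (rule act_cong)
    fix K :: "7 list" assume "length K = length [i,j,l]"
    then obtain a b d where "K = [a,b,d]" using length_3_cases[of K] by auto
    then show "pd k (\<lambda>q. \<phi> t c q K) = act (\<Gamma> t k) f K + int_prod (W t k) (?\<psi> t) K"
      by (simp add: torsion_W(2)[OF t])
  qed
  have "((\<lambda>s. act (\<Gamma> s k) (\<phi> s c x) [i,j,l]) has_real_derivative
      act (\<Gamma>' k) f [i,j,l] + act (\<Gamma> t k) (act (A x) f) [i,j,l]) (at t within J)"
    by (rule has_real_derivative_act[OF \<Gamma>_dt phi_dt[OF x] refl]) simp
  moreover have "((\<lambda>s. int_prod (W s k) (?\<psi> s) [i,j,l]) has_real_derivative
      int_prod (W' k) (?\<psi> t) [i,j,l] + int_prod (W t k) (act (A x) (?\<psi> t)) [i,j,l]) (at t within J)"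
  proof -
    have "((\<lambda>s. int_prod (W s k) (?\<psi> s) [i,j,l]) has_real_derivative
        (\<Sum>n\<in>UNIV. W' k $ n * ?\<psi> t [n,i,j,l] + act (A x) (?\<psi> t) [n,i,j,l] * W t k $ n)) (at t within J)"
      unfolding int_prod_def by (intro DERIV_sum DERIV_mult W_dt psi_dt) simp
    then show ?thesis by (simp add: int_prod_def sum.distrib mult.commute)
  qed
  ultimately have "((\<lambda>s. act (\<Gamma> s k) (\<phi> s c x) [i,j,l] + int_prod (W s k) (?\<psi> s) [i,j,l]) has_real_derivative
      act (\<Gamma>' k) f [i,j,l] + act (\<Gamma> t k) (act (A x) f) [i,j,l]
      + (int_prod (W' k) (?\<psi> t) [i,j,l] + int_prod (W t k) (act (A x) (?\<psi> t)) [i,j,l])) (at t within J)" (is "(_ has_real_derivative ?R) _")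
    by (rule DERIV_add)
  then have "pd k (\<lambda>q. act (A q) (\<phi> t c q) [i,j,l]) = ?R"
    by (rule dt_unique[OF partial_phi_dt transfer_dt, rotated 2]) (simp_all add: torsion_W(2))
  then
  have "act (dA k) f [i,j,l] + (act (A x) (act (\<Gamma> t k) f) [i,j,l] + act (A x) (int_prod (W t k) (?\<psi> t)) [i,j,l])
      = act (\<Gamma>' k) f [i,j,l] + act (\<Gamma> t k) (act (A x) f) [i,j,l]
      + (int_prod (W' k) (?\<psi> t) [i,j,l] + int_prod (W t k) (act (A x) (?\<psi> t)) [i,j,l])"
    unfolding c[symmetric] dA_def by (subst (asm) pd_act) (simp_all add: dx_A dx_phi t)
  moreover have "int_prod (W' k + A x *v W t k) (?\<psi> t) [i,j,l] = int_prod (W' k) (?\<psi> t) [i,j,l] + int_prod (A x *v W t k) (?\<psi> t) [i,j,l]"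
    by (simp add: int_prod_def distrib_right sum.distrib)
  ultimately show ?thesis
    using act_commutator[of "A x" "\<Gamma> t k" f "[i,j,l]"] by (simp add: act_diff act_add int_prod_act)
qed

section \<open>Covariant derivatives of the generator of the flow\<close>

lemma lowered_A: "q \<in> chart_dom c \<Longrightarrow> low q = G2_metric (\<phi> t c q) ** A q"
  by (simp add: A_def flow_mat_def matrix_mul_assoc G2_metric_inv(1)[OF G2[OF t]])

definition C :: "7 \<Rightarrow> real^7^7" where
  "C k = (\<chi> i j. pd k (\<lambda>q. low q $ i $ j) - act (\<Gamma> t k) (tensor2 (low x)) [i,j])"

text \<open>The bracket is the covariant derivative of the endomorphism \<open>A\<close>, and
  \<open>C\<close> that of its lowered form. They correspond because the metric is parallel.\<close>

lemma C_eq_dA: "G ** (dA k + \<Gamma> t k ** A x - A x ** \<Gamma> t k) = C k"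
proof -
  have "C k $ i $ j = (G ** (dA k + \<Gamma> t k ** A x - A x ** \<Gamma> t k)) $ i $ j" for i j
  proof -
    have "pd k (\<lambda>q. low q $ i $ j) = pd k (\<lambda>q. \<Sum>m\<in>UNIV. G2_metric (\<phi> t c q) $ i $ m * A q $ m $ j)"
      by (rule partial_deriv_cong[OF chart x]) (simp add: lowered_A matrix_matrix_mult_def)
    also have "\<dots> = (\<Sum>m\<in>UNIV. act (\<Gamma> t k) (tensor2 G) [i,m] * A x $ m $ j + G $ i $ m * dA k $ m $ j)"
      by (subst pd_sum_mult) (simp_all add: dx_metric t dx_A pd_metric dA_def)
    also have "\<dots> = ((transpose (\<Gamma> t k) ** G + G ** \<Gamma> t k) ** A x + G ** dA k) $ i $ j"
      by (simp add: act_tensor2_matrix matrix_matrix_mult_def[of _ "A x"] matrix_matrix_mult_def[of _ "dA k"] sum.distrib)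
    finally have p: "pd k (\<lambda>q. low q $ i $ j) = ((transpose (\<Gamma> t k) ** G + G ** \<Gamma> t k) ** A x + G ** dA k) $ i $ j" .
    have a: "act (\<Gamma> t k) (tensor2 (low x)) [i,j] = (transpose (\<Gamma> t k) ** (G ** A x) + (G ** A x) ** \<Gamma> t k) $ i $ j"
      by (simp add: act_tensor2_matrix lowered_A[OF x])
    have "(transpose (\<Gamma> t k) ** G + G ** \<Gamma> t k) ** A x + G ** dA k - (transpose (\<Gamma> t k) ** (G ** A x) + (G ** A x) ** \<Gamma> t k)
        = G ** (dA k + \<Gamma> t k ** A x - A x ** \<Gamma> t k)"
      by (simp add: matrix_mul_add_rdistrib matrix_add_ldistrib matrix_mul_diff_ldistrib matrix_mul_assoc)
    then show ?thesis
      unfolding C_def vec_lambda_beta p a by (metis vector_minus_component)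
  qed
  then show ?thesis by (simp add: vec_eq_iff)
qed

definition Hn :: "7 \<Rightarrow> 7 \<Rightarrow> 7 \<Rightarrow> real" where
  "Hn k i j = G2_nabla (\<phi> t) c k (\<lambda>y. tensor2 (h y)) x [i,j]"

text \<open>The covariant derivative of \<open>X\<close>, whose index is upper, hence the plus sign
  before the connection term.\<close>

definition Y :: "7 \<Rightarrow> real^7" where
  "Y k = (\<chi> l. pd k (\<lambda>q. X q $ l)) + \<Gamma> t k *v X x"

lemma Hn_eq: "Hn k i j = pd k (\<lambda>q. h q $ i $ j) - act (\<Gamma> t k) (tensor2 (h x)) [i,j]"
  by (simp add: Hn_def G2_nabla_def cov_deriv_act \<Gamma>_def tensor2_def[of _ "[_,_]"])

lemma h_nth: "q \<in> chart_dom c \<Longrightarrow> h q $ j $ i = h q $ i $ j"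
  using arg_cong[OF h_sym, of q "\<lambda>m. m $ i $ j"] by (simp add: transpose_def)

lemma Hn_sym: "Hn k i j = Hn k j i"
proof -
  have "pd k (\<lambda>q. h q $ i $ j) = pd k (\<lambda>q. h q $ j $ i)"
    by (rule partial_deriv_cong[OF chart x]) (rule h_nth)
  then show ?thesis
    by (simp add: Hn_eq act_tensor2 h_nth[OF x, of i] h_nth[OF x, of j])
qed

text \<open>The Leibniz rule for \<open>h + X^l \<phi>_l / 3\<close>: the derivative falls on
  \<open>h\<close>, on \<open>X\<close> (giving \<open>Y\<close>) or on \<phi>, where it produces W
  \<lrcorner> \<psi>.\<close>

lemma C_eq:
  "C k $ i $ j = Hn k i j + (\<Sum>l\<in>UNIV. Y k $ l / 3 * f [l,i,j])
     + (\<Sum>l\<in>UNIV. X x $ l / 3 * int_prod (W t k) (G2_psi f) [l,i,j])"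
proof -
  let ?N = "\<lambda>q. \<chi> i j. \<Sum>l\<in>UNIV. X q $ l / 3 * \<phi> t c q [l,i,j]"
  have X3: "pd k (\<lambda>q. X q $ l / 3) = pd k (\<lambda>q. X q $ l) / 3" for l
    by (rule pd_eqI[OF dx_X3]) (rule DERIV_cdivide[OF pd_curve[OF dx_X]])
  have dN: "pd k (\<lambda>q. ?N q $ i $ j) = (\<Sum>l\<in>UNIV. pd k (\<lambda>q. X q $ l) / 3 * f [l,i,j]
      + X x $ l / 3 * (act (\<Gamma> t k) f [l,i,j] + int_prod (W t k) (G2_psi f) [l,i,j]))"
    unfolding vec_lambda_beta by (subst pd_sum_mult) (simp_all add: dx_X3 dx_phi t X3 torsion_W(2))
  have "pd k (\<lambda>q. low q $ i $ j) = pd k (\<lambda>q. h q $ j $ i) + pd k (\<lambda>q. ?N q $ i $ j)"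
  proof (rule pd_eqI[OF dx_low])
    have "dx (\<lambda>q. ?N q $ i $ j)"
      unfolding vec_lambda_beta by (rule dx_sum_mult[OF dx_X3 dx_phi[OF t]]) simp
    from DERIV_add[OF pd_curve[OF dx_h] pd_curve[OF this]]
    show "((\<lambda>\<sigma>. low (chart_inv c (y + \<sigma> *\<^sub>R axis k 1)) $ i $ j) has_real_derivative
        pd k (\<lambda>q. h q $ j $ i) + pd k (\<lambda>q. ?N q $ i $ j)) (at 0)"
      by (simp add: low_nth)
  qed
  moreover have "low x = transpose (h x) + ?N x" by (simp add: flow_low_def)
  then have "act (\<Gamma> t k) (tensor2 (low x)) [i,j] = act (\<Gamma> t k) (tensor2 (h x)) [i,j] + act (\<Gamma> t k) (tensor2 (?N x)) [i,j]"
    by (simp add: h_sym[OF x] act_tensor2 distrib_left sum.distrib)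
  ultimately have "C k $ i $ j = Hn k i j + (pd k (\<lambda>q. ?N q $ i $ j) - act (\<Gamma> t k) (tensor2 (?N x)) [i,j])"
    using Hn_sym[of k i j] by (simp add: C_def Hn_eq act_tensor2 h_nth[OF x])
  moreover have "pd k (\<lambda>q. ?N q $ i $ j) - act (\<Gamma> t k) (tensor2 (?N x)) [i,j]
      = (\<Sum>l\<in>UNIV. Y k $ l / 3 * f [l,i,j]) + (\<Sum>l\<in>UNIV. X x $ l / 3 * int_prod (W t k) (G2_psi f) [l,i,j])"
  proof -
    have a3: "act (\<Gamma> t k) f [l,i,j] = (\<Sum>m\<in>UNIV. \<Gamma> t k $ m $ l * f [m,i,j]) + (\<Sum>m\<in>UNIV. \<Gamma> t k $ m $ i * f [l,m,j]) + (\<Sum>m\<in>UNIV. \<Gamma> t k $ m $ j * f [l,i,m])" for l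
      by (simp add: act_3 sum.distrib)
    \<comment> \<open>Of the three connection terms of \<phi>, the one in the contracted slot passes
      to \<open>X\<close> and completes \<open>Y\<close>; the other two cancel against the
      connection terms of the contracted 2-tensor.\<close>
    have s1: "(\<Sum>l\<in>UNIV. X x $ l / 3 * (\<Sum>m\<in>UNIV. \<Gamma> t k $ m $ l * f [m,i,j])) = (\<Sum>l\<in>UNIV. (\<Gamma> t k *v X x) $ l / 3 * f [l,i,j])"
      unfolding sum_distrib_left by (subst sum.swap) (simp add: matrix_vector_mult_def sum_distrib_left sum_distrib_right sum_divide_distrib mult_ac)
    have s2: "(\<Sum>l\<in>UNIV. X x $ l / 3 * (\<Sum>m\<in>UNIV. \<Gamma> t k $ m $ i * f [l,m,j])) = (\<Sum>m\<in>UNIV. \<Gamma> t k $ m $ i * ?N x $ m $ j)"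
      unfolding sum_distrib_left vec_lambda_beta by (subst sum.swap) (simp add: mult_ac)
    have s3: "(\<Sum>l\<in>UNIV. X x $ l / 3 * (\<Sum>m\<in>UNIV. \<Gamma> t k $ m $ j * f [l,i,m])) = (\<Sum>m\<in>UNIV. \<Gamma> t k $ m $ j * ?N x $ i $ m)"
      unfolding sum_distrib_left vec_lambda_beta by (subst sum.swap) (simp add: mult_ac)
    have Yk: "(\<Sum>l\<in>UNIV. Y k $ l / 3 * f [l,i,j]) = (\<Sum>l\<in>UNIV. pd k (\<lambda>q. X q $ l) / 3 * f [l,i,j]) + (\<Sum>l\<in>UNIV. (\<Gamma> t k *v X x) $ l / 3 * f [l,i,j])"
      by (simp add: Y_def add_divide_distrib distrib_right sum.distrib)
    show ?thesis
      unfolding dN Yk a3 act_tensor2 distrib_left sum.distrib s1 s2 s3 by simp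
  qed
  ultimately show ?thesis by simp
qed

text \<open>Lowering commutes with the connection: the part of the metric's derivative that hits the
  free index cancels the connection term of the covector.\<close>

lemma nabla_lower_X:
  "G2_nabla (\<phi> t) c p (\<lambda>q. tensor1 (lower (\<phi> t c q) (X q))) x [q] = (G *v Y p) $ q"
proof -
  have "G2_nabla (\<phi> t) c p (\<lambda>q. tensor1 (lower (\<phi> t c q) (X q))) x [q]
      = pd p (\<lambda>z. \<Sum>m\<in>UNIV. G2_metric (\<phi> t c z) $ q $ m * X z $ m) - (\<Sum>m\<in>UNIV. \<Gamma> t p $ m $ q * (G *v X x) $ m)"
    by (simp add: G2_nabla_def cov_deriv_act \<Gamma>_def tensor1_def lower_def act_def matrix_vector_mult_def)
  also have "pd p (\<lambda>z. \<Sum>m\<in>UNIV. G2_metric (\<phi> t c z) $ q $ m * X z $ m)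
      = (\<Sum>m\<in>UNIV. act (\<Gamma> t p) (tensor2 G) [q,m] * X x $ m + G $ q $ m * pd p (\<lambda>z. X z $ m))"
    by (subst pd_sum_mult) (simp_all add: dx_metric t dx_X pd_metric)
  also have "\<dots> = (transpose (\<Gamma> t p) *v (G *v X x) + G *v (\<Gamma> t p *v X x) + G *v (\<chi> m. pd p (\<lambda>z. X z $ m))) $ q"
    unfolding matrix_vector_mul_assoc matrix_vector_mult_add_rdistrib[symmetric]
    by (simp add: act_tensor2_matrix matrix_vector_mult_def sum.distrib)
  also have tv: "(\<Sum>m\<in>UNIV. \<Gamma> t p $ m $ q * (G *v X x) $ m) = (transpose (\<Gamma> t p) *v (G *v X x)) $ q"
    unfolding matrix_vector_mult_def[of "transpose _"] by (simp add: transpose_def)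
  also have "(transpose (\<Gamma> t p) *v (G *v X x) + G *v (\<Gamma> t p *v X x) + G *v (\<chi> m. pd p (\<lambda>z. X z $ m))) $ q
      - (transpose (\<Gamma> t p) *v (G *v X x)) $ q = (G *v Y p) $ q"
    unfolding Y_def matrix_vector_right_distrib vector_add_component by simp
  finally show ?thesis .
qed

text \<open>Product rule for a row G W of the torsion; the rate of the metric contributes both the
  transposed term and \<open>G A W\<close>.\<close>

lemma torsion_dt:
  "((\<lambda>s. full_torsion (\<phi> s) c x $ p $ q) has_real_derivative
     (transpose (A x) *v (G *v W t p) + G *v (W' p + A x *v W t p)) $ q) (at t within J)"
proof -
  have "((\<lambda>s. \<Sum>m\<in>UNIV. G2_metric (\<phi> s c x) $ q $ m * W s p $ m) has_real_derivative
      (\<Sum>m\<in>UNIV. act (A x) (tensor2 G) [q,m] * W t p $ m + W' p $ m * G $ q $ m)) (at t within J)"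
    by (intro DERIV_sum DERIV_mult metric_dt[OF x] W_dt)
  moreover have "(\<Sum>m\<in>UNIV. act (A x) (tensor2 G) [q,m] * W t p $ m + W' p $ m * G $ q $ m)
      = (transpose (A x) *v (G *v W t p) + G *v (W' p + A x *v W t p)) $ q"
    unfolding matrix_vector_right_distrib matrix_vector_mul_assoc
    by (simp add: act_tensor2_matrix matrix_vector_mult_def sum.distrib distrib_left mult.commute[of _ "W t p $ _"] mult.commute[of "W' p $ _"])
  ultimately show ?thesis
    by (intro transfer_dt[OF arg_cong[OF torsion_W(1)[of _ p], where f = "\<lambda>v. v $ q"]]) (simp_all add: matrix_vector_mult_def)
qed

lemma torsion_evolution:
  "((\<lambda>s. full_torsion (\<phi> s) c x $ p $ q) has_real_derivative
      (let f = \<phi> t c x; T = full_torsion (\<phi> t) c x; ginv = G2_inv_metric f in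
        (\<Sum>l\<in>UNIV. \<Sum>m\<in>UNIV. T $ p $ l * ginv $ l $ m * h x $ m $ q)
      + (\<Sum>l\<in>UNIV. \<Sum>m\<in>UNIV. T $ p $ l * ginv $ l $ m * (\<Sum>k\<in>UNIV. X x $ k * f [k, m, q]))
      + (\<Sum>k\<in>UNIV. \<Sum>i\<in>UNIV. \<Sum>a\<in>UNIV. \<Sum>b\<in>UNIV.
           G2_nabla (\<phi> t) c k (\<lambda>y. tensor2 (h y)) x [i, p]
             * ginv $ k $ a * ginv $ i $ b * f [a, b, q])
      + G2_nabla (\<phi> t) c p (\<lambda>y. tensor1 (lower (\<phi> t c y) (X y))) x [q]))
     (at t within J)"
  using torsion_dt[of p q]
  unfolding torsion_rate[where f = f and h = "h x" and X = "X x" and \<Gamma>' = \<Gamma>' and \<Gamma> = "\<Gamma> t" and dA = dA and C = C and Hn = Hn and Y = Y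
      and W = "W t" and W' = W', folded A_def[of x], OF f h_sym[OF x] \<Gamma>'_sym Hn_sym C_eq_dA C_eq metric_rate phi_rate]
  by (simp only: Let_def torsion_W(1)[OF t] nabla_lower_X Hn_def)

end

theorem theorem3p8:
  fixes M :: "'a topology" and A :: "'a chart set" and J :: "real set"
    and \<phi> :: "real \<Rightarrow> 'a chart \<Rightarrow> 'a \<Rightarrow> tensor"
    and h :: "real \<Rightarrow> 'a chart \<Rightarrow> 'a \<Rightarrow> real^7^7"
    and X :: "real \<Rightarrow> 'a chart \<Rightarrow> 'a \<Rightarrow> real^7"
  assumes "smooth_manifold7 M A"
    and "is_interval J" and "interior J \<noteq> {}"
    and "smooth_G2_family M A J \<phi>"
    and "\<And>t. t \<in> J \<Longrightarrow> symmetric_2tensor M A (h t)"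
    and "\<And>t. t \<in> J \<Longrightarrow> vector_field M A (X t)"
    and flow: "\<And>t c x i j k. t \<in> J \<Longrightarrow> c \<in> A \<Longrightarrow> x \<in> chart_dom c \<Longrightarrow>
      ((\<lambda>s. \<phi> s c x [i, j, k]) has_real_derivative
         flow_rhs (\<phi> t c x) (h t c x) (X t c x) i j k) (at t within J)"
    and "t \<in> J" and "c \<in> A" and "x \<in> chart_dom c"
  shows "((\<lambda>s. full_torsion (\<phi> s) c x $ p $ q) has_real_derivative
      (let f = \<phi> t c x; T = full_torsion (\<phi> t) c x; ginv = G2_inv_metric f in
        (\<Sum>l\<in>UNIV. \<Sum>m\<in>UNIV. T $ p $ l * ginv $ l $ m * h t c x $ m $ q)
      + (\<Sum>l\<in>UNIV. \<Sum>m\<in>UNIV. T $ p $ l * ginv $ l $ m * (\<Sum>k\<in>UNIV. X t c x $ k * f [k, m, q]))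
      + (\<Sum>k\<in>UNIV. \<Sum>i\<in>UNIV. \<Sum>a\<in>UNIV. \<Sum>b\<in>UNIV.
           G2_nabla (\<phi> t) c k (\<lambda>y. tensor2 (h t c y)) x [i, p]
             * ginv $ k $ a * ginv $ i $ b * f [a, b, q])
      + G2_nabla (\<phi> t) c p (\<lambda>y. tensor1 (lower (\<phi> t c y) (X t c y))) x [q]))
     (at t within J)"
  proof -
  \<comment> \<open>The evolution equation is an identity of components in the chart
    \<open>c\<close>, so this one chart carries the whole argument.\<close>
  have "G2_flow M c x J \<phi> (h t c) (X t c) t"
  proof
    show "chart_on M c" using assms(1,9) by (auto simp: smooth_manifold7_def)
    show "x \<in> chart_dom c" "is_interval J" "interior J \<noteq> {}" "t \<in> J" by fact+
    show "smooth_on (\<lambda>(t, y). \<phi> t c (chart_inv c y) I) (J \<times> chart_image c)" if "length I = 3" for I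
      using assms(4,9) that by (auto simp: smooth_G2_family_def)
    show "G2_form (\<phi> s c q)" if "s \<in> J" "q \<in> chart_dom c" for s q
      using assms(4,9) that by (auto simp: smooth_G2_family_def G2_structure_def)
    show "smooth_on (\<lambda>y. h t c (chart_inv c y)) (chart_image c)"
      using assms(5)[OF assms(8)] assms(9) unfolding symmetric_2tensor_def by blast
    show "transpose (h t c q) = h t c q" if "q \<in> chart_dom c" for q
      using assms(5)[OF assms(8)] assms(9) that unfolding symmetric_2tensor_def by blast
    show "smooth_on (\<lambda>y. X t c (chart_inv c y)) (chart_image c)"
      using assms(6)[OF assms(8)] assms(9) unfolding vector_field_def by blast
    show "((\<lambda>s. \<phi> s c q [i, j, k]) has_real_derivative flow_rhs (\<phi> t c q) (h t c q) (X t c q) i j k) (at t within J)"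
      if "q \<in> chart_dom c" for q i j k
      using flow[OF assms(8,9) that] .
  qed
  then show ?thesis
    by (rule G2_flow.torsion_evolution)
qed

end
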